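(* Let $n=\{n_0,n_1,n_2\}$ and $\mathbf G_{\mathrm b}=\{B,B_I\}$ be such that $\{n,\mathbf G_{\mathrm b}\}$ is admissible, let $\mathcal T$ be the associated partial integral operator and $X$ the associated domain, and let $\mathcal D=\mathrm{diag}(I_{n_0},\partial_sI_{n_1},\partial_s^2I_{n_2})$. Then: (a) If $\mathbf x\in X$, then $\mathcal D\mathbf x\in L_2^{n_{\mathbf x}}[a,b]$ and $\mathbf x=\mathcal T\mathcal D\mathbf x$. (b) For any $\hat{\mathbf x}\in L_2^{n_{\mathbf x}}[a,b]$, $\mathcal T\hat{\mathbf x}\in X$ and $\hat{\mathbf x}=\mathcal D\mathcal T\hat{\mathbf x}$.
   Context: **Basic notation.** $[a,b]$ is a compact real interval. $L_2^m=L_2^m[a,b]$ is the Hilbert space of $\mathbb R^m$-valued square-integrable functions, and $W_k^m=\{\mathbf u\in L_2^m:\partial_s^l\mathbf u\in L_2^m\text{ for all }l\le k\}$. For matrix functions $R_0(s),R_1(s,\theta),R_2(s,\theta)$, $\mathcal P_{\{R_i\}}$ denotes the operator $$(\mathcal P_{\{R_i\}}\mathbf v)(s)=R_0(s)\mathbf v(s)+\int_a^sR_1(s,\theta)\mathbf v(\theta)\,d\theta+\int_s^bR_2(s,\theta)\mathbf v(\theta)\,d\theta .$$ **Continuity parameter.** $n=\{n_0,n_1,n_2\}$ are nonnegative integers; $n_{\mathbf x}=n_0+n_1+n_2$, $n_S=n_1+2n_2$, $W^n=W_0^{n_0}\times W_1^{n_1}\times W_2^{n_2}$. For $\mathbf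 x=\mathrm{col}(\mathbf x_0,\mathbf x_1,\mathbf x_2)\in W^n$ set $\mathbf x_c=\mathrm{col}(\mathbf x_1,\mathbf x_2,\partial_s\mathbf x_2)$ and $\mathbf x_D=\mathrm{col}(\mathbf x_0,\mathbf x_1,\mathbf x_2,\partial_s\mathbf x_1,\partial_s\mathbf x_2,\partial_s^2\mathbf x_2)$. **Boundary conditions.** $\mathbf G_{\mathrm b}=\{B,B_I\}$ with $B\in\mathbb R^{n_{BC}\times 2n_S}$ and $B_I:[a,b]\to\mathbb R^{n_{BC}\times(n_{\mathbf x}+n_S)}$ square integrable. Define $$X=\Big\{\mathbf x\in W^n: B\begin{bmatrix}\mathbf x_c(a)\\ \mathbf x_c(b)\end{bmatrix}=\int_a^bB_I(s)\mathbf x_D(s)\,ds\Big\}.$$ **Admissibility and construction of $\mathcal T$.** Blocks of rows/columns of size zero are omitted. $$T(s)=\begin{bmatrix}I_{n_1}&0&0\\ 0&I_{n_2}&sI_{n_2}\\ 0&0&I_{n_2}\end{bmatrix},\qquad Q(s)=\begin{bmatrix}0_{n_1\times n_0}&I_{n_1}&0\\ 0&0&sI_{n_2}\\ 0&0&I_{n_2}\end{bmatrix},$$ and $T_1(s),Q_1(s)$ are the first $n_1+n_2$ rows of $T(s),Q(s)$. The constant matrices $U_1\in\mathbb R^{(n_{\mathbf x}+n_S)\times n_{\mathbf x}}$ and $U_2\in\mathbb R^{(n_{\mathbf x}+n_S)\times n_S}$ are $U_1=\mathrm{diag}(U_{10},U_{11},U_{12})$ with $U_{10}=\begin{bmatrix}I_{n_0}\\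 0_{(n_1+n_2)\times n_0}\end{bmatrix}$, $U_{11}=\begin{bmatrix}I_{n_1}\\ 0_{n_2\times n_1}\end{bmatrix}$, $U_{12}=I_{n_2}$, and $U_2=\begin{bmatrix}\mathrm{diag}(U_{20},U_{21})\\ 0_{n_2\times n_S}\end{bmatrix}$ with $U_{20}=\begin{bmatrix}0_{n_0\times(n_1+n_2)}\\ I_{n_1+n_2}\end{bmatrix}$, $U_{21}=\begin{bmatrix}0_{n_1\times n_2}\\ I_{n_2}\end{bmatrix}$. Let $$B_T=B\begin{bmatrix}T(0)\\ T(b-a)\end{bmatrix}-\int_a^bB_I(s)U_2T(s-a)\,ds\in\mathbb R^{n_{BC}\times n_S}.$$ The pair $\{n,\mathbf G_{\mathrm b}\}$ is **admissible** if $B_T$ is invertible (in particular $n_{BC}=n_S$). In that case let $$B_Q(s)=B_T^{-1}\Big(B_I(s)U_1-B\begin{bmatrix}0\\ Q(b-s)\end{bmatrix}+\int_s^bB_I(\theta)U_2Q(\theta-s)\,d\theta\Big),$$ $$G_0=\begin{bmatrix}I_{n_0}&0\\ 0&0_{n_{\mathbf x}-n_0}\end{bmatrix},\quad G_2(s,\theta)=\begin{bmatrix}0_{n_0\times n_{\mathbf x}}\\ T_1(s-a)B_Q(\theta)\end{bmatrix},\quad G_1(s,\theta)=\begin{bmatrix}0_{n_0\times n_{\mathbf x}}\\ Q_1(s-\theta)\end{bmatrix}+G_2(s,\theta),$$ and $\mathcal T=\mathcal P_{\{G_i\}}$. *)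

theory Defs
  imports
    "HOL-Analysis.Analysis"
    "Jordan_Normal_Form.Gauss_Jordan_Elimination"
begin

text \<open>
  Matrices and vectors are those of \<^theory>\<open>Jordan_Normal_Form.Matrix\<close>: their dimensions are
  natural numbers, which are allowed to be zero.  Functions on the interval are total functions on
  the reals of which only the restriction to the closed interval matters, and elements of
  \<open>L\<^sub>2\<close> are represented by such functions: equality in \<open>L\<^sub>2\<close> is equality almost everywhere on
  the interval.
\<close>

no_notation vec_nth (infixl \<open>$\<close> 90)
hide_const (open) Finite_Cartesian_Product.vec Finite_Cartesian_Product.mat
  Finite_Cartesian_Product.row

subsection \<open>Square-integrable functions and weak derivatives\<close>

definition L2 :: "real \<Rightarrow> real \<Rightarrow> (real \<Rightarrow> real) set" where
  "L2 a b = {u. u \<in> borel_measurable (lebesgue_on {a..b}) \<and>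
                integrable (lebesgue_on {a..b}) (\<lambda>s. (u s)\<^sup>2)}"

definition locally_L1 :: "real \<Rightarrow> real \<Rightarrow> (real \<Rightarrow> real) \<Rightarrow> bool" where
  "locally_L1 a b u \<longleftrightarrow> (\<forall>c d. a < c \<and> c \<le> d \<and> d < b \<longrightarrow> integrable (lebesgue_on {c..d}) u)"

text \<open>Test functions: infinitely differentiable, with compact support inside the open interval.\<close>

definition test_function :: "real \<Rightarrow> real \<Rightarrow> (real \<Rightarrow> real) \<Rightarrow> bool" where
  "test_function a b \<phi> \<longleftrightarrow>
     (\<forall>k. (deriv ^^ k) \<phi> differentiable_on UNIV) \<and>
     (\<exists>K. compact K \<and> K \<subseteq> {a<..<b} \<and> (\<forall>x. x \<notin> K \<longrightarrow> \<phi> x = 0))"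

definition has_weak_deriv ::
  "real \<Rightarrow> real \<Rightarrow> nat \<Rightarrow> (real \<Rightarrow> real) \<Rightarrow> (real \<Rightarrow> real) \<Rightarrow> bool" where
  "has_weak_deriv a b l u v \<longleftrightarrow> locally_L1 a b u \<and> locally_L1 a b v \<and>
     (\<forall>\<phi>. test_function a b \<phi> \<longrightarrow>
        (LINT s|lebesgue_on {a..b}. u s * (deriv ^^ l) \<phi> s) =
        (- 1) ^ l * (LINT s|lebesgue_on {a..b}. v s * \<phi> s))"

text \<open>Weak derivatives are unique only up to null sets; \<open>wderiv\<close> picks a representative.\<close>

definition wderiv :: "real \<Rightarrow> real \<Rightarrow> nat \<Rightarrow> (real \<Rightarrow> real) \<Rightarrow> real \<Rightarrow> real" where
  "wderiv a b l u = (SOME v. has_weak_deriv a b l u v)"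

definition sobolev :: "real \<Rightarrow> real \<Rightarrow> nat \<Rightarrow> (real \<Rightarrow> real) set" where
  "sobolev a b k = {u \<in> L2 a b. \<forall>l\<le>k. \<exists>v\<in>L2 a b. has_weak_deriv a b l u v}"

text \<open>
  Point values of an element of \<open>sobolev a b k\<close> with \<open>k \<ge> 1\<close> (in particular boundary values) are
  those of its continuous representative, which for \<open>a < b\<close> is unique on the closed interval.
\<close>

definition cont_rep :: "real \<Rightarrow> real \<Rightarrow> (real \<Rightarrow> real) \<Rightarrow> real \<Rightarrow> real" where
  "cont_rep a b u =
     (SOME g. continuous_on {a..b} g \<and> (AE s in lebesgue_on {a..b}. g s = u s))"

subsection \<open>Vector- and matrix-valued functions\<close>

definition L2_vec :: "real \<Rightarrow> real \<Rightarrow> nat \<Rightarrow> (real \<Rightarrow> real vec) set" where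
  "L2_vec a b m = {u. (\<forall>s\<in>{a..b}. u s \<in> carrier_vec m) \<and> (\<forall>i<m. (\<lambda>s. u s $ i) \<in> L2 a b)}"

definition L2_mat :: "real \<Rightarrow> real \<Rightarrow> nat \<Rightarrow> nat \<Rightarrow> (real \<Rightarrow> real mat) set" where
  "L2_mat a b nr nc = {A. (\<forall>s\<in>{a..b}. A s \<in> carrier_mat nr nc) \<and>
                          (\<forall>i<nr. \<forall>j<nc. (\<lambda>s. A s $$ (i, j)) \<in> L2 a b)}"

definition sobolev_vec :: "real \<Rightarrow> real \<Rightarrow> nat \<Rightarrow> nat \<Rightarrow> (real \<Rightarrow> real vec) set" where
  "sobolev_vec a b k m =
     {u. (\<forall>s\<in>{a..b}. u s \<in> carrier_vec m) \<and> (\<forall>i<m. (\<lambda>s. u s $ i) \<in> sobolev a b k)}"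

definition wderiv_vec ::
  "real \<Rightarrow> real \<Rightarrow> nat \<Rightarrow> nat \<Rightarrow> (real \<Rightarrow> real vec) \<Rightarrow> real \<Rightarrow> real vec" where
  "wderiv_vec a b m l u = (\<lambda>s. Matrix.vec m (\<lambda>i. wderiv a b l (\<lambda>t. u t $ i) s))"

definition cont_rep_vec ::
  "real \<Rightarrow> real \<Rightarrow> nat \<Rightarrow> (real \<Rightarrow> real vec) \<Rightarrow> real \<Rightarrow> real vec" where
  "cont_rep_vec a b m u = (\<lambda>s. Matrix.vec m (\<lambda>i. cont_rep a b (\<lambda>t. u t $ i) s))"

definition integral_vec :: "nat \<Rightarrow> real set \<Rightarrow> (real \<Rightarrow> real vec) \<Rightarrow> real vec" where
  "integral_vec m S u = Matrix.vec m (\<lambda>i. LINT s|lebesgue_on S. u s $ i)"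

definition integral_mat :: "nat \<Rightarrow> nat \<Rightarrow> real set \<Rightarrow> (real \<Rightarrow> real mat) \<Rightarrow> real mat" where
  "integral_mat nr nc S A = Matrix.mat nr nc (\<lambda>(i, j). LINT s|lebesgue_on S. A s $$ (i, j))"

definition append_cols :: "real mat \<Rightarrow> real mat \<Rightarrow> real mat" (infixr \<open>@\<^sub>c\<close> 66) where
  "A @\<^sub>c B = four_block_mat A B (0\<^sub>m 0 (dim_col A)) (0\<^sub>m 0 (dim_col B))"

definition first_rows :: "nat \<Rightarrow> real mat \<Rightarrow> real mat" where
  "first_rows k A = Matrix.mat k (dim_col A) (\<lambda>(i, j). A $$ (i, j))"

text \<open>The operator \<open>\<P>\<close> with parameters \<open>R\<^sub>0\<close>, \<open>R\<^sub>1\<close>, \<open>R\<^sub>2\<close>, with values in dimension \<open>m\<close>.\<close>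

definition PI_op ::
  "real \<Rightarrow> real \<Rightarrow> nat \<Rightarrow> (real \<Rightarrow> real mat) \<Rightarrow> (real \<Rightarrow> real \<Rightarrow> real mat) \<Rightarrow>
   (real \<Rightarrow> real \<Rightarrow> real mat) \<Rightarrow> (real \<Rightarrow> real vec) \<Rightarrow> real \<Rightarrow> real vec" where
  "PI_op a b m R0 R1 R2 v = (\<lambda>s.
     R0 s *\<^sub>v v s
     + integral_vec m {a..s} (\<lambda>\<theta>. R1 s \<theta> *\<^sub>v v \<theta>)
     + integral_vec m {s..b} (\<lambda>\<theta>. R2 s \<theta> *\<^sub>v v \<theta>))"

subsection \<open>The state space and the boundary conditions\<close>

definition n_x :: "nat \<Rightarrow> nat \<Rightarrow> nat \<Rightarrow> nat" where
  "n_x n0 n1 n2 = n0 + n1 + n2"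

definition n_S :: "nat \<Rightarrow> nat \<Rightarrow> nat" where
  "n_S n1 n2 = n1 + 2 * n2"

text \<open>\<open>block k m x\<close> consists of the components \<open>k, \<dots>, k + m - 1\<close> of \<open>x\<close>.\<close>

definition block :: "nat \<Rightarrow> nat \<Rightarrow> (real \<Rightarrow> real vec) \<Rightarrow> real \<Rightarrow> real vec" where
  "block k m x = (\<lambda>s. Matrix.vec m (\<lambda>i. x s $ (k + i)))"

definition W_n ::
  "real \<Rightarrow> real \<Rightarrow> nat \<Rightarrow> nat \<Rightarrow> nat \<Rightarrow> (real \<Rightarrow> real vec) set" where
  "W_n a b n0 n1 n2 =
     {x. (\<forall>s\<in>{a..b}. x s \<in> carrier_vec (n_x n0 n1 n2)) \<and>
         block 0 n0 x \<in> sobolev_vec a b 0 n0 \<and>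
         block n0 n1 x \<in> sobolev_vec a b 1 n1 \<and>
         block (n0 + n1) n2 x \<in> sobolev_vec a b 2 n2}"

definition x_c ::
  "real \<Rightarrow> real \<Rightarrow> nat \<Rightarrow> nat \<Rightarrow> nat \<Rightarrow> (real \<Rightarrow> real vec) \<Rightarrow> real \<Rightarrow> real vec" where
  "x_c a b n0 n1 n2 x = (\<lambda>s.
     let x1 = block n0 n1 x; x2 = block (n0 + n1) n2 x in
     cont_rep_vec a b n1 x1 s @\<^sub>v
     cont_rep_vec a b n2 x2 s @\<^sub>v
     cont_rep_vec a b n2 (wderiv_vec a b n2 1 x2) s)"

definition x_D ::
  "real \<Rightarrow> real \<Rightarrow> nat \<Rightarrow> nat \<Rightarrow> nat \<Rightarrow> (real \<Rightarrow> real vec) \<Rightarrow> real \<Rightarrow> real vec" where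
  "x_D a b n0 n1 n2 x = (\<lambda>s.
     let x0 = block 0 n0 x; x1 = block n0 n1 x; x2 = block (n0 + n1) n2 x in
     x0 s @\<^sub>v x1 s @\<^sub>v x2 s @\<^sub>v
     wderiv_vec a b n1 1 x1 s @\<^sub>v wderiv_vec a b n2 1 x2 s @\<^sub>v wderiv_vec a b n2 2 x2 s)"

text \<open>The number of boundary conditions is \<^term>\<open>dim_row B\<close>.\<close>

definition X_dom ::
  "real \<Rightarrow> real \<Rightarrow> nat \<Rightarrow> nat \<Rightarrow> nat \<Rightarrow> real mat \<Rightarrow> (real \<Rightarrow> real mat) \<Rightarrow>
   (real \<Rightarrow> real vec) set" where
  "X_dom a b n0 n1 n2 B B_I =
     {x \<in> W_n a b n0 n1 n2.
        B *\<^sub>v (x_c a b n0 n1 n2 x a @\<^sub>v x_c a b n0 n1 n2 x b) =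
        integral_vec (dim_row B) {a..b} (\<lambda>s. B_I s *\<^sub>v x_D a b n0 n1 n2 x s)}"

definition D_op ::
  "real \<Rightarrow> real \<Rightarrow> nat \<Rightarrow> nat \<Rightarrow> nat \<Rightarrow> (real \<Rightarrow> real vec) \<Rightarrow> real \<Rightarrow> real vec" where
  "D_op a b n0 n1 n2 x = (\<lambda>s.
     block 0 n0 x s @\<^sub>v
     wderiv_vec a b n1 1 (block n0 n1 x) s @\<^sub>v
     wderiv_vec a b n2 2 (block (n0 + n1) n2 x) s)"

subsection \<open>Admissibility and the partial integral operator\<close>

definition T_mat :: "nat \<Rightarrow> nat \<Rightarrow> real \<Rightarrow> real mat" where
  "T_mat n1 n2 s =
     (1\<^sub>m n1    @\<^sub>c 0\<^sub>m n1 n2 @\<^sub>c 0\<^sub>m n1 n2) @\<^sub>r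
     (0\<^sub>m n2 n1 @\<^sub>c 1\<^sub>m n2    @\<^sub>c (s \<cdot>\<^sub>m 1\<^sub>m n2)) @\<^sub>r
     (0\<^sub>m n2 n1 @\<^sub>c 0\<^sub>m n2 n2 @\<^sub>c 1\<^sub>m n2)"

definition Q_mat :: "nat \<Rightarrow> nat \<Rightarrow> nat \<Rightarrow> real \<Rightarrow> real mat" where
  "Q_mat n0 n1 n2 s =
     (0\<^sub>m n1 n0 @\<^sub>c 1\<^sub>m n1    @\<^sub>c 0\<^sub>m n1 n2) @\<^sub>r
     (0\<^sub>m n2 n0 @\<^sub>c 0\<^sub>m n2 n1 @\<^sub>c (s \<cdot>\<^sub>m 1\<^sub>m n2)) @\<^sub>r
     (0\<^sub>m n2 n0 @\<^sub>c 0\<^sub>m n2 n1 @\<^sub>c 1\<^sub>m n2)"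

definition T1_mat :: "nat \<Rightarrow> nat \<Rightarrow> real \<Rightarrow> real mat" where
  "T1_mat n1 n2 s = first_rows (n1 + n2) (T_mat n1 n2 s)"

definition Q1_mat :: "nat \<Rightarrow> nat \<Rightarrow> nat \<Rightarrow> real \<Rightarrow> real mat" where
  "Q1_mat n0 n1 n2 s = first_rows (n1 + n2) (Q_mat n0 n1 n2 s)"

definition U1_mat :: "nat \<Rightarrow> nat \<Rightarrow> nat \<Rightarrow> real mat" where
  "U1_mat n0 n1 n2 =
     diag_block_mat [1\<^sub>m n0 @\<^sub>r 0\<^sub>m (n1 + n2) n0, 1\<^sub>m n1 @\<^sub>r 0\<^sub>m n2 n1, 1\<^sub>m n2]"

definition U2_mat :: "nat \<Rightarrow> nat \<Rightarrow> nat \<Rightarrow> real mat" where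
  "U2_mat n0 n1 n2 =
     diag_block_mat [0\<^sub>m n0 (n1 + n2) @\<^sub>r 1\<^sub>m (n1 + n2), 0\<^sub>m n1 n2 @\<^sub>r 1\<^sub>m n2]
     @\<^sub>r 0\<^sub>m n2 (n_S n1 n2)"

definition B_T ::
  "real \<Rightarrow> real \<Rightarrow> nat \<Rightarrow> nat \<Rightarrow> nat \<Rightarrow> real mat \<Rightarrow> (real \<Rightarrow> real mat) \<Rightarrow> real mat" where
  "B_T a b n0 n1 n2 B B_I =
     B * (T_mat n1 n2 0 @\<^sub>r T_mat n1 n2 (b - a))
     - integral_mat (dim_row B) (n_S n1 n2) {a..b}
         (\<lambda>s. B_I s * U2_mat n0 n1 n2 * T_mat n1 n2 (s - a))"

definition admissible ::
  "real \<Rightarrow> real \<Rightarrow> nat \<Rightarrow> nat \<Rightarrow> nat \<Rightarrow> real mat \<Rightarrow> (real \<Rightarrow> real mat) \<Rightarrow> bool" where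
  "admissible a b n0 n1 n2 B B_I \<longleftrightarrow> invertible_mat (B_T a b n0 n1 n2 B B_I)"

definition B_Q ::
  "real \<Rightarrow> real \<Rightarrow> nat \<Rightarrow> nat \<Rightarrow> nat \<Rightarrow> real mat \<Rightarrow> (real \<Rightarrow> real mat) \<Rightarrow> real \<Rightarrow> real mat" where
  "B_Q a b n0 n1 n2 B B_I s =
     the (mat_inverse (B_T a b n0 n1 n2 B B_I)) *
     (B_I s * U1_mat n0 n1 n2
      - B * (0\<^sub>m (n_S n1 n2) (n_x n0 n1 n2) @\<^sub>r Q_mat n0 n1 n2 (b - s))
      + integral_mat (dim_row B) (n_x n0 n1 n2) {s..b}
          (\<lambda>\<theta>. B_I \<theta> * U2_mat n0 n1 n2 * Q_mat n0 n1 n2 (\<theta> - s)))"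

definition G0 :: "nat \<Rightarrow> nat \<Rightarrow> nat \<Rightarrow> real \<Rightarrow> real mat" where
  "G0 n0 n1 n2 s =
     four_block_mat (1\<^sub>m n0) (0\<^sub>m n0 (n1 + n2)) (0\<^sub>m (n1 + n2) n0) (0\<^sub>m (n1 + n2) (n1 + n2))"

definition G2 ::
  "real \<Rightarrow> real \<Rightarrow> nat \<Rightarrow> nat \<Rightarrow> nat \<Rightarrow> real mat \<Rightarrow> (real \<Rightarrow> real mat) \<Rightarrow>
   real \<Rightarrow> real \<Rightarrow> real mat" where
  "G2 a b n0 n1 n2 B B_I s \<theta> =
     0\<^sub>m n0 (n_x n0 n1 n2) @\<^sub>r (T1_mat n1 n2 (s - a) * B_Q a b n0 n1 n2 B B_I \<theta>)"

definition G1 ::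
  "real \<Rightarrow> real \<Rightarrow> nat \<Rightarrow> nat \<Rightarrow> nat \<Rightarrow> real mat \<Rightarrow> (real \<Rightarrow> real mat) \<Rightarrow>
   real \<Rightarrow> real \<Rightarrow> real mat" where
  "G1 a b n0 n1 n2 B B_I s \<theta> =
     (0\<^sub>m n0 (n_x n0 n1 n2) @\<^sub>r Q1_mat n0 n1 n2 (s - \<theta>)) + G2 a b n0 n1 n2 B B_I s \<theta>"

definition T_op ::
  "real \<Rightarrow> real \<Rightarrow> nat \<Rightarrow> nat \<Rightarrow> nat \<Rightarrow> real mat \<Rightarrow> (real \<Rightarrow> real mat) \<Rightarrow>
   (real \<Rightarrow> real vec) \<Rightarrow> real \<Rightarrow> real vec" where
  "T_op a b n0 n1 n2 B B_I =
     PI_op a b (n_x n0 n1 n2) (G0 n0 n1 n2) (G1 a b n0 n1 n2 B B_I) (G2 a b n0 n1 n2 B B_I)"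

end

theory Submission
  imports Defs
begin

text \<open>
  On an interval an element of \<open>W\<^sub>1\<close> is almost everywhere equal to a constant plus the
  primitive of its weak derivative, and conversely; iterating this, an element of \<open>W\<^sub>2\<close> is
  \<open>u(a) + (s - a) u'(a)\<close> plus the integral of \<open>(s - \<theta>) u''(\<theta>)\<close> over \<open>a \<le> \<theta> \<le> s\<close>
  (\<open>sobolev_1_structure\<close>, \<open>sobolev_2_structure\<close> and the converses
  \<open>sobolev_1_primitive\<close>, \<open>sobolev_2_primitive\<close>).  Written in blocks, this says that the
  states in \<open>W\<^sup>n\<close> are exactly the functions whose core values follow the trajectory
  \<open>x\<^sub>c(s) = T(s - a) c\<close> plus the integral of \<open>Q(s - \<theta>) v(\<theta>)\<close>, for a vector \<open>c = x\<^sub>c(a)\<close> and a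
  square-integrable \<open>v = D x\<close>; moreover \<open>x\<^sub>D = U\<^sub>1 v + U\<^sub>2 x\<^sub>c\<close>.  Inserting this in
  the boundary condition and interchanging the order of integration turns it into
  \<open>B\<^sub>T c = \<integral> B\<^sub>T B\<^sub>Q v\<close>, which by admissibility is \<open>c = \<integral> B\<^sub>Q v\<close>
  (\<open>boundary_condition_iff\<close>).  The operator \<open>\<T>\<close> returns the state with exactly this
  initial vector (\<open>T_op_eq\<close>), so it inverts \<open>D\<close> on \<open>X\<close>.

  The analytic ingredients are the fundamental lemma of the calculus of variations and the
  lemma of du Bois-Reymond (\<open>AE_zero_if_test_integrals_zero\<close>,
  \<open>AE_const_if_test_deriv_integrals_zero\<close>), which rest on a supply of bump functions
  (\<open>test_function_approx_indicator\<close>), and Fubini's theorem on the triangle \<open>a \<le> \<theta> \<le> s \<le> b\<close> (\<open>integral_triangle_swap\<close>).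
\<close>

section \<open>Smooth functions and test functions\<close>

text \<open>Infinite differentiability on the whole line, in the form used by \<^const>\<open>test_function\<close>.\<close>

definition smooth :: "(real \<Rightarrow> real) \<Rightarrow> bool" where
  "smooth f \<longleftrightarrow> (\<forall>k. (deriv ^^ k) f differentiable_on UNIV)"

text \<open>A property of functions that passes to derivatives implies smoothness.\<close>

lemma smooth_coinduct:
  assumes "P f"
    and step: "\<And>f. P f \<Longrightarrow> \<exists>f'. (\<forall>x. (f has_real_derivative f' x) (at x)) \<and> P f'"
  shows "smooth f"
proof -
  have deriv_P: "P (deriv g)" if Pg: "P g" for g
  proof -
    obtain g' where g': "\<forall>x. (g has_real_derivative g' x) (at x)" "P g'"
      using step[OF Pg] by blast
    then have "deriv g = g'" by (intro ext) (auto intro: DERIV_imp_deriv)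
    with g' show ?thesis by simp
  qed
  have "P ((deriv ^^ k) f)" for k
    by (induction k) (auto simp: assms(1) deriv_P)
  then show ?thesis
    unfolding smooth_def differentiable_on_def
    using step by (meson field_differentiable_def field_differentiable_imp_differentiable
        has_field_derivative_at_within)
qed

lemma smooth_step: "smooth f \<Longrightarrow> (f has_real_derivative deriv f x) (at x) \<and> smooth (deriv f)"
proof -
  assume *: "smooth f"
  have "(deriv ^^ k) (deriv f) = (deriv ^^ Suc k) f" for k
    by (simp add: funpow_swap1)
  then have "smooth (deriv f)" using * unfolding smooth_def by metis
  moreover have "(deriv ^^ 0) f differentiable_on UNIV" using * unfolding smooth_def by blast
  then have "f differentiable (at x)" by (simp add: differentiable_on_def)
  then have "(f has_real_derivative deriv f x) (at x)"
    by (simp add: DERIV_deriv_iff_real_differentiable)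
  ultimately show ?thesis by simp
qed

lemma smooth_has_derivative: "smooth f \<Longrightarrow> (f has_real_derivative deriv f x) (at x)"
  and smooth_deriv: "smooth f \<Longrightarrow> smooth (deriv f)"
  using smooth_step by blast+

lemma smooth_continuous: "smooth f \<Longrightarrow> continuous_on S f"
  by (intro continuous_at_imp_continuous_on ballI DERIV_isCont) (rule smooth_has_derivative)

lemma smooth_const: "smooth (\<lambda>x. c)"
proof (rule smooth_coinduct[where P="\<lambda>f. \<exists>c. f = (\<lambda>x. c)"])
  fix f :: "real \<Rightarrow> real" assume "\<exists>c. f = (\<lambda>x. c)"
  then show "\<exists>f'. (\<forall>x. (f has_real_derivative f' x) (at x)) \<and> (\<exists>c. f' = (\<lambda>x. c))"
    by (intro exI[of _ "\<lambda>x. 0"]) (auto intro!: derivative_eq_intros)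
qed auto

text \<open>
  The functions generated from the smooth ones by sums and products.  By the product rule this
  class is closed under derivatives, so its members are smooth; no Leibniz formula for higher
  derivatives is needed.
\<close>

inductive smooth_alg :: "(real \<Rightarrow> real) \<Rightarrow> bool" where
  base: "smooth f \<Longrightarrow> smooth_alg f"
| add: "smooth_alg f \<Longrightarrow> smooth_alg g \<Longrightarrow> smooth_alg (\<lambda>x. f x + g x)"
| mult: "smooth_alg f \<Longrightarrow> smooth_alg g \<Longrightarrow> smooth_alg (\<lambda>x. f x * g x)"

lemma smooth_alg_imp_smooth: "smooth_alg f \<Longrightarrow> smooth f"
proof (rule smooth_coinduct[where P = smooth_alg])
  show "\<exists>f'. (\<forall>x. (f has_real_derivative f' x) (at x)) \<and> smooth_alg f'" if "smooth_alg f" for f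
    using that
  proof induction
    case (base f)
    then show ?case using smooth_step smooth_alg.base by blast
  next
    case (add f g)
    then obtain f' g' where "\<forall>x. (f has_real_derivative f' x) (at x)" "smooth_alg f'"
      "\<forall>x. (g has_real_derivative g' x) (at x)" "smooth_alg g'" by blast
    then show ?case
      by (intro exI[of _ "\<lambda>x. f' x + g' x"]) (auto intro!: derivative_eq_intros smooth_alg.add)
  next
    case (mult f g)
    then obtain f' g' where "\<forall>x. (f has_real_derivative f' x) (at x)" "smooth_alg f'"
      "\<forall>x. (g has_real_derivative g' x) (at x)" "smooth_alg g'" by blast
    with mult show ?case
      by (intro exI[of _ "\<lambda>x. f' x * g x + f x * g' x"])
        (auto intro!: derivative_eq_intros smooth_alg.add smooth_alg.mult)
  qed
qed

lemma smooth_mult: "smooth f \<Longrightarrow> smooth g \<Longrightarrow> smooth (\<lambda>x. f x * g x)"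
  and smooth_add: "smooth f \<Longrightarrow> smooth g \<Longrightarrow> smooth (\<lambda>x. f x + g x)"
  by (blast intro: smooth_alg_imp_smooth smooth_alg.intros)+

lemma smooth_affine: 
  assumes "smooth f" shows "smooth (\<lambda>x. f (m * x + t))"
proof (rule smooth_coinduct[where P="\<lambda>h. \<exists>c f. smooth f \<and> h = (\<lambda>x. c * f (m * x + t))"])
  show "\<exists>c f'. smooth f' \<and> (\<lambda>x. f (m * x + t)) = (\<lambda>x. c * f' (m * x + t))"
    using assms by (intro exI[of _ 1] exI[of _ f]) auto
next
  fix h assume "\<exists>c f. smooth f \<and> h = (\<lambda>x. c * f (m * x + t))"
  then obtain c f where f: "smooth f" "h = (\<lambda>x. c * f (m * x + t))" by blast
  have "(h has_real_derivative c * m * deriv f (m * x + t)) (at x)" for x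
    unfolding f mult.assoc
    by (intro DERIV_cmult DERIV_chain'[OF _ smooth_has_derivative[OF f(1)], THEN DERIV_cong])
      (auto intro!: derivative_eq_intros)
  then show "\<exists>h'. (\<forall>x. (h has_real_derivative h' x) (at x)) \<and>
      (\<exists>c f. smooth f \<and> h' = (\<lambda>x. c * f (m * x + t)))"
    using smooth_deriv[OF f(1)] by (intro exI[of _ "\<lambda>x. c * m * deriv f (m * x + t)"]) blast
qed

text \<open>
  The functions \<open>p(1/x) exp(-1/x)\<close> for \<open>x > 0\<close>, continued by zero, where \<open>p\<close> is a
  polynomial.  They are closed under derivatives; those with \<open>p = 1\<close> are the building blocks of
  bump functions.
\<close>

definition flat_exp :: "real poly \<Rightarrow> real \<Rightarrow> real" where
  "flat_exp p x = (if x > 0 then poly p (1 / x) * exp (- (1 / x)) else 0)"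

lemma poly_exp_tendsto_0: "((\<lambda>y::real. poly p y * exp (- y)) \<longlongrightarrow> 0) at_top"
proof (induction p)
  case (pCons a p)
  have "((\<lambda>y::real. poly q y * (y * exp (- y))) \<longlongrightarrow> 0) at_top" for q
  proof -
    have "((\<lambda>y. \<Sum>i\<le>degree q. coeff q i * (y ^ Suc i / exp y)) \<longlongrightarrow> 0) at_top"
      by (rule tendsto_null_sum) (intro tendsto_mult_right_zero tendsto_power_div_exp_0)
    then show ?thesis
      by (simp add: poly_altdef sum_distrib_right exp_minus sum_distrib_left sum_divide_distrib divide_simps mult_ac)
  qed
  note 1 = this[of p]
  have "((\<lambda>y::real. a * (y ^ 0 / exp y)) \<longlongrightarrow> 0) at_top"
    by (intro tendsto_mult_right_zero tendsto_power_div_exp_0)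
  from tendsto_add[OF this 1] show ?case
    by (simp add: exp_minus field_simps)
qed simp

lemma flat_exp_has_derivative:
  "(flat_exp p has_real_derivative flat_exp ([:0,0,1:] * (p - pderiv p)) x) (at x)"
proof -
  consider "x < 0" | "x > 0" | "x = 0" by linarith
  then show ?thesis
  proof cases
    case 1
    have "((\<lambda>x. 0) has_real_derivative 0) (at x)" by simp
    then have "(flat_exp p has_real_derivative 0) (at x)"
      by (rule has_field_derivative_transform_within_open[where S="{..<0}"]) 
        (use 1 in \<open>auto simp: flat_exp_def\<close>)
    then show ?thesis using 1 by (simp add: flat_exp_def)
  next
    case 2
    have "((\<lambda>x. poly p (1/x) * exp (- (1 / x))) has_real_derivative
        flat_exp ([:0,0,1:] * (p - pderiv p)) x) (at x)"
      using 2 by (auto intro!: derivative_eq_intros simp: flat_exp_def field_simps power2_eq_square)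
    then show ?thesis
      by (rule has_field_derivative_transform_within_open[where S="{0<..}"])
        (use 2 in \<open>auto simp: flat_exp_def\<close>)
  next
    case 3
    have "((\<lambda>h. flat_exp p h / h) \<longlongrightarrow> 0) (at_right 0)"
    proof -
      have "((\<lambda>h. poly (pCons 0 p) (inverse h) * exp (- (inverse h))) \<longlongrightarrow> 0) (at_right (0::real))"
        by (rule filterlim_compose[OF poly_exp_tendsto_0 filterlim_inverse_at_top_right])
      then show ?thesis
        by (rule Lim_transform_eventually)
          (auto simp: eventually_at_filter flat_exp_def field_simps)
    qed
    moreover have "((\<lambda>h. flat_exp p h / h) \<longlongrightarrow> 0) (at_left 0)"
      by (rule Lim_transform_eventually[of "\<lambda>_. 0"]) (auto simp: eventually_at_filter flat_exp_def)
    ultimately have "((\<lambda>h. flat_exp p h / h) \<longlongrightarrow> 0) (at 0)"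
      by (simp add: filterlim_split_at)
    then show ?thesis using 3 by (simp add: DERIV_def) (simp add: flat_exp_def)
  qed
qed

lemma smooth_flat_exp: "smooth (flat_exp p)"
proof (rule smooth_coinduct[where P="\<lambda>f. \<exists>p. f = flat_exp p"])
  fix f assume "\<exists>p. f = flat_exp p"
  then show "\<exists>f'. (\<forall>x. (f has_real_derivative f' x) (at x)) \<and> (\<exists>p. f' = flat_exp p)"
    using flat_exp_has_derivative by blast
qed blast

text \<open>The support may be taken to be a compact interval (empty if \<open>d < c\<close>).\<close>

lemma test_function_iff:
  "test_function a b \<phi> \<longleftrightarrow>
     smooth \<phi> \<and> (\<exists>c d. a < c \<and> d < b \<and> (\<forall>x. x \<notin> {c..d} \<longrightarrow> \<phi> x = 0))"
  (is "?L \<longleftrightarrow> ?R")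
proof
  assume L: ?L
  then obtain K where K: "compact K" "K \<subseteq> {a<..<b}" "\<And>x. x \<notin> K \<Longrightarrow> \<phi> x = 0" "smooth \<phi>"
    by (auto simp: test_function_def smooth_def)
  show ?R
  proof (cases "K = {}")
    case False
    obtain c where c: "c \<in> K" "\<And>x. x \<in> K \<Longrightarrow> c \<le> x"
      using compact_attains_inf[OF K(1) False] by blast
    obtain d where d: "d \<in> K" "\<And>x. x \<in> K \<Longrightarrow> x \<le> d"
      using compact_attains_sup[OF K(1) False] by blast
    have "\<phi> x = 0" if "x \<notin> {c..d}" for x
      using that c(2) d(2) by (intro K(3)) auto
    moreover have "a < c" "d < b" using c d K(2) by auto
    ultimately show ?thesis using K(4) by blast
  next
    case True
    then have "\<forall>x. x \<notin> {a + 1..b - 1} \<longrightarrow> \<phi> x = 0" using K(3) by blast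
    then show ?thesis using K(4) by (intro conjI exI[of _ "a + 1"] exI[of _ "b - 1"]) auto
  qed
next
  assume ?R
  then obtain c d where *: "smooth \<phi>" "a < c" "d < b" "\<forall>x. x \<notin> {c..d} \<longrightarrow> \<phi> x = 0" by blast
  then show ?L unfolding test_function_def smooth_def
    by (intro conjI exI[of _ "{c..d}"]) auto
qed

lemma test_function_deriv:
  assumes "test_function a b \<phi>" shows "test_function a b (deriv \<phi>)"
proof -
  obtain c d where *: "smooth \<phi>" "a < c" "d < b" "\<forall>x. x \<notin> {c..d} \<longrightarrow> \<phi> x = 0"
    using assms unfolding test_function_iff by blast
  have "deriv \<phi> x = 0" if "x \<notin> {c..d}" for x
  proof (rule DERIV_imp_deriv, rule has_field_derivative_transform_within_open[where S="- {c..d}"])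
    show "((\<lambda>x. 0) has_real_derivative 0) (at x)" by simp
  qed (use that * in \<open>auto\<close>)
  then show ?thesis using * smooth_deriv unfolding test_function_iff by blast
qed

lemma test_function_add:
  assumes "test_function a b \<phi>" "test_function a b \<psi>"
  shows "test_function a b (\<lambda>x. \<phi> x + \<psi> x)"
proof -
  obtain c d where *: "smooth \<phi>" "a < c" "d < b" "\<forall>x. x \<notin> {c..d} \<longrightarrow> \<phi> x = 0"
    using assms(1) unfolding test_function_iff by blast
  obtain c' d' where **: "smooth \<psi>" "a < c'" "d' < b" "\<forall>x. x \<notin> {c'..d'} \<longrightarrow> \<psi> x = 0"
    using assms(2) unfolding test_function_iff by blast
  show ?thesis unfolding test_function_iff
    by (intro conjI smooth_add * ** exI[of _ "min c c'"] exI[of _ "max d d'"])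
      (use * ** in \<open>auto simp: min_def max_def split: if_splits\<close>)
qed

lemma test_function_cmult:
  assumes "test_function a b \<phi>" shows "test_function a b (\<lambda>x. r * \<phi> x)"
  using assms smooth_mult[OF smooth_const[of r], of \<phi>] unfolding test_function_iff by force

text \<open>A primitive of a test function of mean zero is again a test function.\<close>

lemma test_function_primitive:
  assumes "test_function a b \<phi>" "a < b" "integral {a..b} \<phi> = 0"
  obtains \<Phi> where "test_function a b \<Phi>" "deriv \<Phi> = \<phi>"
proof -
  obtain c d where *: "smooth \<phi>" "a < c" "d < b" "\<forall>x. x \<notin> {c..d} \<longrightarrow> \<phi> x = 0"
    using assms unfolding test_function_iff by blast
  \<comment> \<open>starting left of \<open>a\<close> makes \<open>\<Phi>\<close> differentiable at \<open>a\<close> itself\<close>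
  define \<Phi> where "\<Phi> x = integral {a - 1..x} \<phi>" for x
  have int: "\<phi> integrable_on {u..v}" for u v
    by (intro integrable_continuous_real smooth_continuous *)
  have der: "(\<Phi> has_real_derivative \<phi> x) (at x)" if "x > a - 1" for x
  proof -
    have "(\<Phi> has_real_derivative \<phi> x) (at x within {a - 1..x + 1})"
      unfolding \<Phi>_def using that
      by (intro integral_has_real_derivative smooth_continuous *) auto
    then show ?thesis using that by (simp add: at_within_Icc_at)
  qed
  have left: "\<Phi> x = 0" if "x < c" for x
    unfolding \<Phi>_def
    by (rule integral_unique, rule has_integral_is_0) (use that * in auto)
  have right: "\<Phi> x = 0" if "x > d" for x
  proof -
    define y where "y = max x b"
    have z: "integral {a - 1..a} \<phi> = 0" "integral {x..y} \<phi> = 0" "integral {b..y} \<phi> = 0"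
      by (rule integral_unique, rule has_integral_is_0, use that * in auto)+
    show ?thesis
    proof (cases "x \<ge> a - 1")
      case True
      have "integral {a - 1..y} \<phi> = integral {a - 1..x} \<phi> + integral {x..y} \<phi>"
        using True by (intro Henstock_Kurzweil_Integration.integral_combine[symmetric] int) (auto simp: y_def)
      moreover have "integral {a - 1..y} \<phi> = integral {a - 1..a} \<phi> + integral {a..y} \<phi>"
        using assms(2) by (intro Henstock_Kurzweil_Integration.integral_combine[symmetric] int) (auto simp: y_def)
      moreover have "integral {a..y} \<phi> = integral {a..b} \<phi> + integral {b..y} \<phi>"
        using assms(2) by (intro Henstock_Kurzweil_Integration.integral_combine[symmetric] int) (auto simp: y_def)
      ultimately show ?thesis using z assms(3) by (simp add: \<Phi>_def)
    qed (simp add: \<Phi>_def)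
  qed
  have "(\<Phi> has_real_derivative \<phi> x) (at x)" for x
  proof (cases "x > a - 1")
    case False
    have "((\<lambda>x. 0) has_real_derivative \<phi> x) (at x)" using * False by auto
    then show ?thesis
      by (rule has_field_derivative_transform_within_open[where S="{..<a}"])
        (use left *(2) False in auto)
  qed (use der in auto)
  then have der: "\<And>x. (\<Phi> has_real_derivative \<phi> x) (at x)" by blast
  then have d: "deriv \<Phi> = \<phi>" by (intro ext DERIV_imp_deriv)
  have "smooth \<Phi>"
    by (rule smooth_coinduct[where P="\<lambda>f. f = \<Phi> \<or> smooth f"])
      (use der *(1) smooth_has_derivative smooth_deriv in blast)+
  then have "test_function a b \<Phi>" using left right * unfolding test_function_iff by force
  with d show thesis using that by blast
qed

text \<open>Test functions that are bounded by one and converge pointwise to an indicator function.\<close>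

lemma test_function_approx_indicator:
  assumes "a < c" "c < d" "d < b"
  obtains \<phi> :: "nat \<Rightarrow> real \<Rightarrow> real" where
    "\<And>n. test_function a b (\<phi> n)" "\<And>n x. 0 \<le> \<phi> n x" "\<And>n x. \<phi> n x \<le> 1"
    "\<And>x. (\<lambda>n. \<phi> n x) \<longlonglongrightarrow> indicator {c<..<d} x"
    "\<And>n x. x \<in> {c<..<d} \<Longrightarrow> \<phi> n x > 0" "\<And>n x. x \<notin> {c<..<d} \<Longrightarrow> \<phi> n x = 0"
proof -
  \<comment> \<open>for \<open>t > 0\<close>, \<open>exp (- 1 / (m t))\<close> tends to \<open>1\<close> as \<open>m\<close> grows\<close>
  define m where "m n = real (Suc n)" for n
  define \<phi> where "\<phi> n x = flat_exp 1 (m n * x + - m n * c) * flat_exp 1 (- m n * x + m n * d)" for n x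
  have m: "m n > 0" for n by (simp add: m_def)
  have pos: "m n * x + - m n * c > 0 \<longleftrightarrow> x > c" "- m n * x + m n * d > 0 \<longleftrightarrow> x < d" for n x
    using m[of n] by (auto simp: algebra_simps)
  have e: "flat_exp 1 x \<ge> 0" "flat_exp 1 x \<le> 1" "x > 0 \<Longrightarrow> flat_exp 1 x > 0" 
    "\<not> x > 0 \<Longrightarrow> flat_exp 1 x = 0" for x
    by (auto simp: flat_exp_def)
  have eq: "flat_exp 1 (m n * t) = exp (- (1 / t * (1 / real (Suc n))))" if "t > 0" for t n
    using that by (auto simp: flat_exp_def m_def field_simps add_pos_nonneg)
  have lim: "(\<lambda>n. flat_exp 1 (m n * t)) \<longlonglongrightarrow> 1" if "t > 0" for t
    unfolding eq[OF that]
    by (rule tendsto_eq_intros refl LIMSEQ_Suc[OF lim_1_over_n] | simp)+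
  show thesis
  proof
    show "test_function a b (\<phi> n)" for n
      unfolding test_function_iff \<phi>_def
      by (intro conjI smooth_mult smooth_affine smooth_flat_exp exI[of _ c] exI[of _ d])
        (use assms e(4) pos[of n] in auto)
    show "0 \<le> \<phi> n x" "\<phi> n x \<le> 1" for n x
      unfolding \<phi>_def using e by (auto intro: mult_le_one)
    show "\<phi> n x > 0" if "x \<in> {c<..<d}" for n x
      unfolding \<phi>_def using that pos[of n x] e(3) by (intro mult_pos_pos) auto
    show "\<phi> n x = 0" if "x \<notin> {c<..<d}" for n x
      unfolding \<phi>_def using that e(4) pos[of n x] by auto
    show "(\<lambda>n. \<phi> n x) \<longlonglongrightarrow> indicator {c<..<d} x" for x
    proof (cases "x \<in> {c<..<d}")
      case True
      have "\<phi> n x = flat_exp 1 (m n * (x - c)) * flat_exp 1 (m n * (d - x))" for n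
        by (simp add: \<phi>_def algebra_simps)
      with tendsto_mult[OF lim lim, of "x - c" "d - x"] True show ?thesis by simp
    next
      case False
      then have "\<phi> n x = 0" for n unfolding \<phi>_def using e(4) pos[of n x] by auto
      with False show ?thesis by simp
    qed
  qed
qed

section \<open>Lebesgue measure on compact intervals\<close>

text \<open>
  Lebesgue measure is complete, so functions that agree almost everywhere may replace each other
  in integrals with no measurability hypothesis.
\<close>

lemma borel_measurable_lebesgue_on_AE:
  fixes f g :: "real \<Rightarrow> real"
  assumes "f \<in> borel_measurable (lebesgue_on S)" "S \<in> sets lebesgue"
    and "AE s in lebesgue_on S. f s = g s"
  shows "g \<in> borel_measurable (lebesgue_on S)"
proof -
  have "AE s in lebesgue. (if s \<in> S then f s else 0) = (if s \<in> S then g s else 0)"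
    using assms(2,3) by (auto simp: AE_restrict_space_iff elim: eventually_mono)
  from borel_measurable_AE[OF _ this] assms(1,2) show ?thesis
    by (simp only: borel_measurable_if)
qed

lemma lebesgue_on_cong_AE:
  fixes f g :: "real \<Rightarrow> real"
  assumes "S \<in> sets lebesgue" "AE s in lebesgue_on S. f s = g s"
  shows "integrable (lebesgue_on S) f \<longleftrightarrow> integrable (lebesgue_on S) g"
    and "integral\<^sup>L (lebesgue_on S) f = integral\<^sup>L (lebesgue_on S) g"
proof -
  have "AE s in lebesgue_on S. g s = f s" using assms(2) by (auto elim: eventually_mono)
  then have m: "f \<in> borel_measurable (lebesgue_on S) \<longleftrightarrow> g \<in> borel_measurable (lebesgue_on S)"
    using assms borel_measurable_lebesgue_on_AE by blast
  show i: "integrable (lebesgue_on S) f \<longleftrightarrow> integrable (lebesgue_on S) g"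
    using m assms(2) integrable_cong_AE by blast
  show "integral\<^sup>L (lebesgue_on S) f = integral\<^sup>L (lebesgue_on S) g"
    using m assms(2) integral_cong_AE i not_integrable_integral_eq borel_measurable_integrable by metis
qed

lemma AE_lebesgue_on_neq: "S \<in> sets lebesgue \<Longrightarrow> AE s in lebesgue_on S. s \<noteq> (c :: real)"
  using AE_completion[OF AE_lborel_singleton[of c]]
  by (auto simp: AE_restrict_space_iff elim: eventually_mono)

lemma AE_lebesgue_on_subset:
  assumes "AE s in lebesgue_on T. P s" "S \<subseteq> T" "S \<in> sets lebesgue" "T \<in> sets lebesgue"
  shows "AE s in lebesgue_on S. P (s :: real)"
  using assms by (auto simp: AE_restrict_space_iff elim: eventually_mono)

text \<open>A property that holds almost everywhere on all compact subintervals of the open interval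
  holds almost everywhere on the closed interval.\<close>

lemma AE_lebesgue_on_Icc_exhaust:
  fixes a b :: real
  assumes "\<And>c d. a < c \<Longrightarrow> c < d \<Longrightarrow> d < b \<Longrightarrow> AE s in lebesgue_on {c..d}. P s"
  shows "AE s in lebesgue_on {a..b}. P s"
proof -
  have "AE s in lebesgue. s \<in> {a + 1 / Suc n..b - 1 / Suc n} \<longrightarrow> s \<noteq> a + 1 / Suc n \<longrightarrow> P s" for n
  proof (cases "a + 1 / Suc n < b - 1 / Suc n")
    case True
    then have "AE s in lebesgue_on {a + 1 / Suc n..b - 1 / Suc n}. P s" by (intro assms) auto
    then show ?thesis by (auto simp: AE_restrict_space_iff elim: eventually_mono)
  qed auto
  then have "AE s in lebesgue. \<forall>n. s \<in> {a + 1 / Suc n..b - 1 / Suc n} \<longrightarrow> s \<noteq> a + 1 / Suc n \<longrightarrow> P s"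
    by (simp add: AE_all_countable)
  moreover have "AE s in lebesgue. s \<noteq> a" "AE s in lebesgue. s \<noteq> b"
    using AE_completion[OF AE_lborel_singleton] by auto
  ultimately have "AE s in lebesgue. s \<in> {a..b} \<longrightarrow> P s"
  proof eventually_elim
    case (elim s)
    show ?case
    proof
      assume "s \<in> {a..b}"
      with elim have "0 < min (s - a) (b - s)" by auto
      then obtain n where n: "1 / Suc n < min (s - a) (b - s)" using nat_approx_posE by blast
      then have "s \<in> {a + 1 / Suc n..b - 1 / Suc n}" "s \<noteq> a + 1 / Suc n" by auto
      with elim show "P s" by blast
    qed
  qed
  then show ?thesis by (simp add: AE_restrict_space_iff)
qed

lemma continuous_AE_eq_imp_eq:
  fixes f g :: "real \<Rightarrow> real"
  assumes "continuous_on {a..b} f" "continuous_on {a..b} g" "a < b"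
    and "AE s in lebesgue_on {a..b}. f s = g s" and "s \<in> {a..b}"
  shows "f s = g s"
proof -
  have c: "continuous_on {a..b} (\<lambda>s. \<bar>f s - g s\<bar>)" by (intro continuous_intros assms)
  have "integral {a..b} (\<lambda>s. \<bar>f s - g s\<bar>) = (LINT s|lebesgue_on {a..b}. \<bar>f s - g s\<bar>)"
    by (simp add: lebesgue_integral_eq_integral continuous_imp_integrable_real c)
  also have "\<dots> = 0" by (rule integral_eq_zero_AE) (use assms(4) in \<open>auto elim: eventually_mono\<close>)
  finally show ?thesis using integral_eq_0_iff[OF c \<open>a < b\<close>] assms(5) by auto
qed

lemma integrable_mult_bounded:
  fixes f g :: "'a \<Rightarrow> real"
  assumes "integrable M f" "g \<in> borel_measurable M" "\<And>x. x \<in> space M \<Longrightarrow> \<bar>g x\<bar> \<le> C"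
  shows "integrable M (\<lambda>x. f x * g x)"
proof (rule Bochner_Integration.integrable_bound)
  show "integrable M (\<lambda>x. C * f x)" using assms(1) by simp
  show "AE x in M. norm (f x * g x) \<le> norm (C * f x)"
    using assms(3) by (intro AE_I2) (auto simp: abs_mult mult.commute[of "\<bar>f _\<bar>"] intro!: mult_right_mono order_trans[OF assms(3)])
qed (use assms in auto)

lemma integrable_mult_continuous:
  fixes f g :: "real \<Rightarrow> real"
  assumes "integrable (lebesgue_on {a..b}) f" "continuous_on {a..b} g"
  shows "integrable (lebesgue_on {a..b}) (\<lambda>s. f s * g s)"
proof -
  have "compact (g ` {a..b})" by (intro compact_continuous_image assms) simp
  then have "bounded (g ` {a..b})" by (rule compact_imp_bounded)
  then obtain C where "\<forall>x\<in>g ` {a..b}. \<bar>x\<bar> \<le> C" unfolding bounded_iff by auto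
  then have "\<bar>g s\<bar> \<le> C" if "s \<in> {a..b}" for s using that by blast
  then show ?thesis
    by (intro integrable_mult_bounded assms continuous_imp_measurable_on_sets_lebesgue) auto
qed

text \<open>
  If all integrals over subintervals vanish, then by the Henstock lemma the Riemann sums of
  \<open>\<bar>v\<bar>\<close> over fine tagged divisions are small, so \<open>\<bar>v\<bar>\<close> has integral zero.
\<close>

lemma zero_integrals_imp_AE_zero:
  fixes v :: "real \<Rightarrow> real"
  assumes v: "integrable (lebesgue_on {c..d}) v"
    and zero: "\<And>x y. c \<le> x \<Longrightarrow> x \<le> y \<Longrightarrow> y \<le> d \<Longrightarrow> integral {x..y} v = 0"
  shows "AE s in lebesgue_on {c..d}. v s = 0"
proof -
  have "v integrable_on cbox c d" using v by (simp add: integrable_on_lebesgue_on)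
  have "((\<lambda>s. \<bar>v s\<bar>) has_integral 0) (cbox c d)"
    unfolding has_integral
  proof (intro allI impI)
    fix e :: real assume "e > 0"
    with Henstock_lemma[OF \<open>v integrable_on cbox c d\<close>] obtain \<gamma> where \<gamma>: "gauge \<gamma>"
      "\<And>p. p tagged_partial_division_of cbox c d \<Longrightarrow> \<gamma> fine p \<Longrightarrow>
        (\<Sum>(x, k)\<in>p. norm (measure lborel k *\<^sub>R v x - integral k v)) < e" by blast
    have "norm ((\<Sum>(x, k)\<in>p. measure lborel k *\<^sub>R \<bar>v x\<bar>) - 0) < e"
      if p: "p tagged_division_of cbox c d" "\<gamma> fine p" for p
    proof -
      have "measure lborel k *\<^sub>R \<bar>v x\<bar> = norm (measure lborel k *\<^sub>R v x - integral k v)" if k: "(x, k) \<in> p" for x k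
      proof -
        obtain y z where yz: "k = {y..z}" using tagged_division_ofD(4)[OF p(1) k] by auto
        moreover have "x \<in> k" "k \<subseteq> {c..d}" using tagged_division_ofD(2,3)[OF p(1) k] by auto
        ultimately have "integral k v = 0" 
          using zero[of y z] by (cases "y \<le> z") (simp_all add: subset_eq)
        then show ?thesis by (simp add: abs_mult)
      qed
      then have "(\<Sum>(x, k)\<in>p. measure lborel k *\<^sub>R \<bar>v x\<bar>) = (\<Sum>(x, k)\<in>p. norm (measure lborel k *\<^sub>R v x - integral k v))"
        by (intro sum.cong) auto
      moreover have "\<dots> < e" using p by (intro \<gamma>) (auto simp: tagged_division_of_def)
      moreover have "(\<Sum>(x, k)\<in>p. measure lborel k *\<^sub>R \<bar>v x\<bar>) \<ge> 0" by (intro sum_nonneg) auto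
      ultimately show ?thesis by simp
    qed
    then show "\<exists>\<gamma>. gauge \<gamma> \<and> (\<forall>\<D>. \<D> tagged_division_of cbox c d \<and> \<gamma> fine \<D> \<longrightarrow>
        norm ((\<Sum>(x, K)\<in>\<D>. measure lborel K *\<^sub>R \<bar>v x\<bar>) - 0) < e)"
      by (intro exI[of _ \<gamma>] conjI allI impI \<gamma>(1)) (elim conjE, assumption)
  qed
  then have "integral {c..d} (\<lambda>s. \<bar>v s\<bar>) = 0" by (simp add: integral_unique)
  then have "(LINT s|lebesgue_on {c..d}. \<bar>v s\<bar>) = 0"
    using v by (subst lebesgue_integral_eq_integral) auto
  with v show ?thesis by (subst (asm) integral_nonneg_eq_0_iff_AE) auto
qed

section \<open>Square-integrable functions\<close>

lemma finite_measure_lebesgue_on_Icc: "finite_measure (lebesgue_on {a..b::real})"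
  by (intro finite_measure_lebesgue_on) simp

lemma L2_measurable: "u \<in> L2 a b \<Longrightarrow> u \<in> borel_measurable (lebesgue_on {a..b})"
  by (simp add: L2_def)

lemma L2_mult_integrable:
  assumes "u \<in> L2 a b" "v \<in> L2 a b"
  shows "integrable (lebesgue_on {a..b}) (\<lambda>s. u s * v s)"
proof (rule Bochner_Integration.integrable_bound)
  show "integrable (lebesgue_on {a..b}) (\<lambda>s. (u s)\<^sup>2 + (v s)\<^sup>2)"
    using assms by (simp add: L2_def)
  have "\<bar>x * y\<bar> \<le> x\<^sup>2 + y\<^sup>2" for x y :: real
  proof -
    have "2 * (\<bar>x\<bar> * \<bar>y\<bar>) \<le> x\<^sup>2 + y\<^sup>2"
      using sum_squares_bound[of "\<bar>x\<bar>" "\<bar>y\<bar>"] by simp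
    moreover have "0 \<le> \<bar>x\<bar> * \<bar>y\<bar>" by simp
    ultimately show ?thesis unfolding abs_mult by linarith
  qed
  then show "AE s in lebesgue_on {a..b}. norm (u s * v s) \<le> norm ((u s)\<^sup>2 + (v s)\<^sup>2)"
    by simp
qed (use assms L2_measurable in auto)

lemma L2_continuous: "continuous_on {a..b} u \<Longrightarrow> u \<in> L2 a b"
  unfolding L2_def
  by (auto intro!: continuous_imp_integrable_real continuous_intros
      continuous_imp_measurable_on_sets_lebesgue)

lemma L2_integrable: "u \<in> L2 a b \<Longrightarrow> integrable (lebesgue_on {a..b}) u"
  using L2_mult_integrable[of u a b "\<lambda>_. 1"] L2_continuous[of a b "\<lambda>_. 1"] by simp

lemma L2_add: "u \<in> L2 a b \<Longrightarrow> v \<in> L2 a b \<Longrightarrow> (\<lambda>s. u s + v s) \<in> L2 a b"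
  using L2_mult_integrable[of u a b v]
  by (auto simp: L2_def power2_sum mult.assoc)

lemma L2_cong_AE:
  assumes "AE s in lebesgue_on {a..b}. u s = v s"
  shows "u \<in> L2 a b \<longleftrightarrow> v \<in> L2 a b"
proof -
  have "AE s in lebesgue_on {a..b}. v s = u s" and sq: "AE s in lebesgue_on {a..b}. (u s)\<^sup>2 = (v s)\<^sup>2"
    using assms by (auto elim: eventually_mono)
  then have "u \<in> borel_measurable (lebesgue_on {a..b}) \<longleftrightarrow> v \<in> borel_measurable (lebesgue_on {a..b})"
    using assms borel_measurable_lebesgue_on_AE[of _ "{a..b}"] by fastforce
  moreover have "integrable (lebesgue_on {a..b}) (\<lambda>s. (u s)\<^sup>2) \<longleftrightarrow> integrable (lebesgue_on {a..b}) (\<lambda>s. (v s)\<^sup>2)"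
    by (rule lebesgue_on_cong_AE(1)[OF _ sq]) simp
  ultimately show ?thesis unfolding L2_def by simp
qed

lemma L2_cmult: "u \<in> L2 a b \<Longrightarrow> (\<lambda>s. r * u s) \<in> L2 a b"
  by (auto simp: L2_def power_mult_distrib)

lemma L2_sum: "finite I \<Longrightarrow> (\<And>i. i \<in> I \<Longrightarrow> u i \<in> L2 a b) \<Longrightarrow> (\<lambda>s. \<Sum>i\<in>I. u i s) \<in> L2 a b"
  by (induction I rule: finite_induct) (auto intro: L2_add L2_continuous)

lemma L2_cong: "(\<And>s. s \<in> {a..b} \<Longrightarrow> u s = v s) \<Longrightarrow> u \<in> L2 a b \<longleftrightarrow> v \<in> L2 a b"
  by (intro L2_cong_AE AE_I2) simp

section \<open>Fubini on a triangle\<close>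

text \<open>Fubini's theorem on the triangle \<open>a \<le> \<theta> \<le> s \<le> b\<close>, for convolution kernels.\<close>

lemma
  fixes f g k :: "real \<Rightarrow> real"
  assumes f: "integrable (lebesgue_on {a..b}) f" and g: "integrable (lebesgue_on {a..b}) g"
    and k: "continuous_on UNIV k"
  shows integrable_triangle_inner_left:
      "integrable (lebesgue_on {a..b}) (\<lambda>s. f s * (LINT \<theta>|lebesgue_on {a..s}. k (s - \<theta>) * g \<theta>))"
    and integrable_triangle_inner_right:
      "integrable (lebesgue_on {a..b}) (\<lambda>\<theta>. (LINT s|lebesgue_on {\<theta>..b}. f s * k (s - \<theta>)) * g \<theta>)"
    and integral_triangle_swap:
      "(LINT s|lebesgue_on {a..b}. f s * (LINT \<theta>|lebesgue_on {a..s}. k (s - \<theta>) * g \<theta>)) =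
       (LINT \<theta>|lebesgue_on {a..b}. (LINT s|lebesgue_on {\<theta>..b}. f s * k (s - \<theta>)) * g \<theta>)"
proof -
  let ?M = "lebesgue_on {a..b}"
  interpret finite_measure ?M by (rule finite_measure_lebesgue_on_Icc)
  interpret pair_sigma_finite ?M ?M ..
  define F where "F s \<theta> = (if \<theta> \<le> s then f s * k (s - \<theta>) * g \<theta> else 0)" for s \<theta>
  have "continuous_on {a - b..b - a} k" using k continuous_on_subset by blast
  then have "bounded (k ` {a - b..b - a})"
    by (intro compact_imp_bounded compact_continuous_image) auto
  then obtain C where "\<forall>x\<in>k ` {a - b..b - a}. \<bar>x\<bar> \<le> C" unfolding bounded_iff by auto
  then have C: "\<bar>k x\<bar> \<le> C" if "x \<in> {a - b..b - a}" for x using that by blast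
  have [measurable]: "f \<in> borel_measurable ?M" "g \<in> borel_measurable ?M" using f g by auto
  have [measurable]: "k \<in> borel_measurable borel" using k by (rule borel_measurable_continuous_onI)
  have [measurable]: "(\<lambda>x. x) \<in> borel_measurable ?M"
    using id_borel_measurable_lebesgue_on[of "{a..b}"] by (simp add: id_def)
  have meas: "case_prod F \<in> borel_measurable (?M \<Otimes>\<^sub>M ?M)"
    unfolding F_def case_prod_beta by measurable
  have "integrable (?M \<Otimes>\<^sub>M ?M) (\<lambda>p. f (fst p) * g (snd p))"
  proof (rule Fubini_integrable)
    show "(\<lambda>p. f (fst p) * g (snd p)) \<in> borel_measurable (?M \<Otimes>\<^sub>M ?M)" by measurable
    show "integrable ?M (\<lambda>x. \<integral>y. norm (f (fst (x, y)) * g (snd (x, y))) \<partial>?M)"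
      using f g by (simp add: abs_mult)
    show "AE x in ?M. integrable ?M (\<lambda>y. f (fst (x, y)) * g (snd (x, y)))"
      using g by simp
  qed
  then have "integrable (?M \<Otimes>\<^sub>M ?M) (\<lambda>p. C * (f (fst p) * g (snd p)))" by simp
  then have int: "integrable (?M \<Otimes>\<^sub>M ?M) (case_prod F)"
  proof (rule Bochner_Integration.integrable_bound[OF _ meas], intro AE_I2)
    fix p assume "p \<in> space (?M \<Otimes>\<^sub>M ?M)"
    then have p: "fst p \<in> {a..b}" "snd p \<in> {a..b}" by (auto simp: space_pair_measure)
    then have "\<bar>k (fst p - snd p)\<bar> \<le> C" by (intro C) auto
    then have "\<bar>k (fst p - snd p)\<bar> * (\<bar>f (fst p)\<bar> * \<bar>g (snd p)\<bar>) \<le> \<bar>C\<bar> * (\<bar>f (fst p)\<bar> * \<bar>g (snd p)\<bar>)"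
      by (intro mult_right_mono) auto
    then show "norm (case_prod F p) \<le> norm (C * (f (fst p) * g (snd p)))"
      by (auto simp: F_def case_prod_beta abs_mult mult_ac)
  qed
  have left: "(\<integral>\<theta>. F s \<theta> \<partial>?M) = f s * (LINT \<theta>|lebesgue_on {a..s}. k (s - \<theta>) * g \<theta>)"
    if "s \<in> {a..b}" for s
  proof -
    have "(\<integral>\<theta>. F s \<theta> \<partial>?M) = (\<integral>\<theta>. (if \<theta> \<in> {a..s} then f s * (k (s - \<theta>) * g \<theta>) else 0) \<partial>?M)"
      by (intro Bochner_Integration.integral_cong) (auto simp: F_def)
    also have "\<dots> = (LINT \<theta>|lebesgue_on {a..s}. f s * (k (s - \<theta>) * g \<theta>))"
      using that by (intro integral_restrict) auto
    finally show ?thesis by simp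
  qed
  have right: "(LINT s|?M. F s \<theta>) = (LINT s|lebesgue_on {\<theta>..b}. f s * k (s - \<theta>)) * g \<theta>"
    if "\<theta> \<in> {a..b}" for \<theta>
  proof -
    have "(LINT s|?M. F s \<theta>) = (\<integral>s. (if s \<in> {\<theta>..b} then f s * k (s - \<theta>) * g \<theta> else 0) \<partial>?M)"
      by (intro Bochner_Integration.integral_cong) (auto simp: F_def)
    also have "\<dots> = (LINT s|lebesgue_on {\<theta>..b}. f s * k (s - \<theta>) * g \<theta>)"
      using that by (intro integral_restrict) auto
    finally show ?thesis by simp
  qed
  have "integrable ?M (\<lambda>s. LINT \<theta>|?M. F s \<theta>)" using integrable_fst'[OF int] by simp
  then show "integrable ?M (\<lambda>s. f s * (LINT \<theta>|lebesgue_on {a..s}. k (s - \<theta>) * g \<theta>))"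
    by (rule Bochner_Integration.integrable_cong[THEN iffD1, rotated 2]) (auto simp: left)
  have "integrable ?M (\<lambda>\<theta>. LINT s|?M. F s \<theta>)" using integrable_snd[OF int] by simp
  then show "integrable ?M (\<lambda>\<theta>. (LINT s|lebesgue_on {\<theta>..b}. f s * k (s - \<theta>)) * g \<theta>)"
    by (rule Bochner_Integration.integrable_cong[THEN iffD1, rotated 2]) (auto simp: right)
  have "(LINT s|?M. f s * (LINT \<theta>|lebesgue_on {a..s}. k (s - \<theta>) * g \<theta>)) = (LINT s|?M. LINT \<theta>|?M. F s \<theta>)"
    by (intro Bochner_Integration.integral_cong) (auto simp: left)
  also have "\<dots> = (LINT \<theta>|?M. LINT s|?M. F s \<theta>)"
    by (rule Fubini_integral[OF int, symmetric])
  also have "\<dots> = (LINT \<theta>|?M. (LINT s|lebesgue_on {\<theta>..b}. f s * k (s - \<theta>)) * g \<theta>)"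
    by (intro Bochner_Integration.integral_cong) (auto simp: right)
  finally show "(LINT s|?M. f s * (LINT \<theta>|lebesgue_on {a..s}. k (s - \<theta>) * g \<theta>)) =
       (LINT \<theta>|?M. (LINT s|lebesgue_on {\<theta>..b}. f s * k (s - \<theta>)) * g \<theta>)" .
qed

lemma integral_iterated_primitive:
  fixes v :: "real \<Rightarrow> real"
  assumes "integrable (lebesgue_on {a..s}) v"
  shows "(LINT t|lebesgue_on {a..s}. LINT \<theta>|lebesgue_on {a..t}. v \<theta>) =
         (LINT \<theta>|lebesgue_on {a..s}. (s - \<theta>) * v \<theta>)"
proof -
  have "(LINT t|lebesgue_on {a..s}. LINT \<theta>|lebesgue_on {a..t}. v \<theta>) =
      (LINT \<theta>|lebesgue_on {a..s}. (LINT t|lebesgue_on {\<theta>..s}. 1) * v \<theta>)"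
    using integral_triangle_swap[of a s "\<lambda>_. 1" v "\<lambda>_. 1"] assms
    by (simp add: continuous_imp_integrable_real)
  also have "\<dots> = (LINT \<theta>|lebesgue_on {a..s}. (s - \<theta>) * v \<theta>)"
    by (intro Bochner_Integration.integral_cong refl) (simp add: measure_restrict_space)
  finally show ?thesis .
qed

section \<open>The fundamental lemma and weak derivatives\<close>

lemma integral_mult_supported:
  fixes v \<phi> :: "real \<Rightarrow> real"
  assumes "{c..d} \<subseteq> {a..b}" "\<And>x. x \<notin> {c..d} \<Longrightarrow> \<phi> x = 0"
  shows "integrable (lebesgue_on {a..b}) (\<lambda>s. v s * \<phi> s) \<longleftrightarrow> integrable (lebesgue_on {c..d}) (\<lambda>s. v s * \<phi> s)"
    and "(LINT s|lebesgue_on {a..b}. v s * \<phi> s) = (LINT s|lebesgue_on {c..d}. v s * \<phi> s)"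
proof -
  have eq: "(\<lambda>s. if s \<in> {c..d} then v s * \<phi> s else 0) = (\<lambda>s. v s * \<phi> s)"
    "(\<lambda>s. if s \<in> {a..b} then v s * \<phi> s else 0) = (\<lambda>s. v s * \<phi> s)"
    using assms by fastforce+
  show "integrable (lebesgue_on {a..b}) (\<lambda>s. v s * \<phi> s) \<longleftrightarrow> integrable (lebesgue_on {c..d}) (\<lambda>s. v s * \<phi> s)"
    using Lebesgue_Measure.integrable_restrict_UNIV[of "{c..d}" "\<lambda>s. v s * \<phi> s"] 
      Lebesgue_Measure.integrable_restrict_UNIV[of "{a..b}" "\<lambda>s. v s * \<phi> s"] by (simp only: eq) simp
  show "(LINT s|lebesgue_on {a..b}. v s * \<phi> s) = (LINT s|lebesgue_on {c..d}. v s * \<phi> s)"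
    using Lebesgue_Measure.integral_restrict_UNIV[of "{c..d}" "\<lambda>s. v s * \<phi> s"] 
      Lebesgue_Measure.integral_restrict_UNIV[of "{a..b}" "\<lambda>s. v s * \<phi> s"] by (simp only: eq) simp
qed

lemma locally_L1_I: "integrable (lebesgue_on {a..b}) v \<Longrightarrow> locally_L1 a b v"
  unfolding locally_L1_def by (auto elim!: integrable_subinterval)

lemma locally_L1_test_integrable:
  assumes "locally_L1 a b v" "test_function a b \<phi>"
  shows "integrable (lebesgue_on {a..b}) (\<lambda>s. v s * \<phi> s)"
proof -
  obtain c d where *: "smooth \<phi>" "a < c" "d < b" "\<forall>x. x \<notin> {c..d} \<longrightarrow> \<phi> x = 0"
    using assms unfolding test_function_iff by blast
  have "integrable (lebesgue_on {c..d}) (\<lambda>s. v s * \<phi> s)"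
  proof (cases "c \<le> d")
    case True
    with * assms(1) show ?thesis
      by (intro integrable_mult_continuous smooth_continuous) (auto simp: locally_L1_def)
  qed auto
  with * show ?thesis by (subst integral_mult_supported) auto
qed

text \<open>The fundamental lemma of the calculus of variations.\<close>

lemma AE_zero_if_test_integrals_zero:
  assumes "locally_L1 a b v"
    and "\<And>\<phi>. test_function a b \<phi> \<Longrightarrow> (LINT s|lebesgue_on {a..b}. v s * \<phi> s) = 0"
  shows "AE s in lebesgue_on {a..b}. v s = 0"
proof (rule AE_lebesgue_on_Icc_exhaust)
  have zero: "integral {c..d} v = 0" if "a < c" "c \<le> d" "d < b" for c d
  proof (cases "c = d")
    case False
    with that have "c < d" by simp
    obtain \<phi> where \<phi>: "\<And>n. test_function a b (\<phi> n)" "\<And>n x. 0 \<le> \<phi> n x" "\<And>n x. \<phi> n x \<le> 1"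
      "\<And>x. (\<lambda>n. \<phi> n x) \<longlonglongrightarrow> indicator {c<..<d} x"
      "\<And>n x. x \<notin> {c<..<d} \<Longrightarrow> \<phi> n x = (0::real)"
      using test_function_approx_indicator[OF \<open>a < c\<close> \<open>c < d\<close> \<open>d < b\<close>] by metis
    have v: "integrable (lebesgue_on {c..d}) v" using assms(1) that by (auto simp: locally_L1_def)
    have \<phi>v: "integrable (lebesgue_on {c..d}) (\<lambda>s. v s * \<phi> n s)" for n
      using \<phi>(1)[of n] by (intro integrable_mult_continuous v smooth_continuous) (auto simp: test_function_iff)
    have "(LINT s|lebesgue_on {c..d}. v s * \<phi> n s) = 0" for n
      using integral_mult_supported(2)[of c d a b "\<phi> n" v] assms(2)[OF \<phi>(1)] \<phi>(5) that by force
    moreover have "(\<lambda>n. LINT s|lebesgue_on {c..d}. v s * \<phi> n s) \<longlonglongrightarrow> 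
        (LINT s|lebesgue_on {c..d}. v s * indicator {c<..<d} s)"
    proof (rule integral_dominated_convergence[where w="\<lambda>s. \<bar>v s\<bar>"])
      have "{c<..<d} \<in> sets (lebesgue_on {c..d})" by (subst sets_restrict_space_iff) auto
      then show "(\<lambda>s. v s * indicator {c<..<d} s) \<in> borel_measurable (lebesgue_on {c..d})"
        using v by (intro borel_measurable_times borel_measurable_indicator) auto
      show "AE s in lebesgue_on {c..d}. (\<lambda>n. v s * \<phi> n s) \<longlonglongrightarrow> v s * indicator {c<..<d} s"
        by (intro AE_I2 tendsto_intros \<phi>)
      show "AE s in lebesgue_on {c..d}. norm (v s * \<phi> n s) \<le> \<bar>v s\<bar>" for n
        using \<phi>(2,3) by (intro AE_I2) (auto simp: abs_mult intro: mult_left_le)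
    qed (use v \<phi>v in auto)
    ultimately have "(LINT s|lebesgue_on {c..d}. v s * indicator {c<..<d} s) = 0"
      by (simp add: LIMSEQ_const_iff)
    moreover have "AE s in lebesgue_on {c..d}. s \<noteq> c" "AE s in lebesgue_on {c..d}. s \<noteq> d"
      by (intro AE_lebesgue_on_neq; simp)+
    then have "AE s in lebesgue_on {c..d}. v s * indicator {c<..<d} s = v s"
      using AE_space[of "lebesgue_on {c..d}"]
      by eventually_elim (auto simp: indicator_def)
    ultimately have "integral\<^sup>L (lebesgue_on {c..d}) v = 0" using lebesgue_on_cong_AE(2) by fastforce
    with v show ?thesis by (simp add: lebesgue_integral_eq_integral)
  qed simp
  fix c d assume "a < c" "c < d" "d < b"
  then show "AE s in lebesgue_on {c..d}. v s = 0"
    using assms(1) by (intro zero_integrals_imp_AE_zero zero) (auto simp: locally_L1_def)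
qed

lemma locally_L1_diff: "locally_L1 a b u \<Longrightarrow> locally_L1 a b v \<Longrightarrow> locally_L1 a b (\<lambda>s. u s - v s)"
  unfolding locally_L1_def by auto

lemma locally_L1_cong_AE:
  assumes "AE s in lebesgue_on {a..b}. u s = v s"
  shows "locally_L1 a b u \<longleftrightarrow> locally_L1 a b v"
proof -
  have "integrable (lebesgue_on {c..d}) u \<longleftrightarrow> integrable (lebesgue_on {c..d}) v" if "a < c" "d < b" for c d
    using that by (intro lebesgue_on_cong_AE AE_lebesgue_on_subset[OF assms]) auto
  then show ?thesis unfolding locally_L1_def by blast
qed

lemma has_weak_deriv_unique:
  assumes "has_weak_deriv a b l u v" "has_weak_deriv a b l u v'"
  shows "AE s in lebesgue_on {a..b}. v s = v' s"
proof -
  have l: "locally_L1 a b v" "locally_L1 a b v'" using assms by (auto simp: has_weak_deriv_def)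
  have "AE s in lebesgue_on {a..b}. v s - v' s = 0"
  proof (rule AE_zero_if_test_integrals_zero[OF locally_L1_diff[OF l]])
    fix \<phi> assume \<phi>: "test_function a b \<phi>"
    have "(LINT s|lebesgue_on {a..b}. v s * \<phi> s) = (LINT s|lebesgue_on {a..b}. v' s * \<phi> s)"
      using assms \<phi> by (auto simp: has_weak_deriv_def)
    then show "(LINT s|lebesgue_on {a..b}. (v s - v' s) * \<phi> s) = 0"
      using \<phi> l by (simp add: left_diff_distrib locally_L1_test_integrable)
  qed
  then show ?thesis by (auto elim: eventually_mono)
qed

lemma has_weak_deriv_cong_AE:
  assumes "AE s in lebesgue_on {a..b}. u s = u' s" "AE s in lebesgue_on {a..b}. v s = v' s"
  shows "has_weak_deriv a b l u v \<longleftrightarrow> has_weak_deriv a b l u' v'"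
proof -
  have "AE s in lebesgue_on {a..b}. u s * (deriv ^^ l) \<phi> s = u' s * (deriv ^^ l) \<phi> s"
    "AE s in lebesgue_on {a..b}. v s * \<phi> s = v' s * \<phi> s" for \<phi>
    using assms by (auto elim: eventually_mono)
  note * = this[THEN lebesgue_on_cong_AE(2)[rotated]]
  show ?thesis
    unfolding has_weak_deriv_def using assms[THEN locally_L1_cong_AE] by (simp add: *)
qed

lemma has_weak_deriv_wderiv:
  assumes "has_weak_deriv a b l u v"
  shows "has_weak_deriv a b l u (wderiv a b l u)" "AE s in lebesgue_on {a..b}. wderiv a b l u s = v s"
proof -
  show 1: "has_weak_deriv a b l u (wderiv a b l u)" 
    unfolding wderiv_def using assms by (rule someI[of "has_weak_deriv a b l u"])
  show "AE s in lebesgue_on {a..b}. wderiv a b l u s = v s"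
    by (rule has_weak_deriv_unique[OF 1 assms])
qed

text \<open>The lemma of du Bois-Reymond.\<close>

lemma AE_const_if_test_deriv_integrals_zero:
  assumes "a < b" and w: "integrable (lebesgue_on {a..b}) w"
    and zero: "\<And>\<phi>. test_function a b \<phi> \<Longrightarrow> (LINT s|lebesgue_on {a..b}. w s * deriv \<phi> s) = 0"
  obtains c where "AE s in lebesgue_on {a..b}. w s = c"
proof -
  define I where "I f = (LINT s|lebesgue_on {a..b}. f s)" for f :: "real \<Rightarrow> real"
  obtain c d where cd: "a < c" "c < d" "d < b"
    using dense[OF \<open>a < b\<close>] dense by (meson order.strict_trans)
  obtain \<eta>0 :: "real \<Rightarrow> real" where \<eta>0: "test_function a b \<eta>0" "\<And>x. \<eta>0 x \<ge> 0" "\<And>x. x \<in> {c<..<d} \<Longrightarrow> \<eta>0 x > 0"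
    using test_function_approx_indicator[OF cd] by metis
  have cont: "continuous_on S \<phi>" if "test_function a b \<phi>" for \<phi> S
    using that smooth_continuous unfolding test_function_iff by blast
  have int: "integrable (lebesgue_on {a..b}) \<phi>" if "test_function a b \<phi>" for \<phi>
    using cont[OF that] by (intro continuous_imp_integrable_real)
  have I: "I \<phi> = integral {a..b} \<phi>" if "test_function a b \<phi>" for \<phi>
    unfolding I_def using int[OF that] by (simp add: lebesgue_integral_eq_integral)
  have "integral {a..b} \<eta>0 \<noteq> 0"
    using integral_eq_0_iff[OF cont[OF \<eta>0(1)] \<open>a < b\<close>] \<eta>0(2) \<eta>0(3)[of "(c + d) / 2"] cd
    by (auto intro!: bexI[of _ "(c + d) / 2"])
  then have I0: "I \<eta>0 \<noteq> 0" using I[OF \<eta>0(1)] by simp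
  \<comment> \<open>with a fixed \<open>\<eta>\<close> of integral one, \<open>\<phi> - I \<phi> \<cdot> \<eta>\<close> has mean zero and so is the derivative of
    a test function; testing against it identifies \<open>w\<close> with the constant \<open>m\<close>\<close>
  define \<eta> where "\<eta> x = (1 / I \<eta>0) * \<eta>0 x" for x
  have \<eta>: "test_function a b \<eta>" unfolding \<eta>_def by (rule test_function_cmult[OF \<eta>0(1)])
  have I1: "I \<eta> = 1" using I0 unfolding \<eta>_def I_def by simp
  define m where "m = I (\<lambda>s. w s * \<eta> s)"
  have lw: "locally_L1 a b w" by (rule locally_L1_I[OF w])
  have "AE s in lebesgue_on {a..b}. w s - m = 0"
  proof (rule AE_zero_if_test_integrals_zero)
    show "locally_L1 a b (\<lambda>s. w s - m)"
      using w by (intro locally_L1_diff lw locally_L1_I continuous_imp_integrable_real) auto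
    fix \<phi> assume \<phi>: "test_function a b \<phi>"
    define \<psi> where "\<psi> x = \<phi> x + (- I \<phi>) * \<eta> x" for x
    have \<psi>: "test_function a b \<psi>" unfolding \<psi>_def
      by (intro test_function_add test_function_cmult \<phi> \<eta>)
    have "I \<psi> = I \<phi> + (- I \<phi>) * I \<eta>" 
      using int[OF \<phi>] int[OF \<eta>] unfolding I_def \<psi>_def by simp
    then have "integral {a..b} \<psi> = 0" using I1 I[OF \<psi>] by simp
    then obtain \<Psi> where \<Psi>: "test_function a b \<Psi>" "deriv \<Psi> = \<psi>"
      using test_function_primitive[OF \<psi> \<open>a < b\<close>] by blast
    have i: "integrable (lebesgue_on {a..b}) (\<lambda>s. w s * \<phi> s)" "integrable (lebesgue_on {a..b}) (\<lambda>s. w s * \<eta> s)"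
      using locally_L1_test_integrable lw \<phi> \<eta> by blast+
    have "0 = I (\<lambda>s. w s * \<psi> s)" using zero[OF \<Psi>(1)] \<Psi>(2) by (simp add: I_def)
    also have "\<dots> = I (\<lambda>s. w s * \<phi> s + (- I \<phi>) * (w s * \<eta> s))" 
      by (intro arg_cong[where f=I]) (auto simp: \<psi>_def algebra_simps)
    also have "\<dots> = I (\<lambda>s. w s * \<phi> s) - I \<phi> * m" unfolding m_def using i by (simp add: I_def)
    also have "\<dots> = I (\<lambda>s. w s * \<phi> s - m * \<phi> s)" using i int[OF \<phi>] by (simp add: I_def)
    finally show "(LINT s|lebesgue_on {a..b}. (w s - m) * \<phi> s) = 0"
      by (simp add: I_def left_diff_distrib)
  qed
  then show thesis using that[of m] by (auto elim: eventually_mono)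
qed

section \<open>Sobolev functions on an interval\<close>

lemma has_weak_deriv_primitive:
  assumes "a < b" and v: "integrable (lebesgue_on {a..b}) v"
  shows "has_weak_deriv a b 1 (\<lambda>s. c + (LINT \<theta>|lebesgue_on {a..s}. v \<theta>)) v"
proof -
  let ?P = "\<lambda>s. LINT \<theta>|lebesgue_on {a..s}. v \<theta>"
  have cont: "continuous_on {a..b} ?P" by (rule indefinite_integral_continuous_real[OF v])
  have "(LINT s|lebesgue_on {a..b}. (c + ?P s) * deriv \<phi> s) = - (LINT s|lebesgue_on {a..b}. v s * \<phi> s)"
    if \<phi>: "test_function a b \<phi>" for \<phi>
  proof -
    have sm: "smooth \<phi>" using \<phi> by (simp add: test_function_iff)
    have bd: "\<phi> a = 0" "\<phi> b = 0" using \<phi> unfolding test_function_iff by force+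
    have c': "continuous_on S (deriv \<phi>)" for S by (intro smooth_continuous smooth_deriv sm)
    have ftc: "(LINT s|lebesgue_on {\<theta>..b}. deriv \<phi> s) = - \<phi> \<theta>" if "\<theta> \<le> b" for \<theta>
    proof -
      have "(deriv \<phi> has_integral (\<phi> b - \<phi> \<theta>)) {\<theta>..b}"
        using that smooth_has_derivative[OF sm]
        by (intro fundamental_theorem_of_calculus)
          (auto simp: has_real_derivative_iff_has_vector_derivative[symmetric]
            intro: has_field_derivative_at_within)
      then have "integral {\<theta>..b} (deriv \<phi>) = - \<phi> \<theta>" by (simp add: integral_unique bd)
      then show ?thesis
        by (simp add: lebesgue_integral_eq_integral continuous_imp_integrable_real c')
    qed
    have "(LINT s|lebesgue_on {a..b}. (c + ?P s) * deriv \<phi> s) =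
        (LINT s|lebesgue_on {a..b}. c * deriv \<phi> s + deriv \<phi> s * ?P s)"
      by (intro Bochner_Integration.integral_cong refl) (simp add: algebra_simps)
    also have "\<dots> = c * (LINT s|lebesgue_on {a..b}. deriv \<phi> s) + (LINT s|lebesgue_on {a..b}. deriv \<phi> s * ?P s)"
      by (subst Bochner_Integration.integral_add)
        (auto intro!: continuous_imp_integrable_real continuous_intros c' cont)
    also have "(LINT s|lebesgue_on {a..b}. deriv \<phi> s) = 0"
      using ftc[of a] bd \<open>a < b\<close> by simp
    also have "(LINT s|lebesgue_on {a..b}. deriv \<phi> s * ?P s) =
        (LINT \<theta>|lebesgue_on {a..b}. (LINT s|lebesgue_on {\<theta>..b}. deriv \<phi> s) * v \<theta>)"
      using integral_triangle_swap[of a b "deriv \<phi>" v "\<lambda>_. 1"] v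
      by (simp add: continuous_imp_integrable_real c')
    also have "\<dots> = (LINT \<theta>|lebesgue_on {a..b}. - (v \<theta> * \<phi> \<theta>))"
      by (intro Bochner_Integration.integral_cong refl) (simp add: ftc)
    finally show ?thesis by simp
  qed
  moreover have "locally_L1 a b (\<lambda>s. c + ?P s)"
    by (intro locally_L1_I continuous_imp_integrable_real continuous_intros cont)
  ultimately show ?thesis using locally_L1_I[OF v] by (simp add: has_weak_deriv_def)
qed

text \<open>The second weak derivative is the weak derivative of the first one.\<close>

lemma has_weak_deriv_2:
  assumes "has_weak_deriv a b 1 u w"
  shows "has_weak_deriv a b 2 u v \<longleftrightarrow> has_weak_deriv a b 1 w v"
proof -
  have "(LINT s|lebesgue_on {a..b}. u s * deriv (deriv \<phi>) s) = (LINT s|lebesgue_on {a..b}. v s * \<phi> s) \<longleftrightarrow>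
      (LINT s|lebesgue_on {a..b}. w s * deriv \<phi> s) = - (LINT s|lebesgue_on {a..b}. v s * \<phi> s)"
    if "test_function a b \<phi>" for \<phi>
  proof -
    have "(LINT s|lebesgue_on {a..b}. u s * deriv (deriv \<phi>) s) = - (LINT s|lebesgue_on {a..b}. w s * deriv \<phi> s)"
      using assms test_function_deriv[OF that] by (simp add: has_weak_deriv_def)
    then show ?thesis by linarith
  qed
  moreover have "locally_L1 a b u" "locally_L1 a b w" using assms by (auto simp: has_weak_deriv_def)
  ultimately show ?thesis by (auto simp: has_weak_deriv_def numeral_2_eq_2)
qed

lemma has_weak_deriv_0: "u \<in> L2 a b \<Longrightarrow> has_weak_deriv a b 0 u u"
  by (simp add: has_weak_deriv_def locally_L1_I L2_integrable)

lemma sobolev_0: "sobolev a b 0 = L2 a b"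
  using has_weak_deriv_0 by (auto simp: sobolev_def)

lemma sobolev_1_iff: "u \<in> sobolev a b 1 \<longleftrightarrow> u \<in> L2 a b \<and> (\<exists>v\<in>L2 a b. has_weak_deriv a b 1 u v)"
  using has_weak_deriv_0 by (auto simp: sobolev_def le_Suc_eq)

lemma sobolev_2_iff:
  "u \<in> sobolev a b 2 \<longleftrightarrow> u \<in> L2 a b \<and>
     (\<exists>w\<in>L2 a b. has_weak_deriv a b 1 u w \<and> (\<exists>v\<in>L2 a b. has_weak_deriv a b 1 w v))"
proof -
  have "u \<in> sobolev a b 2 \<longleftrightarrow> u \<in> L2 a b \<and> (\<exists>w\<in>L2 a b. has_weak_deriv a b 1 u w) \<and>
      (\<exists>v\<in>L2 a b. has_weak_deriv a b 2 u v)"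
    using has_weak_deriv_0 by (auto simp: sobolev_def le_Suc_eq numeral_2_eq_2)
  then show ?thesis using has_weak_deriv_2 by blast
qed

lemma cont_rep_eqI:
  assumes "a < b" "continuous_on {a..b} g" "AE s in lebesgue_on {a..b}. u s = g s" "s \<in> {a..b}"
  shows "cont_rep a b u s = g s"
proof -
  have "AE s in lebesgue_on {a..b}. g s = u s" using assms(3) by (auto elim: eventually_mono)
  with assms(2) have *: "continuous_on {a..b} (cont_rep a b u) \<and>
      (AE s in lebesgue_on {a..b}. cont_rep a b u s = u s)"
    unfolding cont_rep_def
    by (intro someI[of "\<lambda>g. continuous_on {a..b} g \<and> (AE s in lebesgue_on {a..b}. g s = u s)" g]) auto
  then have "AE s in lebesgue_on {a..b}. cont_rep a b u s = u s" by blast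
  with assms(3) have "AE s in lebesgue_on {a..b}. cont_rep a b u s = g s" by eventually_elim simp
  with assms * show ?thesis by (intro continuous_AE_eq_imp_eq) auto
qed

text \<open>
  An element of \<open>W\<^sub>1\<close> differs from the primitive of its weak derivative by a constant, by the
  lemma of du Bois-Reymond.
\<close>

lemma sobolev_1_structure:
  assumes "a < b" "u \<in> sobolev a b 1"
  shows "wderiv a b 1 u \<in> L2 a b"
    and "AE s in lebesgue_on {a..b}. u s = cont_rep a b u s"
    and "\<And>s. s \<in> {a..b} \<Longrightarrow>
      cont_rep a b u s = cont_rep a b u a + (LINT \<theta>|lebesgue_on {a..s}. wderiv a b 1 u \<theta>)"
proof -
  define v where "v = wderiv a b 1 u"
  obtain v' where v': "v' \<in> L2 a b" "has_weak_deriv a b 1 u v'" and u: "u \<in> L2 a b"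
    using assms(2) unfolding sobolev_1_iff by blast
  have wd: "has_weak_deriv a b 1 u v" and ae: "AE s in lebesgue_on {a..b}. v s = v' s"
    using has_weak_deriv_wderiv[OF v'(2)] by (simp_all add: v_def)
  show "wderiv a b 1 u \<in> L2 a b" using L2_cong_AE[OF ae] v'(1) by (simp add: v_def)
  then have v: "integrable (lebesgue_on {a..b}) v" by (simp add: v_def L2_integrable)
  define P where "P = (\<lambda>s. LINT \<theta>|lebesgue_on {a..s}. v \<theta>)"
  have cont: "continuous_on {a..b} P" 
    unfolding P_def by (rule indefinite_integral_continuous_real[OF v])
  then have P: "P \<in> L2 a b" by (rule L2_continuous)
  have wP: "has_weak_deriv a b 1 P v"
    using has_weak_deriv_primitive[OF assms(1) v, of 0] by (simp add: P_def)
  have i: "integrable (lebesgue_on {a..b}) (\<lambda>s. u s - P s)" using u P by (simp add: L2_integrable)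
  have "\<exists>c. AE s in lebesgue_on {a..b}. u s - P s = c"
  proof (rule AE_const_if_test_deriv_integrals_zero[OF assms(1) i])
    fix \<phi> assume \<phi>: "test_function a b \<phi>"
    have "integrable (lebesgue_on {a..b}) (\<lambda>s. u s * deriv \<phi> s)" "integrable (lebesgue_on {a..b}) (\<lambda>s. P s * deriv \<phi> s)"
      using u P test_function_deriv[OF \<phi>] by (auto intro!: locally_L1_test_integrable locally_L1_I intro: L2_integrable)
    moreover have "(LINT s|lebesgue_on {a..b}. u s * deriv \<phi> s) = (LINT s|lebesgue_on {a..b}. P s * deriv \<phi> s)"
      using wd wP \<phi> by (auto simp: has_weak_deriv_def)
    ultimately show "(LINT s|lebesgue_on {a..b}. (u s - P s) * deriv \<phi> s) = 0"
      by (simp add: left_diff_distrib)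
  qed blast
  then obtain c where "AE s in lebesgue_on {a..b}. u s - P s = c" by blast
  then have c: "AE s in lebesgue_on {a..b}. u s = c + P s" by (auto elim: eventually_mono)
  have rep: "cont_rep a b u s = c + P s" if "s \<in> {a..b}" for s
    using that by (intro cont_rep_eqI[OF assms(1) _ c] continuous_intros cont)
  show "AE s in lebesgue_on {a..b}. u s = cont_rep a b u s"
    using c AE_space[of "lebesgue_on {a..b}"] by eventually_elim (simp add: rep)
  fix s assume s: "s \<in> {a..b}"
  have "P a = 0"
    unfolding P_def by (rule integral_eq_zero_null_sets) (simp add: null_sets_completionI)
  then show "cont_rep a b u s = cont_rep a b u a + (LINT \<theta>|lebesgue_on {a..s}. wderiv a b 1 u \<theta>)"
    using rep[OF s] rep[of a] assms(1) unfolding v_def[symmetric] by (simp add: P_def)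
qed

lemma sobolev_1_primitive:
  assumes "a < b" "v \<in> L2 a b"
    and u: "AE s in lebesgue_on {a..b}. u s = c + (LINT \<theta>|lebesgue_on {a..s}. v \<theta>)"
  shows "u \<in> sobolev a b 1" "has_weak_deriv a b 1 u v"
    and "AE s in lebesgue_on {a..b}. wderiv a b 1 u s = v s"
    and "\<And>s. s \<in> {a..b} \<Longrightarrow> cont_rep a b u s = c + (LINT \<theta>|lebesgue_on {a..s}. v \<theta>)"
proof -
  have v: "integrable (lebesgue_on {a..b}) v" using assms by (simp add: L2_integrable)
  have cont: "continuous_on {a..b} (\<lambda>s. c + (LINT \<theta>|lebesgue_on {a..s}. v \<theta>))"
    by (intro continuous_intros indefinite_integral_continuous_real[OF v])
  show wd: "has_weak_deriv a b 1 u v"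
    using has_weak_deriv_primitive[OF assms(1) v] has_weak_deriv_cong_AE[OF u, of v v] by auto
  show "u \<in> sobolev a b 1"
    unfolding sobolev_1_iff using wd assms(2) L2_cong_AE[OF u] L2_continuous[OF cont] by blast
  show "AE s in lebesgue_on {a..b}. wderiv a b 1 u s = v s" by (rule has_weak_deriv_wderiv(2)[OF wd])
  show "cont_rep a b u s = c + (LINT \<theta>|lebesgue_on {a..s}. v \<theta>)" if "s \<in> {a..b}" for s
    using that by (intro cont_rep_eqI[OF assms(1) cont u])
qed

text \<open>Taylor's formula of order two with integral remainder, for elements of \<open>W\<^sub>2\<close>.\<close>

lemma sobolev_2_structure:
  assumes "a < b" "u \<in> sobolev a b 2"
  defines "w \<equiv> wderiv a b 1 u" and "v \<equiv> wderiv a b 2 u"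
  shows "u \<in> sobolev a b 1" "w \<in> sobolev a b 1" "v \<in> L2 a b"
    and "\<And>s. s \<in> {a..b} \<Longrightarrow>
      cont_rep a b w s = cont_rep a b w a + (LINT \<theta>|lebesgue_on {a..s}. v \<theta>)"
    and "\<And>s. s \<in> {a..b} \<Longrightarrow> cont_rep a b u s =
      cont_rep a b u a + (s - a) * cont_rep a b w a + (LINT \<theta>|lebesgue_on {a..s}. (s - \<theta>) * v \<theta>)"
proof -
  obtain w' v' where *: "u \<in> L2 a b" "w' \<in> L2 a b" "has_weak_deriv a b 1 u w'" "v' \<in> L2 a b"
    "has_weak_deriv a b 1 w' v'"
    using assms(2) unfolding sobolev_2_iff by blast
  show u: "u \<in> sobolev a b 1" using * unfolding sobolev_1_iff by blast
  have uw: "has_weak_deriv a b 1 u w" and ww': "AE s in lebesgue_on {a..b}. w s = w' s"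
    using has_weak_deriv_wderiv[OF *(3)] by (simp_all add: w_def)
  have wv': "has_weak_deriv a b 1 w v'"
    using *(5) has_weak_deriv_cong_AE[OF ww', of v' v'] by auto
  have wL: "w \<in> L2 a b" using *(2) L2_cong_AE[OF ww'] by blast
  show w: "w \<in> sobolev a b 1" using wL wv' *(4) unfolding sobolev_1_iff by blast
  have "has_weak_deriv a b 2 u v'" using has_weak_deriv_2[OF uw] wv' by blast
  note uv = has_weak_deriv_wderiv[OF this, folded v_def]
  then show vL: "v \<in> L2 a b" using L2_cong_AE *(4) by blast
  have "has_weak_deriv a b 1 w v" using has_weak_deriv_2[OF uw] uv(1) by blast
  from has_weak_deriv_wderiv(2)[OF this]
  have v: "AE s in lebesgue_on {a..b}. wderiv a b 1 w s = v s" .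
  show rep: "cont_rep a b w s = cont_rep a b w a + (LINT \<theta>|lebesgue_on {a..s}. v \<theta>)"
    if "s \<in> {a..b}" for s
  proof -
    have "AE \<theta> in lebesgue_on {a..s}. wderiv a b 1 w \<theta> = v \<theta>"
      using that by (intro AE_lebesgue_on_subset[OF v]) auto
    from lebesgue_on_cong_AE(2)[OF _ this] sobolev_1_structure(3)[OF assms(1) w that]
    show ?thesis by simp
  qed
  show "cont_rep a b u s =
      cont_rep a b u a + (s - a) * cont_rep a b w a + (LINT \<theta>|lebesgue_on {a..s}. (s - \<theta>) * v \<theta>)"
    if s: "s \<in> {a..b}" for s
  proof -
    have vs: "integrable (lebesgue_on {a..s}) v"
      by (rule integrable_subinterval[OF L2_integrable[OF vL]]) (use s in auto)
    have "AE t in lebesgue_on {a..b}. w t = cont_rep a b w a + (LINT \<theta>|lebesgue_on {a..t}. v \<theta>)"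
      using sobolev_1_structure(2)[OF assms(1) w] AE_space[of "lebesgue_on {a..b}"]
    proof eventually_elim
      case (elim t)
      then show ?case using rep[of t] by simp
    qed
    then have "AE t in lebesgue_on {a..s}. w t = cont_rep a b w a + (LINT \<theta>|lebesgue_on {a..t}. v \<theta>)"
      by (rule AE_lebesgue_on_subset) (use s in auto)
    then have "(LINT t|lebesgue_on {a..s}. w t) =
        (LINT t|lebesgue_on {a..s}. cont_rep a b w a + (LINT \<theta>|lebesgue_on {a..t}. v \<theta>))"
      by (intro lebesgue_on_cong_AE) auto
    also have "\<dots> = (LINT t|lebesgue_on {a..s}. cont_rep a b w a) +
        (LINT t|lebesgue_on {a..s}. LINT \<theta>|lebesgue_on {a..t}. v \<theta>)"
      by (intro Bochner_Integration.integral_add continuous_imp_integrable_real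
          indefinite_integral_continuous_real vs) simp
    also have "(LINT t|lebesgue_on {a..s}. cont_rep a b w a) = (s - a) * cont_rep a b w a"
      using s by (simp add: measure_restrict_space)
    finally show ?thesis
      using sobolev_1_structure(3)[OF assms(1) u s] integral_iterated_primitive[OF vs]
      by (simp add: w_def)
  qed
qed

lemma sobolev_2_primitive:
  assumes "a < b" "v \<in> L2 a b"
    and u: "AE s in lebesgue_on {a..b}.
      u s = c + (s - a) * d + (LINT \<theta>|lebesgue_on {a..s}. (s - \<theta>) * v \<theta>)"
  shows "u \<in> sobolev a b 2"
    and "AE s in lebesgue_on {a..b}. wderiv a b 2 u s = v s"
    and "AE s in lebesgue_on {a..b}. wderiv a b 1 u s = d + (LINT \<theta>|lebesgue_on {a..s}. v \<theta>)"
    and "\<And>s. s \<in> {a..b} \<Longrightarrow>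
      cont_rep a b u s = c + (s - a) * d + (LINT \<theta>|lebesgue_on {a..s}. (s - \<theta>) * v \<theta>)"
    and "\<And>s. s \<in> {a..b} \<Longrightarrow>
      cont_rep a b (wderiv a b 1 u) s = d + (LINT \<theta>|lebesgue_on {a..s}. v \<theta>)"
proof -
  define w where "w s = d + (LINT \<theta>|lebesgue_on {a..s}. v \<theta>)" for s
  have cw: "continuous_on {a..b} w"
    unfolding w_def by (intro continuous_intros indefinite_integral_continuous_real L2_integrable assms)
  then have wL: "w \<in> L2 a b" by (rule L2_continuous)
  have Pw: "(s - a) * d + (LINT \<theta>|lebesgue_on {a..s}. (s - \<theta>) * v \<theta>) = (LINT \<theta>|lebesgue_on {a..s}. w \<theta>)"
    if s: "s \<in> {a..b}" for s
  proof -
    have vs: "integrable (lebesgue_on {a..s}) v"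
      by (rule integrable_subinterval[OF L2_integrable[OF assms(2)]]) (use s in auto)
    have "(LINT t|lebesgue_on {a..s}. w t) = (LINT t|lebesgue_on {a..s}. d) +
        (LINT t|lebesgue_on {a..s}. LINT \<theta>|lebesgue_on {a..t}. v \<theta>)"
      unfolding w_def
      by (intro Bochner_Integration.integral_add continuous_imp_integrable_real
          indefinite_integral_continuous_real vs) simp
    also have "(LINT t|lebesgue_on {a..s}. d) = (s - a) * d"
      using s by (simp add: measure_restrict_space)
    finally show ?thesis by (simp add: integral_iterated_primitive[OF vs])
  qed
  have u': "AE s in lebesgue_on {a..b}. u s = c + (LINT \<theta>|lebesgue_on {a..s}. w \<theta>)"
    using u AE_space[of "lebesgue_on {a..b}"] by eventually_elim (simp add: Pw[symmetric])
  note 1 = sobolev_1_primitive[OF assms(1) wL u']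
  have w1: "AE s in lebesgue_on {a..b}. w s = d + (LINT \<theta>|lebesgue_on {a..s}. v \<theta>)"
    by (simp add: w_def)
  note 2 = sobolev_1_primitive[OF assms(1,2) w1]
  have "has_weak_deriv a b 2 u v" using has_weak_deriv_2[OF 1(2)] 2(2) by blast
  then show "AE s in lebesgue_on {a..b}. wderiv a b 2 u s = v s" by (rule has_weak_deriv_wderiv(2))
  have "u \<in> L2 a b" using 1(1) unfolding sobolev_1_iff by blast
  then show "u \<in> sobolev a b 2" using 1(2) 2(2) wL assms(2) unfolding sobolev_2_iff by blast
  show wd: "AE s in lebesgue_on {a..b}. wderiv a b 1 u s = d + (LINT \<theta>|lebesgue_on {a..s}. v \<theta>)"
    using 1(3) by (simp add: w_def)
  show "cont_rep a b u s = c + (s - a) * d + (LINT \<theta>|lebesgue_on {a..s}. (s - \<theta>) * v \<theta>)"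
    if "s \<in> {a..b}" for s
    using 1(4)[OF that] Pw[OF that] by simp
  show "cont_rep a b (wderiv a b 1 u) s = d + (LINT \<theta>|lebesgue_on {a..s}. v \<theta>)" if "s \<in> {a..b}" for s
    by (rule sobolev_1_primitive(4)[OF assms(1,2) wd that])
qed

section \<open>Block matrices\<close>

lemma append_rows_index:
  assumes "i < dim_row A + dim_row B" "j < dim_col A" "dim_col B = dim_col A"
  shows "(A @\<^sub>r B) $$ (i, j) = (if i < dim_row A then A $$ (i, j) else B $$ (i - dim_row A, j))"
  using assms by (simp add: append_rows_def)

lemma append_rows_dim [simp]:
  "dim_row (A @\<^sub>r B) = dim_row A + dim_row B" "dim_col (A @\<^sub>r B) = dim_col A"
  by (simp_all add: append_rows_def)

lemma append_cols_index:
  assumes "i < dim_row A" "j < dim_col A + dim_col B" "dim_row B = dim_row A"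
  shows "(A @\<^sub>c B) $$ (i, j) = (if j < dim_col A then A $$ (i, j) else B $$ (i, j - dim_col A))"
  using assms by (simp add: append_cols_def)

lemma append_cols_dim [simp]:
  "dim_row (A @\<^sub>c B) = dim_row A" "dim_col (A @\<^sub>c B) = dim_col A + dim_col B"
  by (simp_all add: append_cols_def)

lemma T_mat_dim [simp]: "dim_row (T_mat n1 n2 s) = n_S n1 n2" "dim_col (T_mat n1 n2 s) = n_S n1 n2"
  by (simp_all add: T_mat_def n_S_def)

lemma Q_mat_dim [simp]:
  "dim_row (Q_mat n0 n1 n2 s) = n_S n1 n2" "dim_col (Q_mat n0 n1 n2 s) = n_x n0 n1 n2"
  by (simp_all add: Q_mat_def n_S_def n_x_def)

lemma T_mat_index:
  assumes "i < n_S n1 n2" "j < n_S n1 n2"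
  shows "T_mat n1 n2 s $$ (i, j) =
    (if j = i then 1 else if n1 \<le> i \<and> i < n1 + n2 \<and> j = i + n2 then s else 0)"
proof -
  have j: "j < n1 + (n2 + n2)" using assms by (simp add: n_S_def)
  consider "i < n1" | "n1 \<le> i" "i < n1 + n2" | "n1 + n2 \<le> i" "i < n1 + (n2 + n2)"
    using assms unfolding n_S_def by linarith
  then show ?thesis
  proof cases
    case 1 then show ?thesis using j by (auto simp: T_mat_def append_rows_index append_cols_index)
  next
    case 2
    define i' where "i' = i - n1"
    have i: "i = n1 + i'" "i' < n2" using 2 by (auto simp: i'_def)
    show ?thesis unfolding i(1) using j i(2)
      by (auto simp: T_mat_def append_rows_index append_cols_index)
  next
    case 3
    define i' where "i' = i - n1 - n2"
    have i: "i = n1 + (n2 + i')" "i' < n2" using 3 by (auto simp: i'_def)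
    show ?thesis unfolding i(1) using j i(2)
      by (auto simp: T_mat_def append_rows_index append_cols_index)
  qed
qed

lemma Q_mat_index:
  assumes "i < n_S n1 n2" "j < n_x n0 n1 n2"
  shows "Q_mat n0 n1 n2 s $$ (i, j) =
    (if j = (if i < n1 + n2 then n0 + i else n0 + i - n2)
     then (if n1 \<le> i \<and> i < n1 + n2 then s else 1) else 0)"
proof -
  have j: "j < n0 + (n1 + n2)" using assms by (simp add: n_x_def)
  consider "i < n1" | "n1 \<le> i" "i < n1 + n2" | "n1 + n2 \<le> i" "i < n1 + (n2 + n2)"
    using assms unfolding n_S_def by linarith
  then show ?thesis
  proof cases
    case 1 then show ?thesis using j by (auto simp: Q_mat_def append_rows_index append_cols_index)
  next
    case 2
    define i' where "i' = i - n1"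
    have i: "i = n1 + i'" "i' < n2" using 2 by (auto simp: i'_def)
    show ?thesis unfolding i(1) using j i(2)
      by (auto simp: Q_mat_def append_rows_index append_cols_index)
  next
    case 3
    define i' where "i' = i - n1 - n2"
    have i: "i = n1 + (n2 + i')" "i' < n2" using 3 by (auto simp: i'_def)
    show ?thesis unfolding i(1) using j i(2)
      by (auto simp: Q_mat_def append_rows_index append_cols_index)
  qed
qed

lemma U1_mat_eq: "U1_mat n0 n1 n2 = four_block_mat (1\<^sub>m n0 @\<^sub>r 0\<^sub>m (n1 + n2) n0)
    (0\<^sub>m (n0 + (n1 + n2)) (n1 + n2)) (0\<^sub>m (n1 + n2 + n2) n0)
    (four_block_mat (1\<^sub>m n1 @\<^sub>r 0\<^sub>m n2 n1) (0\<^sub>m (n1 + n2) n2) (0\<^sub>m n2 n1) (1\<^sub>m n2))"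
  unfolding U1_mat_def diag_block_mat.simps(2)[of _ "_ # _"] diag_block_mat_singleton
  by (simp add: Let_def add.assoc)

lemma U2_mat_eq: "U2_mat n0 n1 n2 =
    four_block_mat (0\<^sub>m n0 (n1 + n2) @\<^sub>r 1\<^sub>m (n1 + n2)) (0\<^sub>m (n0 + (n1 + n2)) n2)
      (0\<^sub>m (n1 + n2) (n1 + n2)) (0\<^sub>m n1 n2 @\<^sub>r 1\<^sub>m n2)
    @\<^sub>r 0\<^sub>m n2 (n_S n1 n2)"
  unfolding U2_mat_def diag_block_mat.simps(2)[of _ "_ # _"] diag_block_mat_singleton
  by (simp add: Let_def add.assoc)

lemma U1_mat_dim [simp]:
  "dim_row (U1_mat n0 n1 n2) = n_x n0 n1 n2 + n_S n1 n2" "dim_col (U1_mat n0 n1 n2) = n_x n0 n1 n2"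
  by (simp_all add: U1_mat_eq n_S_def n_x_def)

lemma U2_mat_dim [simp]:
  "dim_row (U2_mat n0 n1 n2) = n_x n0 n1 n2 + n_S n1 n2" "dim_col (U2_mat n0 n1 n2) = n_S n1 n2"
  by (simp_all add: U2_mat_eq n_S_def n_x_def)

text \<open>The rows of \<open>x\<^sub>D\<close>, that is of \<open>U\<^sub>1\<close> and \<open>U\<^sub>2\<close>, in their blocks.\<close>

lemma row_block_cases:
  assumes "i < n_x n0 n1 n2 + n_S n1 n2"
  obtains (x0) "i < n0"
    | (x12) k where "i = n0 + k" "k < n1 + n2"
    | (dx1) k where "i = n0 + (n1 + n2) + k" "k < n1"
    | (dx2) k where "i = n0 + (n1 + n2) + (n1 + k)" "k < n2"
    | (ddx2) k where "i = n0 + (n1 + n2) + (n1 + n2 + k)" "k < n2"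
proof -
  consider "i < n0" | "n0 \<le> i" "i < n0 + (n1 + n2)"
    | "n0 + (n1 + n2) \<le> i" "i < n0 + (n1 + n2) + n1"
    | "n0 + (n1 + n2) + n1 \<le> i" "i < n0 + (n1 + n2) + (n1 + n2)"
    | "n0 + (n1 + n2) + (n1 + n2) \<le> i" "i < n0 + (n1 + n2) + (n1 + n2 + n2)"
    using assms unfolding n_S_def n_x_def by linarith
  then show thesis
    by cases (auto simp: x0 intro: x12[of "i - n0"] dx1[of "i - (n0 + (n1 + n2))"]
        dx2[of "i - (n0 + (n1 + n2) + n1)"] ddx2[of "i - (n0 + (n1 + n2) + (n1 + n2))"])
qed

lemma U1_mat_index:
  assumes "i < n_x n0 n1 n2 + n_S n1 n2" "j < n_x n0 n1 n2"
  shows "U1_mat n0 n1 n2 $$ (i, j) =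
    (if i < n0 \<and> j = i \<or>
        n_x n0 n1 n2 \<le> i \<and> i < n_x n0 n1 n2 + n1 \<and> j = i - n1 - n2 \<or>
        n_x n0 n1 n2 + n1 + n2 \<le> i \<and> j = i - n1 - 2 * n2 then 1 else 0)"
proof -
  have j: "j < n0 + (n1 + n2)" using assms by (simp add: n_x_def)
  from assms(1) show ?thesis
    by (cases rule: row_block_cases) 
      (use j in \<open>auto simp: U1_mat_eq n_x_def append_rows_index\<close>)
qed

lemma U2_mat_index:
  assumes "i < n_x n0 n1 n2 + n_S n1 n2" "j < n_S n1 n2"
  shows "U2_mat n0 n1 n2 $$ (i, j) =
    (if n0 \<le> i \<and> i < n_x n0 n1 n2 \<and> j = i - n0 \<or>
        n_x n0 n1 n2 + n1 \<le> i \<and> i < n_x n0 n1 n2 + n1 + n2 \<and> j = i - n0 - n1 then 1 else 0)"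
proof -
  have j: "j < n1 + (n2 + n2)" using assms by (simp add: n_S_def)
  from assms(1) show ?thesis
    by (cases rule: row_block_cases) 
      (use j in \<open>auto simp: U2_mat_eq n_x_def n_S_def append_rows_index\<close>)
qed

lemma mult_mat_vec_index_sum:
  assumes "i < dim_row A" "dim_vec v = dim_col A"
  shows "(A *\<^sub>v v) $ i = (\<Sum>j<dim_col A. A $$ (i, j) * v $ j)"
  using assms by (auto simp: scalar_prod_def lessThan_atLeast0 intro!: sum.cong)

lemma T_mat_mult_vec:
  assumes "c \<in> carrier_vec (n_S n1 n2)" "i < n_S n1 n2"
  shows "(T_mat n1 n2 s *\<^sub>v c) $ i =
    c $ i + (if n1 \<le> i \<and> i < n1 + n2 then s * c $ (i + n2) else 0)"
proof -
  have "(T_mat n1 n2 s *\<^sub>v c) $ i = (\<Sum>j<n_S n1 n2. (if j = i then c $ j else 0) +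
      (if j = i + n2 then (if n1 \<le> i \<and> i < n1 + n2 then s * c $ j else 0) else 0))"
    using assms by (subst mult_mat_vec_index_sum) (auto simp: T_mat_index intro!: sum.cong)
  also have "\<dots> = c $ i + (if n1 \<le> i \<and> i < n1 + n2 then s * c $ (i + n2) else 0)"
    using assms(2) by (auto simp: sum.distrib n_S_def)
  finally show ?thesis .
qed

lemma Q_mat_mult_vec:
  assumes "v \<in> carrier_vec (n_x n0 n1 n2)" "i < n_S n1 n2"
  shows "(Q_mat n0 n1 n2 s *\<^sub>v v) $ i =
    (if i < n1 then v $ (n0 + i) else if i < n1 + n2 then s * v $ (n0 + i) else v $ (n0 + i - n2))"
proof -
  have "(Q_mat n0 n1 n2 s *\<^sub>v v) $ i = (\<Sum>j<n_x n0 n1 n2.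
      (if j = (if i < n1 + n2 then n0 + i else n0 + i - n2)
       then (if n1 \<le> i \<and> i < n1 + n2 then s else 1) * v $ j else 0))"
    using assms
    by (subst mult_mat_vec_index_sum, simp, simp, simp only: Q_mat_dim)
      (intro sum.cong refl, simp add: Q_mat_index)
  then show ?thesis using assms(2) by (auto simp: n_S_def n_x_def)
qed

text \<open>
  \<open>U\<^sub>1 v + U\<^sub>2 c\<close> merges the highest derivatives \<open>v\<close> with the core values \<open>c\<close> in
  the order of \<open>x\<^sub>D\<close>.
\<close>

lemma U_mat_mult_vec:
  assumes "v \<in> carrier_vec (n_x n0 n1 n2)" "c \<in> carrier_vec (n_S n1 n2)"
    "i < n_x n0 n1 n2 + n_S n1 n2"
  shows "(U1_mat n0 n1 n2 *\<^sub>v v + U2_mat n0 n1 n2 *\<^sub>v c) $ i =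
    (if i < n0 then v $ i
     else if i < n_x n0 n1 n2 then c $ (i - n0)
     else if i < n_x n0 n1 n2 + n1 then v $ (i - n1 - n2)
     else if i < n_x n0 n1 n2 + n1 + n2 then c $ (i - n0 - n1)
     else v $ (i - n1 - 2 * n2))"
proof -
  have 1: "(U1_mat n0 n1 n2 *\<^sub>v v) $ i = (\<Sum>j<n_x n0 n1 n2.
      (if j = (if i < n0 then i else if i < n_x n0 n1 n2 + n1 then i - n1 - n2 else i - n1 - 2 * n2)
       then (if i < n0 \<or> n_x n0 n1 n2 \<le> i \<and> i < n_x n0 n1 n2 + n1 \<or> n_x n0 n1 n2 + n1 + n2 \<le> i
         then v $ j else 0) else 0))"
    using assms
    by (subst mult_mat_vec_index_sum, simp, simp, simp only: U1_mat_dim)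
      (intro sum.cong refl, auto simp: U1_mat_index n_x_def)
  have 2: "(U2_mat n0 n1 n2 *\<^sub>v c) $ i = (\<Sum>j<n_S n1 n2.
      (if j = (if i < n_x n0 n1 n2 then i - n0 else i - n0 - n1)
       then (if n0 \<le> i \<and> i < n_x n0 n1 n2 \<or> n_x n0 n1 n2 + n1 \<le> i \<and> i < n_x n0 n1 n2 + n1 + n2
         then c $ j else 0) else 0))"
    using assms
    by (subst mult_mat_vec_index_sum, simp, simp, simp only: U2_mat_dim)
      (intro sum.cong refl, auto simp: U2_mat_index n_x_def)
  have 3: "(U1_mat n0 n1 n2 *\<^sub>v v + U2_mat n0 n1 n2 *\<^sub>v c) $ i =
      (U1_mat n0 n1 n2 *\<^sub>v v) $ i + (U2_mat n0 n1 n2 *\<^sub>v c) $ i"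
    using assms(3) by (simp add: scalar_prod_def)
  from assms(3) show ?thesis
    unfolding 3 1 2 sum.delta[OF finite_lessThan]
    by (cases rule: row_block_cases) (simp_all add: n_S_def n_x_def)
qed

lemma T_mat_carrier [simp]: "T_mat n1 n2 s \<in> carrier_mat (n_S n1 n2) (n_S n1 n2)"
  and Q_mat_carrier [simp]: "Q_mat n0 n1 n2 s \<in> carrier_mat (n_S n1 n2) (n_x n0 n1 n2)"
  and U1_mat_carrier [simp]: "U1_mat n0 n1 n2 \<in> carrier_mat (n_x n0 n1 n2 + n_S n1 n2) (n_x n0 n1 n2)"
  and U2_mat_carrier [simp]: "U2_mat n0 n1 n2 \<in> carrier_mat (n_x n0 n1 n2 + n_S n1 n2) (n_S n1 n2)"
  by auto

lemma continuous_on_if_const: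
  "continuous_on S f \<Longrightarrow> continuous_on S g \<Longrightarrow> continuous_on S (\<lambda>s. if P then f s else g s)"
  by (cases P) simp_all

lemma continuous_T_mat:
  assumes "i < n_S n1 n2" "j < n_S n1 n2"
  shows "continuous_on UNIV (\<lambda>s. T_mat n1 n2 s $$ (i, j))"
  unfolding T_mat_index[OF assms]
  by (intro continuous_on_if_const continuous_on_id continuous_on_const)

lemma continuous_Q_mat:
  assumes "i < n_S n1 n2" "j < n_x n0 n1 n2"
  shows "continuous_on UNIV (\<lambda>s. Q_mat n0 n1 n2 s $$ (i, j))"
  unfolding Q_mat_index[OF assms]
  by (intro continuous_on_if_const continuous_on_id continuous_on_const)

lemma n_S_cases:
  assumes "i < n_S n1 n2"
  obtains (x1) "i < n1" | (x2) k where "i = n1 + k" "k < n2" | (dx2) k where "i = n1 + n2 + k" "k < n2"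
proof -
  consider "i < n1" | "n1 \<le> i" "i < n1 + n2" | "n1 + n2 \<le> i" "i < n1 + n2 + n2"
    using assms unfolding n_S_def by linarith
  then show thesis
    by cases (auto simp: x1 intro: x2[of "i - n1"] dx2[of "i - (n1 + n2)"])
qed

lemma n_x_cases:
  assumes "i < n_x n0 n1 n2"
  obtains (x0) "i < n0" | (x1) k where "i = n0 + k" "k < n1" | (x2) k where "i = n0 + n1 + k" "k < n2"
proof -
  consider "i < n0" | "n0 \<le> i" "i < n0 + n1" | "n0 + n1 \<le> i" "i < n0 + n1 + n2"
    using assms unfolding n_x_def by linarith
  then show thesis
    by cases (auto simp: x0 intro: x1[of "i - n0"] x2[of "i - (n0 + n1)"])
qed

lemma first_rows_mult_index:
  assumes "i < k" "k \<le> dim_row A" "dim_vec v = dim_col A"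
  shows "(first_rows k A *\<^sub>v v) $ i = (A *\<^sub>v v) $ i"
  using assms by (subst (1 2) mult_mat_vec_index_sum) (auto simp: first_rows_def)

lemma first_rows_carrier [simp]: "A \<in> carrier_mat m p \<Longrightarrow> first_rows k A \<in> carrier_mat k p"
  by (auto simp: first_rows_def)

lemma first_rows_dim [simp]: "dim_row (first_rows k A) = k" "dim_col (first_rows k A) = dim_col A"
  by (simp_all add: first_rows_def)

lemma zero_mat_mult_vec: "v \<in> carrier_vec m \<Longrightarrow> 0\<^sub>m k m *\<^sub>v v = (0\<^sub>v k :: real vec)"
  by (intro eq_vecI) (auto simp: scalar_prod_def)

lemma minus_vec_eq_add_smult: "dim_vec x = dim_vec y \<Longrightarrow> x - y = x + - 1 \<cdot>\<^sub>v (y :: real vec)"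
  by (intro eq_vecI) auto

section \<open>Integrals of vector- and matrix-valued functions\<close>

text \<open>
  Componentwise integrability over \<open>S\<close> of functions that take values of the given dimension
  on \<open>S\<close>.
\<close>

definition vec_integrable :: "nat \<Rightarrow> real set \<Rightarrow> (real \<Rightarrow> real vec) \<Rightarrow> bool" where
  "vec_integrable m S u \<longleftrightarrow>
     (\<forall>s\<in>S. u s \<in> carrier_vec m) \<and> (\<forall>i<m. integrable (lebesgue_on S) (\<lambda>s. u s $ i))"

text \<open>Entrywise integrability, likewise.\<close>

definition mat_integrable :: "nat \<Rightarrow> nat \<Rightarrow> real set \<Rightarrow> (real \<Rightarrow> real mat) \<Rightarrow> bool" where
  "mat_integrable nr nc S A \<longleftrightarrow> (\<forall>s\<in>S. A s \<in> carrier_mat nr nc) \<and>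
     (\<forall>i<nr. \<forall>j<nc. integrable (lebesgue_on S) (\<lambda>s. A s $$ (i, j)))"

lemma integral_vec_carrier [simp]: "integral_vec m S u \<in> carrier_vec m"
  and integral_mat_carrier [simp]: "integral_mat nr nc S A \<in> carrier_mat nr nc"
  by (simp_all add: integral_vec_def integral_mat_def)

lemma integral_vec_dim [simp]: "dim_vec (integral_vec m S u) = m"
  by (simp add: integral_vec_def)

lemma integral_vec_index [simp]: "i < m \<Longrightarrow> integral_vec m S u $ i = (LINT s|lebesgue_on S. u s $ i)"
  by (simp add: integral_vec_def)

lemma integral_vec_cong:
  "(\<And>s. s \<in> S \<Longrightarrow> u s = v s) \<Longrightarrow> integral_vec m S u = integral_vec m S v"
  unfolding integral_vec_def
  by (intro eq_vecI) (auto intro!: Bochner_Integration.integral_cong)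

lemma integral_vec_cong_AE:
  assumes "AE s in lebesgue_on S. u s = v s" "S \<in> sets lebesgue"
  shows "integral_vec m S u = integral_vec m S v"
proof (rule eq_vecI)
  fix i assume "i < dim_vec (integral_vec m S v)"
  moreover have "AE s in lebesgue_on S. u s $ i = v s $ i"
    using assms(1) by (auto elim: eventually_mono)
  ultimately show "integral_vec m S u $ i = integral_vec m S v $ i"
    using lebesgue_on_cong_AE(2)[OF assms(2)] by simp
qed simp

lemma AE_vec_eqI:
  assumes "\<And>s. s \<in> S \<Longrightarrow> dim_vec (u s) = m" "\<And>s. s \<in> S \<Longrightarrow> dim_vec (v s) = m"
    and "\<And>i. i < m \<Longrightarrow> AE s in lebesgue_on S. u s $ i = v s $ i"
  shows "AE s in lebesgue_on S. u s = v s"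
proof -
  have "AE s in lebesgue_on S. \<forall>i\<in>{..<m}. u s $ i = v s $ i"
    using assms(3) by (intro AE_finite_allI) auto
  then show ?thesis using AE_space[of "lebesgue_on S"]
    by eventually_elim (auto intro!: eq_vecI simp: assms(1,2))
qed

lemma vec_integrable_cong:
  assumes "\<And>s. s \<in> S \<Longrightarrow> u s = v s"
  shows "vec_integrable m S u \<longleftrightarrow> vec_integrable m S v"
proof -
  have "integrable (lebesgue_on S) (\<lambda>s. u s $ i) \<longleftrightarrow> integrable (lebesgue_on S) (\<lambda>s. v s $ i)" for i
    by (intro Bochner_Integration.integrable_cong refl) (simp add: assms)
  then show ?thesis by (simp add: vec_integrable_def assms)
qed

lemma integral_vec_add:
  assumes "vec_integrable m S u" "vec_integrable m S v"
  shows "integral_vec m S (\<lambda>s. u s + v s) = integral_vec m S u + integral_vec m S v"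
proof (rule eq_vecI)
  fix i assume "i < dim_vec (integral_vec m S u + integral_vec m S v)"
  then have i: "i < m" by simp
  have "(LINT s|lebesgue_on S. (u s + v s) $ i) = (LINT s|lebesgue_on S. u s $ i + v s $ i)"
    using i assms by (intro Bochner_Integration.integral_cong refl) (auto simp: vec_integrable_def)
  also have "\<dots> = (LINT s|lebesgue_on S. u s $ i) + (LINT s|lebesgue_on S. v s $ i)"
    using i assms by (intro Bochner_Integration.integral_add) (auto simp: vec_integrable_def)
  finally show "integral_vec m S (\<lambda>s. u s + v s) $ i = (integral_vec m S u + integral_vec m S v) $ i"
    using i by simp
qed simp

lemma vec_integrable_add:
  assumes "vec_integrable m S u" "vec_integrable m S v"
  shows "vec_integrable m S (\<lambda>s. u s + v s)"
  unfolding vec_integrable_def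
proof (intro conjI allI impI)
  fix i assume i: "i < m"
  have "integrable (lebesgue_on S) (\<lambda>s. u s $ i + v s $ i)" 
    using assms i by (auto simp: vec_integrable_def)
  then show "integrable (lebesgue_on S) (\<lambda>s. (u s + v s) $ i)"
    by (rule Bochner_Integration.integrable_cong[THEN iffD1, rotated 2])
      (use assms i in \<open>auto simp: vec_integrable_def\<close>)
qed (use assms in \<open>auto simp: vec_integrable_def\<close>)

lemma
  assumes A: "A \<in> carrier_mat k m" and u: "vec_integrable m S u"
  shows vec_integrable_mult_const: "vec_integrable k S (\<lambda>s. A *\<^sub>v u s)"
    and integral_vec_mult_const:
      "integral_vec k S (\<lambda>s. A *\<^sub>v u s) = A *\<^sub>v integral_vec m S u"
proof -
  have eq: "(A *\<^sub>v u s) $ i = (\<Sum>j<m. A $$ (i, j) * u s $ j)" if "i < k" "s \<in> S" for i s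
    using that assms by (subst mult_mat_vec_index_sum) (auto simp: vec_integrable_def)
  have int: "integrable (lebesgue_on S) (\<lambda>s. A $$ (i, j) * u s $ j)" if "i < k" "j < m" for i j
    using that u by (auto simp: vec_integrable_def)
  show "vec_integrable k S (\<lambda>s. A *\<^sub>v u s)"
    unfolding vec_integrable_def
  proof (intro conjI allI impI ballI)
    fix i assume i: "i < k"
    have "integrable (lebesgue_on S) (\<lambda>s. \<Sum>j<m. A $$ (i, j) * u s $ j)"
      using int[OF i] by (intro Bochner_Integration.integrable_sum) auto
    then show "integrable (lebesgue_on S) (\<lambda>s. (A *\<^sub>v u s) $ i)"
      by (rule Bochner_Integration.integrable_cong[THEN iffD1, rotated 2]) (simp_all add: eq i)
  qed (use A u in \<open>auto simp: vec_integrable_def intro: mult_mat_vec_carrier\<close>)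
  show "integral_vec k S (\<lambda>s. A *\<^sub>v u s) = A *\<^sub>v integral_vec m S u"
  proof (rule eq_vecI)
    fix i assume "i < dim_vec (A *\<^sub>v integral_vec m S u)"
    then have i: "i < k" using A by simp
    have "(LINT s|lebesgue_on S. (A *\<^sub>v u s) $ i) = (LINT s|lebesgue_on S. (\<Sum>j<m. A $$ (i, j) * u s $ j))"
      using i by (intro Bochner_Integration.integral_cong refl) (simp add: eq)
    also have "\<dots> = (\<Sum>j<m. A $$ (i, j) * (LINT s|lebesgue_on S. u s $ j))"
      using int[OF i] by (subst Bochner_Integration.integral_sum) auto
    also have "\<dots> = (A *\<^sub>v integral_vec m S u) $ i"
      using A i by (subst mult_mat_vec_index_sum) auto
    finally show "integral_vec k S (\<lambda>s. A *\<^sub>v u s) $ i = (A *\<^sub>v integral_vec m S u) $ i"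
      using i by simp
  qed (use A in simp)
qed

lemma
  assumes A: "mat_integrable k m S A" and c: "c \<in> carrier_vec m"
  shows vec_integrable_mat_mult_const: "vec_integrable k S (\<lambda>s. A s *\<^sub>v c)"
    and integral_mat_mult_const:
      "integral_vec k S (\<lambda>s. A s *\<^sub>v c) = integral_mat k m S A *\<^sub>v c"
proof -
  have eq: "(A s *\<^sub>v c) $ i = (\<Sum>j<m. A s $$ (i, j) * c $ j)" if "i < k" "s \<in> S" for i s
    using that assms by (subst mult_mat_vec_index_sum) (auto simp: mat_integrable_def)
  have int: "integrable (lebesgue_on S) (\<lambda>s. A s $$ (i, j) * c $ j)" if "i < k" "j < m" for i j
    using that A by (auto simp: mat_integrable_def)
  show "vec_integrable k S (\<lambda>s. A s *\<^sub>v c)"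
    unfolding vec_integrable_def
  proof (intro conjI allI impI ballI)
    fix i assume i: "i < k"
    have "integrable (lebesgue_on S) (\<lambda>s. \<Sum>j<m. A s $$ (i, j) * c $ j)"
      using int[OF i] by (intro Bochner_Integration.integrable_sum) auto
    then show "integrable (lebesgue_on S) (\<lambda>s. (A s *\<^sub>v c) $ i)"
      by (rule Bochner_Integration.integrable_cong[THEN iffD1, rotated 2]) (simp_all add: eq i)
  qed (use A c in \<open>auto simp: mat_integrable_def intro: mult_mat_vec_carrier\<close>)
  show "integral_vec k S (\<lambda>s. A s *\<^sub>v c) = integral_mat k m S A *\<^sub>v c"
  proof (rule eq_vecI)
    fix i assume "i < dim_vec (integral_mat k m S A *\<^sub>v c)"
    then have i: "i < k" by (simp add: integral_mat_def)
    have "(LINT s|lebesgue_on S. (A s *\<^sub>v c) $ i) = (LINT s|lebesgue_on S. (\<Sum>j<m. A s $$ (i, j) * c $ j))"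
      using i by (intro Bochner_Integration.integral_cong refl) (simp add: eq)
    also have "\<dots> = (\<Sum>j<m. (LINT s|lebesgue_on S. A s $$ (i, j)) * c $ j)"
      using int[OF i] by (subst Bochner_Integration.integral_sum) auto
    also have "\<dots> = (integral_mat k m S A *\<^sub>v c) $ i"
      using c i by (subst mult_mat_vec_index_sum) (auto simp: integral_mat_def)
    finally show "integral_vec k S (\<lambda>s. A s *\<^sub>v c) $ i = (integral_mat k m S A *\<^sub>v c) $ i"
      using i by simp
  qed (simp add: integral_mat_def)
qed

lemma L2_mat_carrier: "A \<in> L2_mat a b k m \<Longrightarrow> s \<in> {a..b} \<Longrightarrow> A s \<in> carrier_mat k m"
  and L2_vec_carrier: "v \<in> L2_vec a b m \<Longrightarrow> s \<in> {a..b} \<Longrightarrow> v s \<in> carrier_vec m"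
  and L2_vec_entry: "v \<in> L2_vec a b m \<Longrightarrow> i < m \<Longrightarrow> (\<lambda>s. v s $ i) \<in> L2 a b"
  by (simp_all add: L2_mat_def L2_vec_def)

lemma mult_mat_vec_index:
  assumes "A \<in> carrier_mat k m" "v \<in> carrier_vec m" "i < k"
  shows "(A *\<^sub>v v) $ i = (\<Sum>j<m. A $$ (i, j) * v $ j)"
  using assms by (subst mult_mat_vec_index_sum) auto

lemma mult_mat_mat_index:
  assumes "A \<in> carrier_mat k m" "B \<in> carrier_mat m p" "i < k" "j < p"
  shows "(A * B) $$ (i, j) = (\<Sum>l<m. A $$ (i, l) * B $$ (l, j))"
  using assms by (auto simp: scalar_prod_def lessThan_atLeast0 intro!: sum.cong)

lemma vec_integrable_L2_mult:
  assumes A: "A \<in> L2_mat a b k m" and v: "v \<in> L2_vec a b m"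
  shows "vec_integrable k {a..b} (\<lambda>s. A s *\<^sub>v v s)"
  unfolding vec_integrable_def
proof (intro conjI allI impI ballI)
  fix i assume i: "i < k"
  have "integrable (lebesgue_on {a..b}) (\<lambda>s. \<Sum>j<m. A s $$ (i, j) * v s $ j)"
    using i A v by (intro Bochner_Integration.integrable_sum L2_mult_integrable)
      (auto simp: L2_mat_def L2_vec_def)
  moreover have "(A s *\<^sub>v v s) $ i = (\<Sum>j<m. A s $$ (i, j) * v s $ j)" if "s \<in> {a..b}" for s
    by (rule mult_mat_vec_index[OF L2_mat_carrier[OF A that] L2_vec_carrier[OF v that] i])
  ultimately show "integrable (lebesgue_on {a..b}) (\<lambda>s. (A s *\<^sub>v v s) $ i)"
    by (subst Bochner_Integration.integrable_cong[OF refl]) auto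
next
  fix s assume s: "s \<in> {a..b}"
  show "A s *\<^sub>v v s \<in> carrier_vec k"
    by (rule mult_mat_vec_carrier[OF L2_mat_carrier[OF A s] L2_vec_carrier[OF v s]])
qed

lemma L2_mat_mult_const:
  assumes A: "A \<in> L2_mat a b k m" and U: "U \<in> carrier_mat m p"
  shows "(\<lambda>s. A s * U) \<in> L2_mat a b k p"
  unfolding L2_mat_def
proof (intro CollectI conjI allI impI ballI)
  fix i j assume i: "i < k" and j: "j < p"
  have "(\<lambda>s. \<Sum>l<m. U $$ (l, j) * A s $$ (i, l)) \<in> L2 a b"
    using i A by (intro L2_sum L2_cmult) (auto simp: L2_mat_def)
  moreover have "(A s * U) $$ (i, j) = (\<Sum>l<m. U $$ (l, j) * A s $$ (i, l))" if "s \<in> {a..b}" for s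
    by (subst mult_mat_mat_index[OF L2_mat_carrier[OF A that] U i j]) (simp add: mult.commute)
  ultimately show "(\<lambda>s. (A s * U) $$ (i, j)) \<in> L2 a b"
    by (subst L2_cong) auto
next
  fix s assume s: "s \<in> {a..b}"
  show "A s * U \<in> carrier_mat k p"
    by (rule mult_carrier_mat[OF L2_mat_carrier[OF A s] U])
qed

text \<open>A matrix function with square-integrable entries times one with continuous entries.\<close>

lemma mat_integrable_mult_continuous:
  assumes A: "A \<in> L2_mat a b k m" and K: "\<And>s. K s \<in> carrier_mat m p"
    and cont: "\<And>i j. i < m \<Longrightarrow> j < p \<Longrightarrow> continuous_on UNIV (\<lambda>s. K s $$ (i, j))"
    and cd: "{c..d} \<subseteq> {a..b}"
  shows "mat_integrable k p {c..d} (\<lambda>s. A s * K (s - r))"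
  unfolding mat_integrable_def
proof (intro conjI allI impI ballI)
  fix i j assume i: "i < k" and j: "j < p"
  have "integrable (lebesgue_on {c..d}) (\<lambda>s. A s $$ (i, l) * K (s - r) $$ (l, j))" if l: "l < m" for l
  proof (rule integrable_mult_continuous)
    show "integrable (lebesgue_on {c..d}) (\<lambda>s. A s $$ (i, l))"
      using i l A by (intro integrable_subinterval[OF L2_integrable cd]) (auto simp: L2_mat_def)
    show "continuous_on {c..d} (\<lambda>s. K (s - r) $$ (l, j))"
      by (rule continuous_on_compose2[OF cont[OF l j]]) (auto intro!: continuous_intros)
  qed
  then have "integrable (lebesgue_on {c..d}) (\<lambda>s. \<Sum>l<m. A s $$ (i, l) * K (s - r) $$ (l, j))"
    by (intro Bochner_Integration.integrable_sum) auto
  moreover have "(A s * K (s - r)) $$ (i, j) = (\<Sum>l<m. A s $$ (i, l) * K (s - r) $$ (l, j))"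
    if "s \<in> {c..d}" for s
    using that cd by (intro mult_mat_mat_index[OF L2_mat_carrier[OF A] K i j]) auto
  ultimately show "integrable (lebesgue_on {c..d}) (\<lambda>s. (A s * K (s - r)) $$ (i, j))"
    by (subst Bochner_Integration.integrable_cong[OF refl]) auto
next
  fix s assume "s \<in> {c..d}"
  then have s: "s \<in> {a..b}" using cd by blast
  show "A s * K (s - r) \<in> carrier_mat k p"
    by (rule mult_carrier_mat[OF L2_mat_carrier[OF A s] K])
qed

text \<open>Interchanging the order of integration for matrix-valued convolution kernels.\<close>

lemma
  assumes A: "A \<in> L2_mat a b k m" and v: "v \<in> L2_vec a b p" and K: "\<And>s. K s \<in> carrier_mat m p"
    and cont: "\<And>i j. i < m \<Longrightarrow> j < p \<Longrightarrow> continuous_on UNIV (\<lambda>s. K s $$ (i, j))"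
  shows vec_integrable_convolution_left: "vec_integrable k {a..b}
        (\<lambda>s. A s *\<^sub>v integral_vec m {a..s} (\<lambda>\<theta>. K (s - \<theta>) *\<^sub>v v \<theta>))"
    and vec_integrable_convolution_right: "vec_integrable k {a..b}
        (\<lambda>\<theta>. integral_mat k p {\<theta>..b} (\<lambda>s. A s * K (s - \<theta>)) *\<^sub>v v \<theta>)"
    and integral_vec_convolution_swap:
      "integral_vec k {a..b} (\<lambda>s. A s *\<^sub>v integral_vec m {a..s} (\<lambda>\<theta>. K (s - \<theta>) *\<^sub>v v \<theta>)) =
       integral_vec k {a..b} (\<lambda>\<theta>. integral_mat k p {\<theta>..b} (\<lambda>s. A s * K (s - \<theta>)) *\<^sub>v v \<theta>)"
proof -
  let ?M = "lebesgue_on {a..b}"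
  let ?L = "\<lambda>s. A s *\<^sub>v integral_vec m {a..s} (\<lambda>\<theta>. K (s - \<theta>) *\<^sub>v v \<theta>)"
  let ?R = "\<lambda>\<theta>. integral_mat k p {\<theta>..b} (\<lambda>s. A s * K (s - \<theta>)) *\<^sub>v v \<theta>"
  define l where "l i j q s = A s $$ (i, j) * (LINT \<theta>|lebesgue_on {a..s}. K (s - \<theta>) $$ (j, q) * v \<theta> $ q)" for i j q s
  define r where "r i j q \<theta> = (LINT s|lebesgue_on {\<theta>..b}. A s $$ (i, j) * K (s - \<theta>) $$ (j, q)) * v \<theta> $ q" for i j q \<theta>
  have Ai: "integrable ?M (\<lambda>s. A s $$ (i, j))" if "i < k" "j < m" for i j
    using that A by (intro L2_integrable) (auto simp: L2_mat_def)
  have vi: "integrable ?M (\<lambda>s. v s $ q)" if "q < p" for q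
    using that v by (intro L2_integrable) (auto simp: L2_vec_def)
  have li: "integrable ?M (l i j q)" and ri: "integrable ?M (r i j q)" 
    and lr: "integral\<^sup>L ?M (l i j q) = integral\<^sup>L ?M (r i j q)" if "i < k" "j < m" "q < p" for i j q
    unfolding l_def r_def using that
    by (intro integrable_triangle_inner_left integrable_triangle_inner_right integral_triangle_swap Ai vi cont; simp)+
  have L: "?L s $ i = (\<Sum>j<m. \<Sum>q<p. l i j q s)" if i: "i < k" and s: "s \<in> {a..b}" for i s
  proof -
    have "(K (s - \<theta>) *\<^sub>v v \<theta>) $ j = (\<Sum>q<p. K (s - \<theta>) $$ (j, q) * v \<theta> $ q)"
      if "j < m" "\<theta> \<in> {a..s}" for j \<theta>
      using that s by (intro mult_mat_vec_index[OF K L2_vec_carrier[OF v]]) auto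
    then have "(LINT \<theta>|lebesgue_on {a..s}. (K (s - \<theta>) *\<^sub>v v \<theta>) $ j) =
        (LINT \<theta>|lebesgue_on {a..s}. (\<Sum>q<p. K (s - \<theta>) $$ (j, q) * v \<theta> $ q))" if "j < m" for j
      using that by (intro Bochner_Integration.integral_cong refl) auto
    also have "\<dots> j = (\<Sum>q<p. LINT \<theta>|lebesgue_on {a..s}. K (s - \<theta>) $$ (j, q) * v \<theta> $ q)" if "j < m" for j
    proof (intro Bochner_Integration.integral_sum)
      fix q assume "q \<in> {..<p}"
      then have q: "q < p" by simp
      have "integrable (lebesgue_on {a..s}) (\<lambda>\<theta>. v \<theta> $ q * K (s - \<theta>) $$ (j, q))"
      proof (rule integrable_mult_continuous)
        show "integrable (lebesgue_on {a..s}) (\<lambda>\<theta>. v \<theta> $ q)"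
          using s by (intro integrable_subinterval[OF vi[OF q]]) auto
        show "continuous_on {a..s} (\<lambda>\<theta>. K (s - \<theta>) $$ (j, q))"
          by (rule continuous_on_compose2[OF cont[OF that q]]) (auto intro!: continuous_intros)
      qed
      then show "integrable (lebesgue_on {a..s}) (\<lambda>\<theta>. K (s - \<theta>) $$ (j, q) * v \<theta> $ q)"
        by (simp add: mult.commute)
    qed
    finally show ?thesis
      by (subst mult_mat_vec_index[OF L2_mat_carrier[OF A s] _ i])
        (auto simp: l_def sum_distrib_left)
  qed
  have R: "?R \<theta> $ i = (\<Sum>j<m. \<Sum>q<p. r i j q \<theta>)" if i: "i < k" and \<theta>: "\<theta> \<in> {a..b}" for i \<theta>
  proof -
    have "(LINT s|lebesgue_on {\<theta>..b}. (A s * K (s - \<theta>)) $$ (i, q)) =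
        (LINT s|lebesgue_on {\<theta>..b}. (\<Sum>j<m. A s $$ (i, j) * K (s - \<theta>) $$ (j, q)))" if q: "q < p" for q
    proof (intro Bochner_Integration.integral_cong refl)
      fix s assume "s \<in> space (lebesgue_on {\<theta>..b})"
      then show "(A s * K (s - \<theta>)) $$ (i, q) = (\<Sum>j<m. A s $$ (i, j) * K (s - \<theta>) $$ (j, q))"
        using \<theta> by (intro mult_mat_mat_index[OF L2_mat_carrier[OF A] K i q]) auto
    qed
    also have "\<dots> q = (\<Sum>j<m. LINT s|lebesgue_on {\<theta>..b}. A s $$ (i, j) * K (s - \<theta>) $$ (j, q))" if q: "q < p" for q
    proof (intro Bochner_Integration.integral_sum integrable_mult_continuous)
      fix j assume "j \<in> {..<m}"
      then have j: "j < m" by simp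
      show "integrable (lebesgue_on {\<theta>..b}) (\<lambda>s. A s $$ (i, j))"
        using \<theta> by (intro integrable_subinterval[OF Ai[OF i j]]) auto
      show "continuous_on {\<theta>..b} (\<lambda>s. K (s - \<theta>) $$ (j, q))"
        by (rule continuous_on_compose2[OF cont[OF j q]]) (auto intro!: continuous_intros)
    qed
    finally have *: "(LINT s|lebesgue_on {\<theta>..b}. (A s * K (s - \<theta>)) $$ (i, q)) = 
       (\<Sum>j<m. LINT s|lebesgue_on {\<theta>..b}. A s $$ (i, j) * K (s - \<theta>) $$ (j, q))" if q: "q < p" for q
      by (simp only: that)
    have "?R \<theta> $ i = (\<Sum>q<p. \<Sum>j<m. r i j q \<theta>)"
      using i by (subst mult_mat_vec_index[OF integral_mat_carrier L2_vec_carrier[OF v \<theta>] i])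
        (auto simp: integral_mat_def * r_def sum_distrib_right)
    then show ?thesis by (subst sum.swap)
  qed
  have "integrable ?M (\<lambda>s. \<Sum>j<m. \<Sum>q<p. l i j q s)" if "i < k" for i
    using that by (intro Bochner_Integration.integrable_sum li) auto
  then have "integrable ?M (\<lambda>s. ?L s $ i)" if "i < k" for i
    using that by (subst Bochner_Integration.integrable_cong[OF refl L]) auto
  then show "vec_integrable k {a..b} ?L"
    using mult_mat_vec_carrier[OF L2_mat_carrier[OF A] integral_vec_carrier]
    by (auto simp: vec_integrable_def)
  have "integrable ?M (\<lambda>s. \<Sum>j<m. \<Sum>q<p. r i j q s)" if "i < k" for i
    using that by (intro Bochner_Integration.integrable_sum ri) auto
  then have "integrable ?M (\<lambda>s. ?R s $ i)" if "i < k" for i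
    using that by (subst Bochner_Integration.integrable_cong[OF refl R]) auto
  then show "vec_integrable k {a..b} ?R"
    using mult_mat_vec_carrier[OF integral_mat_carrier L2_vec_carrier[OF v]]
    by (auto simp: vec_integrable_def)
  show "integral_vec k {a..b} ?L = integral_vec k {a..b} ?R"
  proof (rule eq_vecI)
    fix i assume "i < dim_vec (integral_vec k {a..b} ?R)"
    then have i: "i < k" by simp
    have sum2: "(LINT s|?M. (\<Sum>j<m. \<Sum>q<p. h j q s)) = (\<Sum>j<m. \<Sum>q<p. integral\<^sup>L ?M (h j q))"
      if "\<And>j q. j < m \<Longrightarrow> q < p \<Longrightarrow> integrable ?M (h j q)" for h :: "nat \<Rightarrow> nat \<Rightarrow> real \<Rightarrow> real"
    proof -
      have "(LINT s|?M. (\<Sum>j<m. \<Sum>q<p. h j q s)) = (\<Sum>j<m. LINT s|?M. (\<Sum>q<p. h j q s))"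
        using that by (intro Bochner_Integration.integral_sum Bochner_Integration.integrable_sum) auto
      also have "\<dots> = (\<Sum>j<m. \<Sum>q<p. integral\<^sup>L ?M (h j q))"
        using that by (intro sum.cong refl Bochner_Integration.integral_sum) auto
      finally show ?thesis .
    qed
    have "(LINT s|?M. ?L s $ i) = (LINT s|?M. (\<Sum>j<m. \<Sum>q<p. l i j q s))"
      using i by (intro Bochner_Integration.integral_cong refl L) auto
    also have "\<dots> = (\<Sum>j<m. \<Sum>q<p. integral\<^sup>L ?M (l i j q))"
      using sum2[of "l i"] li[OF i] by simp
    also have "\<dots> = (\<Sum>j<m. \<Sum>q<p. integral\<^sup>L ?M (r i j q))"
      using i lr by simp
    also have "\<dots> = (LINT s|?M. (\<Sum>j<m. \<Sum>q<p. r i j q s))"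
      using sum2[of "r i"] ri[OF i] by simp
    also have "\<dots> = (LINT s|?M. ?R s $ i)"
      using i by (intro Bochner_Integration.integral_cong refl R[symmetric]) auto
    finally show "integral_vec k {a..b} ?L $ i = integral_vec k {a..b} ?R $ i" using i by simp
  qed simp
qed

section \<open>State trajectories\<close>

lemma W_n_iff:
  "x \<in> W_n a b n0 n1 n2 \<longleftrightarrow> (\<forall>s\<in>{a..b}. x s \<in> carrier_vec (n_x n0 n1 n2)) \<and>
     (\<forall>i<n0. (\<lambda>s. x s $ i) \<in> L2 a b) \<and>
     (\<forall>i<n1. (\<lambda>s. x s $ (n0 + i)) \<in> sobolev a b 1) \<and>
     (\<forall>i<n2. (\<lambda>s. x s $ (n0 + n1 + i)) \<in> sobolev a b 2)"
  unfolding W_n_def sobolev_vec_def block_def sobolev_0 by auto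

lemma D_op_dim [simp]: "dim_vec (D_op a b n0 n1 n2 x s) = n_x n0 n1 n2"
  by (simp add: D_op_def block_def wderiv_vec_def n_x_def)

lemma D_op_index:
  "i < n0 \<Longrightarrow> D_op a b n0 n1 n2 x s $ i = x s $ i"
  "i < n1 \<Longrightarrow> D_op a b n0 n1 n2 x s $ (n0 + i) = wderiv a b 1 (\<lambda>t. x t $ (n0 + i)) s"
  "i < n2 \<Longrightarrow> D_op a b n0 n1 n2 x s $ (n0 + n1 + i) = wderiv a b 2 (\<lambda>t. x t $ (n0 + n1 + i)) s"
  by (simp_all add: D_op_def block_def wderiv_vec_def)

lemma x_c_dim [simp]: "dim_vec (x_c a b n0 n1 n2 x s) = n_S n1 n2"
  by (simp add: x_c_def cont_rep_vec_def n_S_def Let_def)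

lemma x_c_index:
  "i < n1 \<Longrightarrow> x_c a b n0 n1 n2 x s $ i = cont_rep a b (\<lambda>t. x t $ (n0 + i)) s"
  "i < n2 \<Longrightarrow> x_c a b n0 n1 n2 x s $ (n1 + i) = cont_rep a b (\<lambda>t. x t $ (n0 + n1 + i)) s"
  "i < n2 \<Longrightarrow> x_c a b n0 n1 n2 x s $ (n1 + n2 + i) =
    cont_rep a b (wderiv a b 1 (\<lambda>t. x t $ (n0 + n1 + i))) s"
  by (simp_all add: x_c_def cont_rep_vec_def wderiv_vec_def block_def Let_def)

lemma x_D_dim [simp]: "dim_vec (x_D a b n0 n1 n2 x s) = n_x n0 n1 n2 + n_S n1 n2"
  by (simp add: x_D_def wderiv_vec_def block_def n_S_def n_x_def Let_def)

lemma x_D_index: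
  "i < n0 \<Longrightarrow> x_D a b n0 n1 n2 x s $ i = x s $ i"
  "i < n1 + n2 \<Longrightarrow> x_D a b n0 n1 n2 x s $ (n0 + i) = x s $ (n0 + i)"
  "i < n1 \<Longrightarrow> x_D a b n0 n1 n2 x s $ (n0 + (n1 + n2) + i) = wderiv a b 1 (\<lambda>t. x t $ (n0 + i)) s"
  "i < n2 \<Longrightarrow> x_D a b n0 n1 n2 x s $ (n0 + (n1 + n2) + (n1 + i)) =
    wderiv a b 1 (\<lambda>t. x t $ (n0 + n1 + i)) s"
  "i < n2 \<Longrightarrow> x_D a b n0 n1 n2 x s $ (n0 + (n1 + n2) + (n1 + n2 + i)) =
    wderiv a b 2 (\<lambda>t. x t $ (n0 + n1 + i)) s"
  by (auto simp: x_D_def wderiv_vec_def block_def Let_def add.assoc)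

text \<open>
  The trajectory of core values with initial vector \<open>c\<close> and highest derivatives \<open>v\<close>: the
  variation-of-constants formula for \<open>\<partial>\<^sub>s x\<^sub>1 = v\<^sub>1\<close>, \<open>\<partial>\<^sub>s\<^sup>2 x\<^sub>2 = v\<^sub>2\<close>.
\<close>

definition state_traj ::
  "real \<Rightarrow> nat \<Rightarrow> nat \<Rightarrow> nat \<Rightarrow> real vec \<Rightarrow> (real \<Rightarrow> real vec) \<Rightarrow> real \<Rightarrow> real vec" where
  "state_traj a n0 n1 n2 c v s = T_mat n1 n2 (s - a) *\<^sub>v c +
     integral_vec (n_S n1 n2) {a..s} (\<lambda>\<theta>. Q_mat n0 n1 n2 (s - \<theta>) *\<^sub>v v \<theta>)"

lemma state_traj_dim [simp]: "dim_vec (state_traj a n0 n1 n2 c v s) = n_S n1 n2"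
  by (simp add: state_traj_def)

lemma state_traj_index:
  assumes v: "v \<in> L2_vec a b (n_x n0 n1 n2)" and c: "c \<in> carrier_vec (n_S n1 n2)"
    and s: "s \<in> {a..b}"
  shows "i < n1 \<Longrightarrow> state_traj a n0 n1 n2 c v s $ i =
      c $ i + (LINT \<theta>|lebesgue_on {a..s}. v \<theta> $ (n0 + i))"
    and "i < n2 \<Longrightarrow> state_traj a n0 n1 n2 c v s $ (n1 + i) =
      c $ (n1 + i) + (s - a) * c $ (n1 + n2 + i) + (LINT \<theta>|lebesgue_on {a..s}. (s - \<theta>) * v \<theta> $ (n0 + n1 + i))"
    and "i < n2 \<Longrightarrow> state_traj a n0 n1 n2 c v s $ (n1 + n2 + i) =
      c $ (n1 + n2 + i) + (LINT \<theta>|lebesgue_on {a..s}. v \<theta> $ (n0 + n1 + i))"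
proof -
  have Q: "(LINT \<theta>|lebesgue_on {a..s}. (Q_mat n0 n1 n2 (s - \<theta>) *\<^sub>v v \<theta>) $ j) =
      (LINT \<theta>|lebesgue_on {a..s}. (if j < n1 then v \<theta> $ (n0 + j)
        else if j < n1 + n2 then (s - \<theta>) * v \<theta> $ (n0 + j) else v \<theta> $ (n0 + j - n2)))"
    if "j < n_S n1 n2" for j
    using s that by (intro Bochner_Integration.integral_cong refl Q_mat_mult_vec L2_vec_carrier[OF v]) auto
  have idx: "state_traj a n0 n1 n2 c v s $ j = (T_mat n1 n2 (s - a) *\<^sub>v c) $ j +
      (LINT \<theta>|lebesgue_on {a..s}. (Q_mat n0 n1 n2 (s - \<theta>) *\<^sub>v v \<theta>) $ j)" if "j < n_S n1 n2" for j
    using that by (simp add: state_traj_def)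
  show "i < n1 \<Longrightarrow> state_traj a n0 n1 n2 c v s $ i = c $ i + (LINT \<theta>|lebesgue_on {a..s}. v \<theta> $ (n0 + i))"
    by (subst idx, simp add: n_S_def, subst Q, simp add: n_S_def, subst T_mat_mult_vec[OF c])
      (auto simp: n_S_def)
  show "i < n2 \<Longrightarrow> state_traj a n0 n1 n2 c v s $ (n1 + i) =
      c $ (n1 + i) + (s - a) * c $ (n1 + n2 + i) + (LINT \<theta>|lebesgue_on {a..s}. (s - \<theta>) * v \<theta> $ (n0 + n1 + i))"
    by (subst idx, simp add: n_S_def, subst Q, simp add: n_S_def, subst T_mat_mult_vec[OF c])
      (auto simp: n_S_def add_ac)
  show "i < n2 \<Longrightarrow> state_traj a n0 n1 n2 c v s $ (n1 + n2 + i) =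
      c $ (n1 + n2 + i) + (LINT \<theta>|lebesgue_on {a..s}. v \<theta> $ (n0 + n1 + i))"
    by (subst idx, simp add: n_S_def, subst Q, simp add: n_S_def, subst T_mat_mult_vec[OF c])
      (auto simp: n_S_def add_ac)
qed

text \<open>Every state follows the trajectory determined by \<open>x\<^sub>c(a)\<close> and \<open>D x\<close>.\<close>

lemma
  assumes "a < b" and x: "x \<in> W_n a b n0 n1 n2"
  defines "v \<equiv> D_op a b n0 n1 n2 x" and "c \<equiv> x_c a b n0 n1 n2 x a"
  shows D_op_in_L2_vec: "v \<in> L2_vec a b (n_x n0 n1 n2)"
    and x_c_eq_state_traj: "\<And>s. s \<in> {a..b} \<Longrightarrow> x_c a b n0 n1 n2 x s = state_traj a n0 n1 n2 c v s"
    and AE_eq_x_c: "\<And>i. i < n1 + n2 \<Longrightarrow>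
      AE s in lebesgue_on {a..b}. x s $ (n0 + i) = x_c a b n0 n1 n2 x s $ i"
    and AE_x_D_eq: "AE s in lebesgue_on {a..b}. x_D a b n0 n1 n2 x s =
      U1_mat n0 n1 n2 *\<^sub>v v s + U2_mat n0 n1 n2 *\<^sub>v x_c a b n0 n1 n2 x s"
proof -
  have x0: "(\<lambda>s. x s $ i) \<in> L2 a b" if "i < n0" for i using x that by (simp add: W_n_iff)
  have x1: "(\<lambda>s. x s $ (n0 + i)) \<in> sobolev a b 1" if "i < n1" for i using x that by (simp add: W_n_iff)
  have x2: "(\<lambda>s. x s $ (n0 + n1 + i)) \<in> sobolev a b 2" if "i < n2" for i using x that by (simp add: W_n_iff)
  note st1 = sobolev_1_structure[OF \<open>a < b\<close> x1]
  note st2 = sobolev_2_structure[OF \<open>a < b\<close> x2]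
  show v: "v \<in> L2_vec a b (n_x n0 n1 n2)"
    unfolding L2_vec_def
  proof (intro CollectI conjI allI impI ballI)
    fix i assume "i < n_x n0 n1 n2"
    then show "(\<lambda>s. v s $ i) \<in> L2 a b"
      by (cases rule: n_x_cases) (simp_all add: v_def D_op_index x0 st1 st2 del: One_nat_def)
  qed (auto simp: v_def carrier_vecI)
  have c: "c \<in> carrier_vec (n_S n1 n2)" by (auto simp: c_def carrier_vecI)
  show "x_c a b n0 n1 n2 x s = state_traj a n0 n1 n2 c v s" if s: "s \<in> {a..b}" for s
  proof (rule eq_vecI)
    fix i assume "i < dim_vec (state_traj a n0 n1 n2 c v s)"
    then have "i < n_S n1 n2" by simp
    then show "x_c a b n0 n1 n2 x s $ i = state_traj a n0 n1 n2 c v s $ i"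
    proof (cases rule: n_S_cases)
      case x1
      then show ?thesis
        unfolding state_traj_index(1)[OF v c s x1] using st1(3)[OF x1 s]
        by (simp add: x_c_index c_def v_def D_op_index)
    next
      case (x2 k)
      then show ?thesis
        unfolding x2(1) state_traj_index(2)[OF v c s x2(2)] using st2(5)[OF x2(2) s]
        by (simp add: x_c_index c_def v_def D_op_index)
    next
      case (dx2 k)
      then show ?thesis
        unfolding dx2(1) state_traj_index(3)[OF v c s dx2(2)] using st2(4)[OF dx2(2) s]
        by (simp add: x_c_index c_def v_def D_op_index)
    qed
  qed simp
  show ae: "AE s in lebesgue_on {a..b}. x s $ (n0 + i) = x_c a b n0 n1 n2 x s $ i" if i: "i < n1 + n2" for i
  proof (cases "i < n1")
    case True
    then show ?thesis using st1(2)[OF True] by (simp add: x_c_index)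
  next
    case False
    then obtain k where k: "i = n1 + k" "k < n2" using i less_imp_add_positive
      by (metis add_less_cancel_left le_Suc_ex not_less)
    then show ?thesis
      using sobolev_1_structure(2)[OF \<open>a < b\<close> st2(1)[OF k(2)]] by (simp add: x_c_index add.assoc)
  qed
  show "AE s in lebesgue_on {a..b}. x_D a b n0 n1 n2 x s =
      U1_mat n0 n1 n2 *\<^sub>v v s + U2_mat n0 n1 n2 *\<^sub>v x_c a b n0 n1 n2 x s"
  proof (rule AE_vec_eqI)
    fix i assume i: "i < n_x n0 n1 n2 + n_S n1 n2"
    let ?rhs = "\<lambda>s. if i < n0 then v s $ i
       else if i < n_x n0 n1 n2 then x_c a b n0 n1 n2 x s $ (i - n0)
       else if i < n_x n0 n1 n2 + n1 then v s $ (i - n1 - n2)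
       else if i < n_x n0 n1 n2 + n1 + n2 then x_c a b n0 n1 n2 x s $ (i - n0 - n1)
       else v s $ (i - n1 - 2 * n2)"
    have U: "(U1_mat n0 n1 n2 *\<^sub>v v s + U2_mat n0 n1 n2 *\<^sub>v x_c a b n0 n1 n2 x s) $ i =
      (if i < n0 then v s $ i
       else if i < n_x n0 n1 n2 then x_c a b n0 n1 n2 x s $ (i - n0)
       else if i < n_x n0 n1 n2 + n1 then v s $ (i - n1 - n2)
       else if i < n_x n0 n1 n2 + n1 + n2 then x_c a b n0 n1 n2 x s $ (i - n0 - n1)
       else v s $ (i - n1 - 2 * n2))" for s
      by (rule U_mat_mult_vec[OF _ _ i]) (auto simp: v_def carrier_vecI)
    from i show "AE s in lebesgue_on {a..b}. x_D a b n0 n1 n2 x s $ i =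
        (U1_mat n0 n1 n2 *\<^sub>v v s + U2_mat n0 n1 n2 *\<^sub>v x_c a b n0 n1 n2 x s) $ i"
      unfolding U
    proof (cases rule: row_block_cases)
      case (x12 k)
      with ae[OF x12(2)] show "AE s in lebesgue_on {a..b}. x_D a b n0 n1 n2 x s $ i = ?rhs s"
        by (simp add: n_x_def x_D_index)
    next
      case (dx2 k)
      have [simp]: "x_c a b n0 n1 n2 x s $ (n2 + (n1 + k)) =
          cont_rep a b (wderiv a b 1 (\<lambda>t. x t $ (n0 + n1 + k))) s" for s
        using x_c_index(3)[OF dx2(2)] by (simp only: add.left_commute[of n2] add.assoc)
      from dx2 sobolev_1_structure(2)[OF \<open>a < b\<close> st2(2)[OF dx2(2)]]
      show "AE s in lebesgue_on {a..b}. x_D a b n0 n1 n2 x s $ i = ?rhs s"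
        by (simp add: n_x_def x_D_index x_c_index)
    next
      case (ddx2 k)
      have [simp]: "D_op a b n0 n1 n2 x s $ (n0 + (n1 + k)) = wderiv a b 2 (\<lambda>t. x t $ (n0 + n1 + k)) s" for s
        unfolding add.assoc[symmetric] by (rule D_op_index(3)[OF ddx2(2)])
      from ddx2
      show "AE s in lebesgue_on {a..b}. x_D a b n0 n1 n2 x s $ i = ?rhs s"
        by (simp add: n_x_def x_D_index v_def)
    qed (simp_all add: n_x_def x_D_index v_def D_op_index del: One_nat_def)
  qed simp_all
qed

text \<open>Conversely, every trajectory comes from a state.\<close>

lemma
  assumes "a < b" and v: "v \<in> L2_vec a b (n_x n0 n1 n2)" and c: "c \<in> carrier_vec (n_S n1 n2)"
    and xc: "\<And>s. s \<in> {a..b} \<Longrightarrow> x s \<in> carrier_vec (n_x n0 n1 n2)"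
    and x0: "\<And>i s. i < n0 \<Longrightarrow> s \<in> {a..b} \<Longrightarrow> x s $ i = v s $ i"
    and x12: "\<And>i s. i < n1 + n2 \<Longrightarrow> s \<in> {a..b} \<Longrightarrow> x s $ (n0 + i) = state_traj a n0 n1 n2 c v s $ i"
  shows state_traj_in_W_n: "x \<in> W_n a b n0 n1 n2"
    and x_c_of_state_traj: "\<And>s. s \<in> {a..b} \<Longrightarrow> x_c a b n0 n1 n2 x s = state_traj a n0 n1 n2 c v s"
    and D_op_of_state_traj: "AE s in lebesgue_on {a..b}. D_op a b n0 n1 n2 x s = v s"
proof -
  note vi = L2_vec_entry[OF v]
  have e1: "AE s in lebesgue_on {a..b}. x s $ (n0 + i) = c $ i + (LINT \<theta>|lebesgue_on {a..s}. v \<theta> $ (n0 + i))"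
    if "i < n1" for i
    using that by (intro AE_I2) (simp add: x12 state_traj_index[OF v c])
  have e2: "AE s in lebesgue_on {a..b}. x s $ (n0 + n1 + i) = c $ (n1 + i) + (s - a) * c $ (n1 + n2 + i) +
      (LINT \<theta>|lebesgue_on {a..s}. (s - \<theta>) * v \<theta> $ (n0 + n1 + i))"
    if "i < n2" for i
    using that x12[of "n1 + i"] by (intro AE_I2) (simp add: add.assoc state_traj_index[OF v c, unfolded add.assoc])
  have v1: "(\<lambda>s. v s $ (n0 + i)) \<in> L2 a b" if "i < n1" for i using that by (intro vi) (simp add: n_x_def)
  have v2: "(\<lambda>s. v s $ (n0 + n1 + i)) \<in> L2 a b" if "i < n2" for i using that by (intro vi) (simp add: n_x_def)
  note p1 = sobolev_1_primitive[OF \<open>a < b\<close> v1 e1]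
  note p2 = sobolev_2_primitive[OF \<open>a < b\<close> v2 e2]
  have "(\<lambda>s. x s $ i) \<in> L2 a b" if "i < n0" for i
    using vi[of i] L2_cong[of a b "\<lambda>s. x s $ i" "\<lambda>s. v s $ i"] x0 that by (simp add: n_x_def)
  then show "x \<in> W_n a b n0 n1 n2" unfolding W_n_iff using xc p1(1) p2(1) by blast
  show "x_c a b n0 n1 n2 x s = state_traj a n0 n1 n2 c v s" if s: "s \<in> {a..b}" for s
  proof (rule eq_vecI)
    fix i assume "i < dim_vec (state_traj a n0 n1 n2 c v s)"
    then have "i < n_S n1 n2" by simp
    then show "x_c a b n0 n1 n2 x s $ i = state_traj a n0 n1 n2 c v s $ i"
    proof (cases rule: n_S_cases)
      case x1
      then show ?thesis using p1(4)[OF x1 x1 s] by (simp add: state_traj_index[OF v c s] x_c_index)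
    next
      case (x2 k)
      then show ?thesis using p2(4)[OF x2(2) x2(2) s] by (simp add: state_traj_index[OF v c s] x_c_index)
    next
      case (dx2 k)
      then show ?thesis using p2(5)[OF dx2(2) dx2(2) s] by (simp add: state_traj_index[OF v c s] x_c_index)
    qed
  qed simp
  show "AE s in lebesgue_on {a..b}. D_op a b n0 n1 n2 x s = v s"
  proof (rule AE_vec_eqI)
    fix i assume "i < n_x n0 n1 n2"
    then show "AE s in lebesgue_on {a..b}. D_op a b n0 n1 n2 x s $ i = v s $ i"
    proof (cases rule: n_x_cases)
      case x0
      then show ?thesis by (intro AE_I2) (simp add: D_op_index assms(5))
    next
      case (x1 k)
      then show ?thesis using p1(3)[OF x1(2) x1(2)] by (simp add: D_op_index)
    next
      case (x2 k)
      then show ?thesis using p2(2)[OF x2(2) x2(2)] by (simp add: D_op_index)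
    qed
  qed (use L2_vec_carrier[OF v] in auto)
qed

section \<open>Admissible boundary conditions\<close>

text \<open>
  The data of the problem.  Admissibility contains \<open>n_BC = n_S n1 n2\<close>, because only square
  matrices are invertible.
\<close>

locale admissible_boundary_conditions =
  fixes a b :: real and n0 n1 n2 n_BC :: nat and B :: "real mat" and B_I :: "real \<Rightarrow> real mat"
  assumes a_less_b: "a < b"
    and B_carrier: "B \<in> carrier_mat n_BC (2 * n_S n1 n2)"
    and B_I_L2: "B_I \<in> L2_mat a b n_BC (n_x n0 n1 n2 + n_S n1 n2)"
    and admissible: "admissible a b n0 n1 n2 B B_I"
begin

abbreviation nS :: nat where "nS \<equiv> n_S n1 n2"
abbreviation nx :: nat where "nx \<equiv> n_x n0 n1 n2"
abbreviation BT :: "real mat" where "BT \<equiv> B_T a b n0 n1 n2 B B_I"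
abbreviation BQ :: "real \<Rightarrow> real mat" where "BQ \<equiv> B_Q a b n0 n1 n2 B B_I"
abbreviation U1 :: "real mat" where "U1 \<equiv> U1_mat n0 n1 n2"
abbreviation U2 :: "real mat" where "U2 \<equiv> U2_mat n0 n1 n2"
abbreviation T :: "real \<Rightarrow> real mat" where "T \<equiv> T_mat n1 n2"
abbreviation Q :: "real \<Rightarrow> real mat" where "Q \<equiv> Q_mat n0 n1 n2"

lemma B_T_carrier: "BT \<in> carrier_mat n_BC nS"
  using B_carrier by (auto simp: B_T_def integral_mat_def)

lemma n_BC_eq: "n_BC = nS"
  using admissible B_T_carrier by (auto simp: admissible_def invertible_mat_def)

text \<open>The inverse of \<open>B\<^sub>T\<close>.\<close>

definition BT_inv :: "real mat" where "BT_inv = the (mat_inverse BT)"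

lemma BT_inv: "BT_inv \<in> carrier_mat nS nS" "BT_inv * BT = 1\<^sub>m nS" "BT * BT_inv = 1\<^sub>m nS"
proof -
  have BT: "BT \<in> carrier_mat nS nS" using B_T_carrier n_BC_eq by simp
  obtain C where C: "BT * C = 1\<^sub>m (dim_row BT)" "C * BT = 1\<^sub>m (dim_row C)"
    using admissible by (auto simp: admissible_def invertible_mat_def inverts_mat_def)
  then have "dim_col C = nS" "dim_row C = nS"
    using BT by (metis carrier_matD index_mult_mat(2,3) index_one_mat(2,3))+
  then have "BT \<in> Units (ring_mat TYPE(real) nS ())"
    using BT C by (auto simp: Units_def ring_mat_simps)
  then obtain D where D: "mat_inverse BT = Some D"
    using mat_inverse(1)[OF BT, where b = "()"] by (cases "mat_inverse BT") auto
  with mat_inverse(2)[OF BT D]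
  show "BT_inv \<in> carrier_mat nS nS" "BT_inv * BT = 1\<^sub>m nS" "BT * BT_inv = 1\<^sub>m nS"
    by (auto simp: BT_inv_def)
qed

text \<open>The matrix function \<open>B\<^sub>T B\<^sub>Q\<close>, whose definition involves no inverse.\<close>

definition BM :: "real \<Rightarrow> real mat" where
  "BM \<theta> = B_I \<theta> * U1 - B * (0\<^sub>m nS nx @\<^sub>r Q (b - \<theta>)) +
     integral_mat nS nx {\<theta>..b} (\<lambda>t. B_I t * U2 * Q (t - \<theta>))"

lemma B_Q_eq: "BQ \<theta> = BT_inv * BM \<theta>"
  using B_carrier by (simp add: B_Q_def BM_def BT_inv_def n_BC_eq)

lemma B_I_L2': "B_I \<in> L2_mat a b nS (nx + nS)" using B_I_L2 n_BC_eq by simp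
lemma B_carrier': "B \<in> carrier_mat nS (nS + nS)" using B_carrier n_BC_eq by (simp add: mult_2)

text \<open>
  Along a trajectory the two sides of the boundary condition are \<open>p + q\<close> and \<open>r + t + w\<close>, where
  \<open>p\<close> and \<open>t\<close> are linear in \<open>c\<close> with \<open>p - t = B\<^sub>T c\<close>, and \<open>r - q + w\<close> is the
  integral of \<open>B\<^sub>T B\<^sub>Q v\<close>; the term \<open>w\<close> is the one in which the order of integration is
  interchanged.
\<close>

lemma
  assumes v: "v \<in> L2_vec a b nx" and c: "c \<in> carrier_vec nS"
  defines "Z \<equiv> state_traj a n0 n1 n2 c v"
  shows vec_integrable_B_Q: "vec_integrable nS {a..b} (\<lambda>\<theta>. BQ \<theta> *\<^sub>v v \<theta>)"
    and boundary_condition_iff: "B *\<^sub>v (Z a @\<^sub>v Z b) = integral_vec nS {a..b} (\<lambda>s. B_I s *\<^sub>v (U1 *\<^sub>v v s + U2 *\<^sub>v Z s)) \<longleftrightarrow>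
      c = integral_vec nS {a..b} (\<lambda>\<theta>. BQ \<theta> *\<^sub>v v \<theta>)"
proof -
  note vc = L2_vec_carrier[OF v] and BIc = L2_mat_carrier[OF B_I_L2']
  note [simp] = c
  let ?A1 = "\<lambda>s. B_I s * U1" and ?A2 = "\<lambda>s. B_I s * U2"
  let ?N = "\<lambda>\<theta>. 0\<^sub>m nS nx @\<^sub>r Q (b - \<theta>)"
  let ?K = "\<lambda>\<theta>. integral_mat nS nx {\<theta>..b} (\<lambda>t. ?A2 t * Q (t - \<theta>))"
  let ?q = "\<lambda>s. integral_vec nS {a..s} (\<lambda>\<theta>. Q (s - \<theta>) *\<^sub>v v \<theta>)"
  have A1: "?A1 \<in> L2_mat a b nS nx" and A2: "?A2 \<in> L2_mat a b nS nS"
    by (rule L2_mat_mult_const[OF B_I_L2']; simp)+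
  note A1c = L2_mat_carrier[OF A1] and A2c = L2_mat_carrier[OF A2]
  have Nc: "?N \<theta> \<in> carrier_mat (nS + nS) nx" for \<theta> by auto
  have N: "?N \<in> L2_mat a b (nS + nS) nx"
    unfolding L2_mat_def
  proof (intro CollectI conjI allI impI ballI Nc)
    fix i j assume i: "i < nS + nS" and j: "j < nx"
    show "(\<lambda>\<theta>. ?N \<theta> $$ (i, j)) \<in> L2 a b"
    proof (cases "i < nS")
      case True
      then show ?thesis using j by (simp add: append_rows_index L2_continuous)
    next
      case False
      then have "continuous_on {a..b} (\<lambda>\<theta>. Q (b - \<theta>) $$ (i - nS, j))"
        using i j by (intro continuous_on_compose2[OF continuous_Q_mat]) (auto intro!: continuous_intros)
      then show ?thesis using False i j by (simp add: append_rows_index L2_continuous)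
    qed
  qed
  have i1: "vec_integrable nS {a..b} (\<lambda>s. ?A1 s *\<^sub>v v s)"
    by (rule vec_integrable_L2_mult[OF A1 v])
  have iN: "vec_integrable (nS + nS) {a..b} (\<lambda>s. ?N s *\<^sub>v v s)"
    by (rule vec_integrable_L2_mult[OF N v])
  have i2: "vec_integrable nS {a..b} (\<lambda>s. B *\<^sub>v (?N s *\<^sub>v v s))"
    by (rule vec_integrable_mult_const[OF B_carrier' iN])
  have i3: "vec_integrable nS {a..b} (\<lambda>\<theta>. ?K \<theta> *\<^sub>v v \<theta>)"
    by (rule vec_integrable_convolution_right[OF A2 v Q_mat_carrier continuous_Q_mat])
  have i4: "vec_integrable nS {a..b} (\<lambda>s. ?A2 s *\<^sub>v ?q s)"
    by (rule vec_integrable_convolution_left[OF A2 v Q_mat_carrier continuous_Q_mat])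
  have swap: "integral_vec nS {a..b} (\<lambda>s. ?A2 s *\<^sub>v ?q s) = integral_vec nS {a..b} (\<lambda>\<theta>. ?K \<theta> *\<^sub>v v \<theta>)"
    by (rule integral_vec_convolution_swap[OF A2 v Q_mat_carrier continuous_Q_mat])
  have mT: "mat_integrable nS nS {a..b} (\<lambda>s. ?A2 s * T (s - a))"
    by (rule mat_integrable_mult_continuous[OF A2 T_mat_carrier continuous_T_mat]) auto
  note i5 = vec_integrable_mat_mult_const[OF mT c]
  define p where "p = B * (T 0 @\<^sub>r T (b - a)) *\<^sub>v c"
  define t where "t = integral_mat nS nS {a..b} (\<lambda>s. ?A2 s * T (s - a)) *\<^sub>v c"
  define q where "q = integral_vec nS {a..b} (\<lambda>\<theta>. B *\<^sub>v (?N \<theta> *\<^sub>v v \<theta>))"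
  define r where "r = integral_vec nS {a..b} (\<lambda>\<theta>. ?A1 \<theta> *\<^sub>v v \<theta>)"
  define w where "w = integral_vec nS {a..b} (\<lambda>\<theta>. ?K \<theta> *\<^sub>v v \<theta>)"
  have BTT: "B * (T 0 @\<^sub>r T (b - a)) \<in> carrier_mat nS nS"
    by (rule mult_carrier_mat[OF B_carrier']) auto
  have carr: "p \<in> carrier_vec nS" "t \<in> carrier_vec nS" "q \<in> carrier_vec nS" "r \<in> carrier_vec nS" "w \<in> carrier_vec nS"
    using mult_mat_vec_carrier[OF BTT c] mult_mat_vec_carrier[OF integral_mat_carrier c]
    by (auto simp: p_def t_def q_def r_def w_def)
  have BMv: "BM \<theta> *\<^sub>v v \<theta> = (?A1 \<theta> *\<^sub>v v \<theta> + - 1 \<cdot>\<^sub>v (B *\<^sub>v (?N \<theta> *\<^sub>v v \<theta>))) + ?K \<theta> *\<^sub>v v \<theta>"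
    and BMc: "BM \<theta> \<in> carrier_mat nS nx" if \<theta>: "\<theta> \<in> {a..b}" for \<theta>
  proof -
    have BN: "B * ?N \<theta> \<in> carrier_mat nS nx" by (rule mult_carrier_mat[OF B_carrier' Nc])
    show "BM \<theta> \<in> carrier_mat nS nx" unfolding BM_def using A1c[OF \<theta>] BN by auto
    have "BM \<theta> *\<^sub>v v \<theta> = (?A1 \<theta> - B * ?N \<theta>) *\<^sub>v v \<theta> + ?K \<theta> *\<^sub>v v \<theta>"
      unfolding BM_def using A1c[OF \<theta>] BN vc[OF \<theta>] by (intro add_mult_distrib_mat_vec) auto
    also have "(?A1 \<theta> - B * ?N \<theta>) *\<^sub>v v \<theta> = ?A1 \<theta> *\<^sub>v v \<theta> - (B * ?N \<theta>) *\<^sub>v v \<theta>"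
      using A1c[OF \<theta>] BN vc[OF \<theta>] by (intro minus_mult_distrib_mat_vec) auto
    also have "(B * ?N \<theta>) *\<^sub>v v \<theta> = B *\<^sub>v (?N \<theta> *\<^sub>v v \<theta>)"
      by (rule assoc_mult_mat_vec[OF B_carrier' Nc vc[OF \<theta>]])
    finally show "BM \<theta> *\<^sub>v v \<theta> = (?A1 \<theta> *\<^sub>v v \<theta> + - 1 \<cdot>\<^sub>v (B *\<^sub>v (?N \<theta> *\<^sub>v v \<theta>))) + ?K \<theta> *\<^sub>v v \<theta>"
      using carrier_matD(1)[OF A1c[OF \<theta>]] carrier_matD(1)[OF B_carrier']
      by (simp add: minus_vec_eq_add_smult)
  qed
  \<comment> \<open>as a matrix multiplication, the sign is covered by linearity of the integral\<close>
  have neg: "- 1 \<cdot>\<^sub>v u = (- 1 \<cdot>\<^sub>m 1\<^sub>m nS) *\<^sub>v u" if "u \<in> carrier_vec nS" for u :: "real vec"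
    using that by (intro eq_vecI) (auto simp: row_smult)
  have i2': "vec_integrable nS {a..b} (\<lambda>\<theta>. (- 1 \<cdot>\<^sub>m 1\<^sub>m nS) *\<^sub>v (B *\<^sub>v (?N \<theta> *\<^sub>v v \<theta>)))"
    by (rule vec_integrable_mult_const[OF _ i2]) auto
  let ?m = "\<lambda>\<theta>. (?A1 \<theta> *\<^sub>v v \<theta> + (- 1 \<cdot>\<^sub>m 1\<^sub>m nS) *\<^sub>v (B *\<^sub>v (?N \<theta> *\<^sub>v v \<theta>))) + ?K \<theta> *\<^sub>v v \<theta>"
  have BMv': "BM \<theta> *\<^sub>v v \<theta> = ?m \<theta>" if \<theta>: "\<theta> \<in> {a..b}" for \<theta>
    unfolding BMv[OF \<theta>]
      neg[OF mult_mat_vec_carrier[OF B_carrier' mult_mat_vec_carrier[OF Nc vc[OF \<theta>]]]] ..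
  have im: "vec_integrable nS {a..b} ?m"
    by (intro vec_integrable_add i1 i2' i3)
  have "integral_vec nS {a..b} (\<lambda>\<theta>. BM \<theta> *\<^sub>v v \<theta>) = integral_vec nS {a..b} ?m"
    by (intro integral_vec_cong BMv')
  also have "\<dots> = r + (- 1 \<cdot>\<^sub>m 1\<^sub>m nS) *\<^sub>v q + w"
    unfolding r_def q_def w_def
    by (subst integral_vec_add[OF vec_integrable_add[OF i1 i2'] i3], subst integral_vec_add[OF i1 i2'],
        subst integral_vec_mult_const[OF _ i2]) auto
  finally have intBM: "integral_vec nS {a..b} (\<lambda>\<theta>. BM \<theta> *\<^sub>v v \<theta>) = r + - 1 \<cdot>\<^sub>v q + w"
    using neg[OF carr(3)] by simp
  have iBM: "vec_integrable nS {a..b} (\<lambda>\<theta>. BM \<theta> *\<^sub>v v \<theta>)"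
    using im by (subst vec_integrable_cong[OF BMv'])
  have BQv: "BQ \<theta> *\<^sub>v v \<theta> = BT_inv *\<^sub>v (BM \<theta> *\<^sub>v v \<theta>)" if \<theta>: "\<theta> \<in> {a..b}" for \<theta>
    unfolding B_Q_eq by (rule assoc_mult_mat_vec[OF BT_inv(1) BMc[OF \<theta>] vc[OF \<theta>]])
  note iBQ = vec_integrable_mult_const[OF BT_inv(1) iBM]
  show "vec_integrable nS {a..b} (\<lambda>\<theta>. BQ \<theta> *\<^sub>v v \<theta>)"
    using iBQ by (subst vec_integrable_cong[OF BQv])
  have "integral_vec nS {a..b} (\<lambda>\<theta>. BQ \<theta> *\<^sub>v v \<theta>) = integral_vec nS {a..b} (\<lambda>\<theta>. BT_inv *\<^sub>v (BM \<theta> *\<^sub>v v \<theta>))"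
    by (intro integral_vec_cong BQv)
  also have "\<dots> = BT_inv *\<^sub>v (r + - 1 \<cdot>\<^sub>v q + w)"
    using integral_vec_mult_const[OF BT_inv(1) iBM] intBM by simp
  finally have intBQ: "integral_vec nS {a..b} (\<lambda>\<theta>. BQ \<theta> *\<^sub>v v \<theta>) = BT_inv *\<^sub>v (r + - 1 \<cdot>\<^sub>v q + w)" .
  have BT_sq: "BT \<in> carrier_mat nS nS" using B_T_carrier n_BC_eq by simp
  have BTc: "BT *\<^sub>v c = p - t"
  proof -
    have "BT *\<^sub>v c = (B * (T 0 @\<^sub>r T (b - a)) - integral_mat nS nS {a..b} (\<lambda>s. ?A2 s * T (s - a))) *\<^sub>v c"
      using B_carrier' by (simp add: B_T_def)
    also have "\<dots> = p - t" unfolding p_def t_def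
      using BTT by (intro minus_mult_distrib_mat_vec) auto
    finally show ?thesis .
  qed
  have rqw: "r + - 1 \<cdot>\<^sub>v q + w \<in> carrier_vec nS" using carr by auto
  have c_iff: "c = BT_inv *\<^sub>v u \<longleftrightarrow> BT *\<^sub>v c = u" if "u \<in> carrier_vec nS" for u
  proof
    assume "c = BT_inv *\<^sub>v u"
    then have "BT *\<^sub>v c = (BT * BT_inv) *\<^sub>v u"
      using assoc_mult_mat_vec[OF BT_sq BT_inv(1) that] by simp
    then show "BT *\<^sub>v c = u" using BT_inv(3) that by simp
  next
    assume "BT *\<^sub>v c = u"
    then have "BT_inv *\<^sub>v u = (BT_inv * BT) *\<^sub>v c"
      using assoc_mult_mat_vec[OF BT_inv(1) BT_sq c] by simp
    then show "c = BT_inv *\<^sub>v u" using BT_inv(2) by simp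
  qed
  have null: "integral_vec nS {a..a} (\<lambda>\<theta>. Q (a - \<theta>) *\<^sub>v v \<theta>) = 0\<^sub>v nS"
    by (intro eq_vecI) (auto intro!: integral_eq_zero_null_sets null_sets_completionI)
  have Za: "Z a = T 0 *\<^sub>v c" unfolding Z_def state_traj_def null by (intro eq_vecI) auto
  have Zb: "Z b = T (b - a) *\<^sub>v c + ?q b" by (simp add: Z_def state_traj_def)
  have intN: "integral_vec (nS + nS) {a..b} (\<lambda>\<theta>. ?N \<theta> *\<^sub>v v \<theta>) = 0\<^sub>v nS @\<^sub>v ?q b"
  proof -
    have "?N \<theta> *\<^sub>v v \<theta> = 0\<^sub>v nS @\<^sub>v (Q (b - \<theta>) *\<^sub>v v \<theta>)" if "\<theta> \<in> {a..b}" for \<theta>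
      using mat_mult_append[OF _ Q_mat_carrier vc[OF that], of "0\<^sub>m nS nx" nS]
      by (simp add: zero_mat_mult_vec[OF vc[OF that]])
    then have "integral_vec (nS + nS) {a..b} (\<lambda>\<theta>. ?N \<theta> *\<^sub>v v \<theta>) =
        integral_vec (nS + nS) {a..b} (\<lambda>\<theta>. 0\<^sub>v nS @\<^sub>v (Q (b - \<theta>) *\<^sub>v v \<theta>))"
      by (intro integral_vec_cong)
    also have "\<dots> = 0\<^sub>v nS @\<^sub>v ?q b" by (intro eq_vecI) auto
    finally show ?thesis .
  qed
  have "Z a @\<^sub>v Z b = (T 0 @\<^sub>r T (b - a)) *\<^sub>v c + (0\<^sub>v nS @\<^sub>v ?q b)"
    unfolding mat_mult_append[OF T_mat_carrier T_mat_carrier c] Za Zb by (intro eq_vecI) auto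
  also have "B *\<^sub>v \<dots> = B *\<^sub>v ((T 0 @\<^sub>r T (b - a)) *\<^sub>v c) + B *\<^sub>v (0\<^sub>v nS @\<^sub>v ?q b)"
    by (rule mult_add_distrib_mat_vec[OF B_carrier']) (auto intro!: mult_mat_vec_carrier)
  also have "B *\<^sub>v ((T 0 @\<^sub>r T (b - a)) *\<^sub>v c) = p"
    unfolding p_def by (rule assoc_mult_mat_vec[symmetric, OF B_carrier' _ c]) auto
  also have "B *\<^sub>v (0\<^sub>v nS @\<^sub>v ?q b) = q"
    unfolding q_def intN[symmetric] by (rule integral_vec_mult_const[symmetric, OF B_carrier' iN])
  finally have left: "B *\<^sub>v (Z a @\<^sub>v Z b) = p + q" .
  have "B_I s *\<^sub>v (U1 *\<^sub>v v s + U2 *\<^sub>v Z s) = ?A1 s *\<^sub>v v s + ((?A2 s * T (s - a)) *\<^sub>v c + ?A2 s *\<^sub>v ?q s)"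
    if s: "s \<in> {a..b}" for s
  proof -
    have Zc: "Z s \<in> carrier_vec nS" by (simp add: Z_def carrier_vecI)
    have Zs: "Z s = T (s - a) *\<^sub>v c + ?q s" by (simp add: Z_def state_traj_def)
    have "B_I s *\<^sub>v (U1 *\<^sub>v v s + U2 *\<^sub>v Z s) = B_I s *\<^sub>v (U1 *\<^sub>v v s) + B_I s *\<^sub>v (U2 *\<^sub>v Z s)"
      by (rule mult_add_distrib_mat_vec[OF BIc[OF s] mult_mat_vec_carrier[OF U1_mat_carrier vc[OF s]]])
        (rule mult_mat_vec_carrier[OF U2_mat_carrier Zc])
    also have "B_I s *\<^sub>v (U1 *\<^sub>v v s) = ?A1 s *\<^sub>v v s"
      by (rule assoc_mult_mat_vec[symmetric, OF BIc[OF s] U1_mat_carrier vc[OF s]])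
    also have "B_I s *\<^sub>v (U2 *\<^sub>v Z s) = ?A2 s *\<^sub>v Z s"
      by (rule assoc_mult_mat_vec[symmetric, OF BIc[OF s] U2_mat_carrier Zc])
    also have "\<dots> = ?A2 s *\<^sub>v (T (s - a) *\<^sub>v c) + ?A2 s *\<^sub>v ?q s"
      unfolding Zs by (rule mult_add_distrib_mat_vec[OF A2c[OF s]])
        (auto intro!: mult_mat_vec_carrier[OF T_mat_carrier])
    also have "?A2 s *\<^sub>v (T (s - a) *\<^sub>v c) = (?A2 s * T (s - a)) *\<^sub>v c"
      by (rule assoc_mult_mat_vec[symmetric, OF A2c[OF s] T_mat_carrier c])
    finally show ?thesis .
  qed
  then have "integral_vec nS {a..b} (\<lambda>s. B_I s *\<^sub>v (U1 *\<^sub>v v s + U2 *\<^sub>v Z s)) =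
      integral_vec nS {a..b} (\<lambda>s. ?A1 s *\<^sub>v v s + ((?A2 s * T (s - a)) *\<^sub>v c + ?A2 s *\<^sub>v ?q s))"
    by (rule integral_vec_cong)
  also have "\<dots> = r + (t + w)"
    unfolding r_def t_def w_def swap[symmetric] integral_mat_mult_const[OF mT c, symmetric]
    by (subst integral_vec_add[OF i1 vec_integrable_add[OF i5 i4]], subst integral_vec_add[OF i5 i4]) auto
  finally have right: "integral_vec nS {a..b} (\<lambda>s. B_I s *\<^sub>v (U1 *\<^sub>v v s + U2 *\<^sub>v Z s)) = r + (t + w)" .
  have "p + q = r + (t + w) \<longleftrightarrow> p - t = r + - 1 \<cdot>\<^sub>v q + w"
  proof -
    have "p + q = r + (t + w) \<longleftrightarrow> (\<forall>i<nS. p $ i + q $ i = r $ i + (t $ i + w $ i))"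
      using carr by (auto simp: vec_eq_iff)
    moreover have "p - t = r + - 1 \<cdot>\<^sub>v q + w \<longleftrightarrow> (\<forall>i<nS. p $ i - t $ i = r $ i - q $ i + w $ i)"
      using carr by (auto simp: vec_eq_iff)
    moreover have "p $ i + q $ i = r $ i + (t $ i + w $ i) \<longleftrightarrow> p $ i - t $ i = r $ i - q $ i + w $ i" for i
      by linarith
    ultimately show ?thesis by simp
  qed
  then show "B *\<^sub>v (Z a @\<^sub>v Z b) = integral_vec nS {a..b} (\<lambda>s. B_I s *\<^sub>v (U1 *\<^sub>v v s + U2 *\<^sub>v Z s)) \<longleftrightarrow>
      c = integral_vec nS {a..b} (\<lambda>\<theta>. BQ \<theta> *\<^sub>v v \<theta>)"
    unfolding left right intBQ c_iff[OF rqw] BTc .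
qed

text \<open>
  \<open>\<T> v\<close> is the state with highest derivatives \<open>v\<close> and initial vector \<open>c = \<integral> B\<^sub>Q v\<close>: the
  terms with \<open>G\<^sub>2\<close> combine to an integral over the whole interval, from which \<open>T(s - a)\<close>
  can be pulled out.
\<close>

lemma T_op_eq:
  assumes v: "v \<in> L2_vec a b nx" and s: "s \<in> {a..b}"
  defines "c \<equiv> integral_vec nS {a..b} (\<lambda>\<theta>. BQ \<theta> *\<^sub>v v \<theta>)"
  shows "T_op a b n0 n1 n2 B B_I v s \<in> carrier_vec nx"
    and "i < n0 \<Longrightarrow> T_op a b n0 n1 n2 B B_I v s $ i = v s $ i"
    and "i < n1 + n2 \<Longrightarrow> T_op a b n0 n1 n2 B B_I v s $ (n0 + i) = state_traj a n0 n1 n2 c v s $ i"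
proof -
  note vc = L2_vec_carrier[OF v]
  let ?G1 = "G1 a b n0 n1 n2 B B_I s" and ?G2 = "G2 a b n0 n1 n2 B B_I s"
  let ?w = "\<lambda>\<theta>. BQ \<theta> *\<^sub>v v \<theta>"
  have nx: "nx = n0 + (n1 + n2)" by (simp add: n_x_def)
  have le: "n1 + n2 \<le> nS" by (simp add: n_S_def)
  have c: "c \<in> carrier_vec nS" by (simp add: c_def)
  have BQc: "BQ \<theta> \<in> carrier_mat nS nx" for \<theta>
    unfolding B_Q_eq BM_def by (intro mult_carrier_mat[OF BT_inv(1)]) (simp add: n_x_def[symmetric] integral_mat_def)
  have wi: "vec_integrable nS {a..b} ?w" by (rule vec_integrable_B_Q[OF v c])
  have Q1c: "0\<^sub>m n0 nx @\<^sub>r Q1_mat n0 n1 n2 (s - \<theta>) \<in> carrier_mat nx nx" for \<theta>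
    unfolding nx Q1_mat_def by (rule carrier_append_rows) (auto simp: n_x_def intro!: first_rows_carrier)
  have T1BQc: "T1_mat n1 n2 (s - a) * BQ \<theta> \<in> carrier_mat (n1 + n2) nx" for \<theta>
    unfolding T1_mat_def by (rule mult_carrier_mat[OF first_rows_carrier[OF T_mat_carrier] BQc])
  have G2c: "?G2 \<theta> \<in> carrier_mat nx nx" for \<theta>
  proof -
    have "?G2 \<theta> \<in> carrier_mat (n0 + (n1 + n2)) nx" 
      unfolding G2_def by (rule carrier_append_rows[OF zero_carrier_mat T1BQc])
    then show ?thesis by (simp add: nx)
  qed
  have G2v: "?G2 \<theta> *\<^sub>v v \<theta> = 0\<^sub>v n0 @\<^sub>v (first_rows (n1 + n2) (T (s - a)) *\<^sub>v ?w \<theta>)"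
    if \<theta>: "\<theta> \<in> {a..b}" for \<theta>
    unfolding G2_def mat_mult_append[OF zero_carrier_mat T1BQc vc[OF \<theta>]]
    unfolding T1_mat_def assoc_mult_mat_vec[OF first_rows_carrier[OF T_mat_carrier] BQc vc[OF \<theta>]]
    by (simp add: zero_mat_mult_vec[OF vc[OF \<theta>]])
  have G1v: "?G1 \<theta> *\<^sub>v v \<theta> = (0\<^sub>v n0 @\<^sub>v (first_rows (n1 + n2) (Q (s - \<theta>)) *\<^sub>v v \<theta>)) + ?G2 \<theta> *\<^sub>v v \<theta>"
    if \<theta>: "\<theta> \<in> {a..b}" for \<theta>
    unfolding G1_def add_mult_distrib_mat_vec[OF Q1c G2c vc[OF \<theta>]]
    unfolding Q1_mat_def mat_mult_append[OF zero_carrier_mat first_rows_carrier[OF Q_mat_carrier] vc[OF \<theta>]]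
    by (simp add: zero_mat_mult_vec[OF vc[OF \<theta>]])
  have wc: "?w \<theta> \<in> carrier_vec nS" if "\<theta> \<in> {a..b}" for \<theta>
    by (rule mult_mat_vec_carrier[OF BQc vc[OF that]])
  have G2i: "(?G2 \<theta> *\<^sub>v v \<theta>) $ i = (if i < n0 then 0 else (T (s - a) *\<^sub>v ?w \<theta>) $ (i - n0))"
    if \<theta>: "\<theta> \<in> {a..b}" and i: "i < nx" for \<theta> i
    unfolding G2v[OF \<theta>] using i le carrier_matD(1)[OF BQc]
    by (auto simp: nx first_rows_mult_index simp del: index_mult_mat_vec)
  have G1i: "(?G1 \<theta> *\<^sub>v v \<theta>) $ i =
      (if i < n0 then 0 else (Q (s - \<theta>) *\<^sub>v v \<theta>) $ (i - n0) + (T (s - a) *\<^sub>v ?w \<theta>) $ (i - n0))"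
    if \<theta>: "\<theta> \<in> {a..b}" and i: "i < nx" for \<theta> i
  proof -
    have "dim_vec (?G2 \<theta> *\<^sub>v v \<theta>) = nx" using carrier_matD(1)[OF G2c[of \<theta>]] by simp
    then have "(?G1 \<theta> *\<^sub>v v \<theta>) $ i = (0\<^sub>v n0 @\<^sub>v (first_rows (n1 + n2) (Q (s - \<theta>)) *\<^sub>v v \<theta>)) $ i +
        (?G2 \<theta> *\<^sub>v v \<theta>) $ i" unfolding G1v[OF \<theta>] using i by simp
    then show ?thesis unfolding G2i[OF \<theta> i] using i le carrier_vecD[OF vc[OF \<theta>]]
      by (auto simp: nx n_x_def first_rows_mult_index simp del: index_mult_mat_vec)
  qed
  let ?i1 = "integral_vec nx {a..s} (\<lambda>\<theta>. ?G1 \<theta> *\<^sub>v v \<theta>)" and ?i2 = "integral_vec nx {s..b} (\<lambda>\<theta>. ?G2 \<theta> *\<^sub>v v \<theta>)"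
  have Top: "T_op a b n0 n1 n2 B B_I v s = G0 n0 n1 n2 s *\<^sub>v v s + ?i1 + ?i2"
    by (simp add: T_op_def PI_op_def)
  then show "T_op a b n0 n1 n2 B B_I v s \<in> carrier_vec nx" by (simp add: carrier_vecI)
  have G0c: "G0 n0 n1 n2 s \<in> carrier_mat nx nx" by (simp add: G0_def nx)
  have G0i: "(G0 n0 n1 n2 s *\<^sub>v v s) $ i = (if i < n0 then v s $ i else 0)" if i: "i < nx" for i
  proof -
    have "(G0 n0 n1 n2 s *\<^sub>v v s) $ i = (\<Sum>j<nx. if j = i then (if i < n0 then v s $ j else 0) else 0)"
      unfolding mult_mat_vec_index[OF G0c vc[OF s] i]
      by (intro sum.cong refl) (use i in \<open>auto simp: G0_def nx\<close>)
    then show ?thesis using i by simp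
  qed
  have idx: "T_op a b n0 n1 n2 B B_I v s $ i = (if i < n0 then v s $ i else 0) +
      (LINT \<theta>|lebesgue_on {a..s}. (?G1 \<theta> *\<^sub>v v \<theta>) $ i) + (LINT \<theta>|lebesgue_on {s..b}. (?G2 \<theta> *\<^sub>v v \<theta>) $ i)"
    if "i < nx" for i
    unfolding Top using that G0i[OF that] by simp
  have I1: "(LINT \<theta>|lebesgue_on {a..s}. (?G1 \<theta> *\<^sub>v v \<theta>) $ i) = (LINT \<theta>|lebesgue_on {a..s}.
      (if i < n0 then 0 else (Q (s - \<theta>) *\<^sub>v v \<theta>) $ (i - n0) + (T (s - a) *\<^sub>v ?w \<theta>) $ (i - n0)))" if "i < nx" for i
    by (intro Bochner_Integration.integral_cong refl G1i) (use s that in auto)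
  have I2: "(LINT \<theta>|lebesgue_on {s..b}. (?G2 \<theta> *\<^sub>v v \<theta>) $ i) = (LINT \<theta>|lebesgue_on {s..b}.
      (if i < n0 then 0 else (T (s - a) *\<^sub>v ?w \<theta>) $ (i - n0)))" if "i < nx" for i
    by (intro Bochner_Integration.integral_cong refl G2i) (use s that in auto)
  show "T_op a b n0 n1 n2 B B_I v s $ i = v s $ i" if "i < n0"
    using that idx[of i] I1[of i] I2[of i] by (simp add: nx)
  show "T_op a b n0 n1 n2 B B_I v s $ (n0 + i) = state_traj a n0 n1 n2 c v s $ i" if i: "i < n1 + n2"
  proof -
    let ?f = "\<lambda>\<theta>. (T (s - a) *\<^sub>v ?w \<theta>) $ i" and ?g = "\<lambda>\<theta>. (Q (s - \<theta>) *\<^sub>v v \<theta>) $ i"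
    have iS: "i < nS" using i le by simp
    have f: "integrable (lebesgue_on {a..b}) ?f"
      using vec_integrable_mult_const[OF T_mat_carrier wi] iS by (simp add: vec_integrable_def)
    have "vec_integrable nS {a..s} (\<lambda>\<theta>. Q (s - \<theta>) *\<^sub>v v \<theta>)"
    proof (rule vec_integrable_L2_mult)
      show "(\<lambda>\<theta>. Q (s - \<theta>)) \<in> L2_mat a s nS nx"
        unfolding L2_mat_def
      proof (intro CollectI conjI allI impI ballI Q_mat_carrier L2_continuous)
        fix i j assume "i < nS" "j < nx"
        then show "continuous_on {a..s} (\<lambda>\<theta>. Q (s - \<theta>) $$ (i, j))"
          by (intro continuous_on_compose2[OF continuous_Q_mat]) (auto intro!: continuous_intros)
      qed
      have "(\<lambda>s. v s $ i) \<in> L2 a s" if "i < nx" for i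
      proof -
        have "(\<lambda>s. v s $ i) \<in> L2 a b" by (rule L2_vec_entry[OF v that])
        then show ?thesis using s
          unfolding L2_def by (auto elim: measurable_restrict_mono integrable_subinterval)
      qed
      then show "v \<in> L2_vec a s nx" using vc s by (auto simp: L2_vec_def)
    qed
    then have g: "integrable (lebesgue_on {a..s}) ?g" using iS by (simp add: vec_integrable_def)
    have f1: "integrable (lebesgue_on {a..s}) ?f" using s by (intro integrable_subinterval[OF f]) auto
    have "T_op a b n0 n1 n2 B B_I v s $ (n0 + i) = (LINT \<theta>|lebesgue_on {a..s}. ?g \<theta> + ?f \<theta>) + (LINT \<theta>|lebesgue_on {s..b}. ?f \<theta>)"
      using i idx[of "n0 + i"] I1[of "n0 + i"] I2[of "n0 + i"] by (simp add: nx)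
    also have "\<dots> = (LINT \<theta>|lebesgue_on {a..s}. ?g \<theta>) + ((LINT \<theta>|lebesgue_on {a..s}. ?f \<theta>) + (LINT \<theta>|lebesgue_on {s..b}. ?f \<theta>))"
      by (subst Bochner_Integration.integral_add[OF g f1]) simp
    also have "(LINT \<theta>|lebesgue_on {a..s}. ?f \<theta>) + (LINT \<theta>|lebesgue_on {s..b}. ?f \<theta>) = (LINT \<theta>|lebesgue_on {a..b}. ?f \<theta>)"
      using s by (intro Equivalence_Measurable_On_Borel.integral_combine[symmetric] f) auto
    also have "\<dots> = (T (s - a) *\<^sub>v c) $ i"
      unfolding c_def integral_vec_mult_const[OF T_mat_carrier wi, symmetric] using iS by simp
    finally show ?thesis using iS by (simp add: state_traj_def)
  qed
qed

end

section \<open>The partial integral operator and the domain\<close>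

theorem theorem2:
  fixes a b :: real and n0 n1 n2 n_BC :: nat
    and B :: "real mat" and B_I :: "real \<Rightarrow> real mat"
  assumes "a < b"
    and "B \<in> carrier_mat n_BC (2 * n_S n1 n2)"
    and "B_I \<in> L2_mat a b n_BC (n_x n0 n1 n2 + n_S n1 n2)"
    and "admissible a b n0 n1 n2 B B_I"
  shows "(\<forall>x \<in> X_dom a b n0 n1 n2 B B_I.
            D_op a b n0 n1 n2 x \<in> L2_vec a b (n_x n0 n1 n2) \<and>
            (AE s in lebesgue_on {a..b}.
               x s = T_op a b n0 n1 n2 B B_I (D_op a b n0 n1 n2 x) s)) \<and>
         (\<forall>xh \<in> L2_vec a b (n_x n0 n1 n2).
            T_op a b n0 n1 n2 B B_I xh \<in> X_dom a b n0 n1 n2 B B_I \<and>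
            (AE s in lebesgue_on {a..b}.
               xh s = D_op a b n0 n1 n2 (T_op a b n0 n1 n2 B B_I xh) s))"
proof -
  interpret admissible_boundary_conditions a b n0 n1 n2 n_BC B B_I
    by standard (fact assms)+
  have row: "dim_row B = nS" using B_carrier' by simp
  have ab: "a \<in> {a..b}" "b \<in> {a..b}" using \<open>a < b\<close> by auto
  have "D_op a b n0 n1 n2 x \<in> L2_vec a b nx \<and>
      (AE s in lebesgue_on {a..b}. x s = T_op a b n0 n1 n2 B B_I (D_op a b n0 n1 n2 x) s)"
    if "x \<in> X_dom a b n0 n1 n2 B B_I" for x
  proof
    have x: "x \<in> W_n a b n0 n1 n2" and bc: "B *\<^sub>v (x_c a b n0 n1 n2 x a @\<^sub>v x_c a b n0 n1 n2 x b) =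
        integral_vec nS {a..b} (\<lambda>s. B_I s *\<^sub>v x_D a b n0 n1 n2 x s)"
      using that by (auto simp: X_dom_def row)
    define v where "v = D_op a b n0 n1 n2 x"
    define c where "c = x_c a b n0 n1 n2 x a"
    have c: "c \<in> carrier_vec nS" by (simp add: c_def carrier_vecI)
    have v: "v \<in> L2_vec a b nx" unfolding v_def by (rule D_op_in_L2_vec[OF \<open>a < b\<close> x])
    then show "D_op a b n0 n1 n2 x \<in> L2_vec a b nx" by (simp add: v_def)
    let ?Z = "state_traj a n0 n1 n2 c v"
    have xc: "x_c a b n0 n1 n2 x s = ?Z s" if "s \<in> {a..b}" for s
      unfolding v_def c_def by (rule x_c_eq_state_traj[OF \<open>a < b\<close> x that])
    have "AE s in lebesgue_on {a..b}. B_I s *\<^sub>v x_D a b n0 n1 n2 x s = B_I s *\<^sub>v (U1 *\<^sub>v v s + U2 *\<^sub>v ?Z s)"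
      using AE_x_D_eq[OF \<open>a < b\<close> x] AE_space[of "lebesgue_on {a..b}"]
      by eventually_elim (simp add: xc v_def)
    then have "integral_vec nS {a..b} (\<lambda>s. B_I s *\<^sub>v x_D a b n0 n1 n2 x s) =
        integral_vec nS {a..b} (\<lambda>s. B_I s *\<^sub>v (U1 *\<^sub>v v s + U2 *\<^sub>v ?Z s))"
      by (rule integral_vec_cong_AE) simp
    with bc have "B *\<^sub>v (?Z a @\<^sub>v ?Z b) =
        integral_vec nS {a..b} (\<lambda>s. B_I s *\<^sub>v (U1 *\<^sub>v v s + U2 *\<^sub>v ?Z s))"
      by (simp add: xc[OF ab(1)] xc[OF ab(2)])
    then have c_eq: "integral_vec nS {a..b} (\<lambda>\<theta>. BQ \<theta> *\<^sub>v v \<theta>) = c"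
      using boundary_condition_iff[OF v c] by simp
    note T = T_op_eq[OF v, unfolded c_eq]
    have "AE s in lebesgue_on {a..b}. x s = T_op a b n0 n1 n2 B B_I v s"
    proof (rule AE_vec_eqI)
      fix i assume i: "i < nx"
      show "AE s in lebesgue_on {a..b}. x s $ i = T_op a b n0 n1 n2 B B_I v s $ i"
      proof (cases "i < n0")
        case True
        then have "v s $ i = x s $ i" for s by (simp add: v_def D_op_index)
        with True show ?thesis by (intro AE_I2) (simp add: T(2))
      next
        case False
        then obtain k where k: "i = n0 + k" using le_Suc_ex[of n0 i] by auto
        then have "k < n1 + n2" using i by (simp add: n_x_def)
        note T3 = T(3)[OF _ this]
        from AE_eq_x_c[OF \<open>a < b\<close> x \<open>k < n1 + n2\<close>] AE_space[of "lebesgue_on {a..b}"]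
        show ?thesis unfolding k by eventually_elim (simp add: T3 xc)
      qed
    qed (use x T(1) in \<open>auto simp: W_n_iff\<close>)
    then show "AE s in lebesgue_on {a..b}. x s = T_op a b n0 n1 n2 B B_I (D_op a b n0 n1 n2 x) s"
      by (simp add: v_def)
  qed
  moreover have "T_op a b n0 n1 n2 B B_I v \<in> X_dom a b n0 n1 n2 B B_I \<and>
      (AE s in lebesgue_on {a..b}. v s = D_op a b n0 n1 n2 (T_op a b n0 n1 n2 B B_I v) s)"
    if v: "v \<in> L2_vec a b nx" for v
  proof
    define x where "x = T_op a b n0 n1 n2 B B_I v"
    define c where "c = integral_vec nS {a..b} (\<lambda>\<theta>. BQ \<theta> *\<^sub>v v \<theta>)"
    have c: "c \<in> carrier_vec nS" by (simp add: c_def)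
    let ?Z = "state_traj a n0 n1 n2 c v"
    note T = T_op_eq[OF v, folded c_def x_def]
    have x: "x \<in> W_n a b n0 n1 n2"
      by (rule state_traj_in_W_n[OF \<open>a < b\<close> v c T])
    have xc: "x_c a b n0 n1 n2 x s = ?Z s" if "s \<in> {a..b}" for s
      by (rule x_c_of_state_traj[OF \<open>a < b\<close> v c T that])
    have D: "AE s in lebesgue_on {a..b}. D_op a b n0 n1 n2 x s = v s"
      by (rule D_op_of_state_traj[OF \<open>a < b\<close> v c T])
    then show "AE s in lebesgue_on {a..b}. v s = D_op a b n0 n1 n2 (T_op a b n0 n1 n2 B B_I v) s"
      unfolding x_def by (auto elim: eventually_mono)
    have "AE s in lebesgue_on {a..b}. B_I s *\<^sub>v x_D a b n0 n1 n2 x s = B_I s *\<^sub>v (U1 *\<^sub>v v s + U2 *\<^sub>v ?Z s)"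
      using AE_x_D_eq[OF \<open>a < b\<close> x] D AE_space[of "lebesgue_on {a..b}"]
      by eventually_elim (simp add: xc)
    then have "integral_vec nS {a..b} (\<lambda>s. B_I s *\<^sub>v x_D a b n0 n1 n2 x s) =
        integral_vec nS {a..b} (\<lambda>s. B_I s *\<^sub>v (U1 *\<^sub>v v s + U2 *\<^sub>v ?Z s))"
      by (rule integral_vec_cong_AE) simp
    also have "\<dots> = B *\<^sub>v (?Z a @\<^sub>v ?Z b)"
      using boundary_condition_iff[OF v c] by (simp add: c_def)
    finally show "T_op a b n0 n1 n2 B B_I v \<in> X_dom a b n0 n1 n2 B B_I"
      using x xc[OF ab(1)] xc[OF ab(2)] unfolding x_def by (simp add: X_dom_def row)
  qed
  ultimately show ?thesis by blast
qed

end
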